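(* Let $\gamma\in(1,3)$ and $\theta=\frac{\gamma-1}{2}$. Let $(\sigma_0,\beta_0) \in L^\infty(\mathbb{R}) \cap C^1(\mathbb{R})$ (with $\sigma_0\ge 0$) and set $w_1(0,\cdot)=\beta_0+\frac{\sigma_0^\theta}{\theta}$, $w_2(0,\cdot)=\beta_0-\frac{\sigma_0^\theta}{\theta}$. Assume $$\inf_\mathbb{R} w_1(0,\cdot) > 0 > \sup_\mathbb{R} w_2(0,\cdot),$$ and $$\big(\sup_\mathbb{R} w_1(0,\cdot)-\theta \inf_\mathbb{R} w_1(0,\cdot)\big) + (1+\theta)\sup_\mathbb{R} w_2(0,\cdot) < 0,$$ $$(1+\theta)\inf_\mathbb{R}w_1(0,\cdot) - \big( \theta \sup_\mathbb{R} w_2(0,\cdot)-\inf_\mathbb{R}w_2(0,\cdot) \big) > 0.$$ Then there exists a unique global $C^1$ solution $(\sigma,\beta)$ of the isentropic Carrollian fluid equations with exponent $\gamma$ and initial data $(\sigma_0,\beta_0)$ if and only if $$w_{1x}(0,x) \leq 0 \quad \text{and} \quad w_{2x}(0,x) \leq 0 \quad \text{for all } x \in \mathbb{R}. \qquad ( * )$$ If condition $( * )$ fails, then, denoting by $T^*$ the smallest time at which the solution ceases to be $C^1$, there hold for all $t \in (0,T^* )$ the one-sided Lipschitz bounds $$\inf_{\mathbb{R}} w_{jx}(t,\cdot) \geq - \frac{C}{t} \qquad (j=1,2),$$ with the constant $C>0$ depending only on the initial data.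
   Context: The isentropic Carrollian fluid equations with exponent $\gamma$, for unknowns $\sigma,\beta$ depending on $(t,x)$ with $t>0$, $x\in\mathbb{R}$, are $$\partial_t (\sigma \beta) + \partial_x \sigma = 0, \qquad \partial_t \left(\gamma^{-1} \sigma^\gamma + \sigma \beta^2\right) + \partial_x (\sigma \beta) = 0.$$ Let $T>0$ and $(\sigma_0,\beta_0)\in C^1(\mathbb{R})$ with $\sigma_0\ge 0$. A pair $(\sigma,\beta)$ is a $C^1$ solution on $(0,T)\times\mathbb{R}$ if $\sigma,\beta\in C^1([0,T)\times\mathbb{R})$, $\sigma\ge 0$ on $[0,T)\times\mathbb{R}$, and the equations hold pointwise for all $(t,x)\in(0,T)\times\mathbb{R}$; it has initial data $(\sigma_0,\beta_0)$ if in addition $(\sigma(0,x),\beta(0,x))=(\sigma_0(x),\beta_0(x))$ for all $x\in\mathbb{R}$. It is a global $C^1$ solution if it is a $C^1$ solution on $(0,T)\times\mathbb{R}$ for all $T>0$. The smallest time at which the solution ceases to be $C^1$ is the supremum of those $T>0$ for which a $C^1$ solution with the given initial data exists on $(0,T)\times\mathbb{R}$ (with supremum of the empty set equal to $0$). For a solution $(\sigma,\beta)$, write $w_1(t,x)=\beta(t,x)+\frac{\sigma(t,x)^\theta}{\theta}$, $w_2(t,x)=\beta(t,x)-\frac{\sigma(t,x)^\theta}{\theta}$, and $w_{jx}=\partial_x w_j$. The exponent $\gamma$ is regarded as fixed (so $C$ may depend on $\gamma$). *)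

theory Defs
  imports "HOL-Analysis.Analysis"
begin

definition Linfty :: "(real \<Rightarrow> real) \<Rightarrow> bool" where
  "Linfty f \<longleftrightarrow>
     f \<in> borel_measurable lborel \<and> (\<exists>K. AE x in lborel. \<bar>f x\<bar> \<le> K)"

text \<open>Class \<open>C\<^sup>1\<close> for functions of \<open>(t, x)\<close>. On \<open>S = [0,T) \<times> \<real>\<close> the derivative within \<open>S\<close> is
  unique; it is the usual one for \<open>t > 0\<close>, and one-sided in time on the line \<open>t = 0\<close>.\<close>

definition C1_on :: "(real \<times> real) set \<Rightarrow> (real \<times> real \<Rightarrow> real) \<Rightarrow> bool" where
  "C1_on S f \<longleftrightarrow>
     (\<exists>ft fx. continuous_on S ft \<and> continuous_on S fx \<and>
        (\<forall>p\<in>S. (f has_derivative (\<lambda>(h, k). ft p * h + fx p * k)) (at p within S)))"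

definition dt :: "(real \<times> real \<Rightarrow> real) \<Rightarrow> real \<Rightarrow> real \<Rightarrow> real" where
  "dt f t x = deriv (\<lambda>s. f (s, x)) t"

definition dx :: "(real \<times> real \<Rightarrow> real) \<Rightarrow> real \<Rightarrow> real \<Rightarrow> real" where
  "dx f t x = deriv (\<lambda>y. f (t, y)) x"

text \<open>For \<open>\<gamma> > 1\<close> and nonnegative \<open>\<sigma>\<close> of class \<open>C\<^sup>1\<close>, all functions differentiated here are of class
  \<open>C\<^sup>1\<close>, also where \<open>\<sigma>\<close> vanishes, so \<^const>\<open>deriv\<close> is a genuine derivative in the two equations.\<close>

definition C1_solution ::
  "real \<Rightarrow> real \<Rightarrow> (real \<times> real \<Rightarrow> real) \<Rightarrow> (real \<times> real \<Rightarrow> real) \<Rightarrow> bool" where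
  "C1_solution \<gamma> T \<sigma> \<beta> \<longleftrightarrow>
     C1_on ({0..<T} \<times> UNIV) \<sigma> \<and> C1_on ({0..<T} \<times> UNIV) \<beta> \<and>
     (\<forall>t\<in>{0..<T}. \<forall>x. \<sigma> (t, x) \<ge> 0) \<and>
     (\<forall>t\<in>{0<..<T}. \<forall>x.
        dt (\<lambda>p. \<sigma> p * \<beta> p) t x + dx \<sigma> t x = 0 \<and>
        dt (\<lambda>p. inverse \<gamma> * \<sigma> p powr \<gamma> + \<sigma> p * (\<beta> p)\<^sup>2) t x + dx (\<lambda>p. \<sigma> p * \<beta> p) t x = 0)"

definition global_C1_solution ::
  "real \<Rightarrow> (real \<times> real \<Rightarrow> real) \<Rightarrow> (real \<times> real \<Rightarrow> real) \<Rightarrow> bool" where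
  "global_C1_solution \<gamma> \<sigma> \<beta> \<longleftrightarrow> (\<forall>T>0. C1_solution \<gamma> T \<sigma> \<beta>)"

definition has_initial_data ::
  "(real \<times> real \<Rightarrow> real) \<Rightarrow> (real \<times> real \<Rightarrow> real) \<Rightarrow>
   (real \<Rightarrow> real) \<Rightarrow> (real \<Rightarrow> real) \<Rightarrow> bool" where
  "has_initial_data \<sigma> \<beta> \<sigma>\<^sub>0 \<beta>\<^sub>0 \<longleftrightarrow> (\<forall>x. \<sigma> (0, x) = \<sigma>\<^sub>0 x \<and> \<beta> (0, x) = \<beta>\<^sub>0 x)"

text \<open>The inserted \<open>0\<close> makes the supremum over the empty set equal to \<open>0\<close>.\<close>

definition C1_lifespan :: "real \<Rightarrow> (real \<Rightarrow> real) \<Rightarrow> (real \<Rightarrow> real) \<Rightarrow> ereal" where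
  "C1_lifespan \<gamma> \<sigma>\<^sub>0 \<beta>\<^sub>0 =
     Sup (insert 0 (ereal ` {T. T > 0 \<and>
       (\<exists>\<sigma> \<beta>. C1_solution \<gamma> T \<sigma> \<beta> \<and> has_initial_data \<sigma> \<beta> \<sigma>\<^sub>0 \<beta>\<^sub>0)}))"

text \<open>The domain is left polymorphic so that \<open>w1\<close> and \<open>w2\<close> apply both to initial data (functions of
  \<open>x\<close>) and to solutions (functions of \<open>(t, x)\<close>).\<close>

definition w1 :: "real \<Rightarrow> ('a \<Rightarrow> real) \<Rightarrow> ('a \<Rightarrow> real) \<Rightarrow> 'a \<Rightarrow> real" where
  "w1 \<theta> \<sigma> \<beta> p = \<beta> p + \<sigma> p powr \<theta> / \<theta>"

definition w2 :: "real \<Rightarrow> ('a \<Rightarrow> real) \<Rightarrow> ('a \<Rightarrow> real) \<Rightarrow> 'a \<Rightarrow> real" where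
  "w2 \<theta> \<sigma> \<beta> p = \<beta> p - \<sigma> p powr \<theta> / \<theta>"

end

theory Submission
  imports Defs
begin

text \<open>
  With \<open>x\<close> as evolution variable the system is isentropic gas dynamics, so \<open>w1\<close> and \<open>w2\<close> are Riemann
  invariants: \<open>\<lambda>\<^sub>j \<partial>\<^sub>t w\<^sub>j + \<partial>\<^sub>x w\<^sub>j = 0\<close> with
  \<open>\<lambda>\<^sub>1 = ((1 + \<theta>) w\<^sub>1 + (1 - \<theta>) w\<^sub>2) / 2\<close> and symmetrically for \<open>\<lambda>\<^sub>2\<close>. The hypotheses on the data say
  that \<open>\<lambda>\<^sub>1 > 0 > \<lambda>\<^sub>2\<close> uniformly on the box of values of the data, so vacuum is excluded and
  the speeds \<open>1 / \<lambda>\<^sub>j\<close> are bounded.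

  Bounds on solutions come from looking at the first time at which a family of functions on
  a backward cone becomes nonnegative; this needs no characteristic curves. It gives invariance of the
  box, uniqueness, and, applied to a Riccati equation for a weighted \<open>\<partial>\<^sub>x w\<^sub>j\<close>, the
  lower bound \<open>-C/t\<close> and (with time reversed) the blow-up of positive derivatives. Since solutions are only
  \<open>C\<^sup>1\<close>, the Riccati equation is derived for difference quotients, with an error that is
  uniformly small on compact sets.

  For nonincreasing Riemann invariants, take the feet \<open>(\<alpha>, \<beta>)\<close> of the two characteristics through a point
  as coordinates. There \<open>w\<^sub>1 = W\<^sub>1(\<alpha>)\<close> and \<open>w\<^sub>2 = W\<^sub>2(\<beta>)\<close> are known, and
  \<open>t(\<alpha>, \<beta>)\<close>, \<open>x(\<alpha>, \<beta>)\<close> solve a linear hyperbolic system, which is a Volterra equation with nonnegative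
  kernel. Its solution makes \<open>(\<alpha>, \<beta>) \<mapsto> (t, x)\<close> a bijection of \<open>{\<alpha> \<le> \<beta>}\<close> onto the half plane
  with Lipschitz inverse.
\<close>

text \<open>The equations for \<open>w1\<close>, \<open>w2\<close> are available only where
  \<open>\<sigma>\<close> is positive, while positivity comes from the gap
  \<open>\<lambda>\<^sub>1 - \<lambda>\<^sub>2 = \<theta> * (w1 - w2)\<close>. Invariance of the box
  and absence of vacuum therefore have to be proved together. The weighted derivative Z satisfies Z'
  \<ge> c Z^2 along its characteristic, and this serves twice. Forward in time, -t Z stays below a
  constant whatever the initial slope was; backward, a solution bounded at a late time must have had
  small Z. Factors 2 and 1/2 in the comparison functions pay for the error of the difference
  quotients. In characteristic coordinates x_\<beta> = t_\<beta> / \<open>\<lambda>\<^sub>1\<close>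
  and x_\<alpha> = t_\<alpha> / \<open>\<lambda>\<^sub>2\<close>; their compatibility is one
  equation for the mixed derivative of t. Nonincreasing data make the inverse speeds nondecreasing
  in \<alpha> and \<beta> respectively, which is the sign of the kernel. So t_\<beta> and
  -t_\<alpha> never drop below their values on the diagonal, and the change of coordinates cannot
  degenerate.\<close>

section \<open>A first-time principle on backward cones\<close>

text \<open>Compactness gives an earliest point where some member of \<open>F\<close> is
  nonnegative; there all members are \<le> 0 and one vanishes. A step back in time along the slope
  \<open>m\<close> stays in the cone because \<open>\<bar>m\<bar> \<le> M\<close>, and
  \<open>d < 0\<close> makes that member positive earlier. The whole family enters
  \<open>step\<close> so that its members can bound each other.\<close>

lemma cone_first_time:
  fixes F :: "(real \<times> real \<Rightarrow> real) set" and M \<tau> x\<^sub>0 :: real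
  defines "K \<equiv> {(t, x). 0 \<le> t \<and> t \<le> \<tau> \<and> \<bar>x - x\<^sub>0\<bar> \<le> M * (\<tau> - t)}"
  assumes "finite F" "0 \<le> M"
    and cont: "\<And>f. f \<in> F \<Longrightarrow> continuous_on K f"
    and init: "\<And>f x. f \<in> F \<Longrightarrow> (0, x) \<in> K \<Longrightarrow> f (0, x) < 0"
    and step: "\<And>f t x. f \<in> F \<Longrightarrow> (t, x) \<in> K \<Longrightarrow> 0 < t \<Longrightarrow> \<forall>g\<in>F. g (t, x) \<le> 0 \<Longrightarrow> f (t, x) = 0 \<Longrightarrow>
      \<exists>m d. \<bar>m\<bar> \<le> M \<and> d < 0 \<and> ((\<lambda>r. f (t + r, x + m * r)) has_real_derivative d) (at 0)"
    and f_in: "f \<in> F" and p_in: "p \<in> K"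
  shows "f p < 0"
proof (rule ccontr)
  assume "\<not> f p < 0"
  have cK: "compact K"
  proof (rule compact_Int_closed[of "{0..\<tau>} \<times> {x\<^sub>0 - M * \<tau>..x\<^sub>0 + M * \<tau>}" K, THEN back_subst[of compact]])
    show "closed K"
      unfolding K_def case_prod_beta'
      by (intro closed_Collect_conj closed_Collect_le continuous_intros)
    show "{0..\<tau>} \<times> {x\<^sub>0 - M * \<tau>..x\<^sub>0 + M * \<tau>} \<inter> K = K"
    proof -
      have "(t, x) \<in> {0..\<tau>} \<times> {x\<^sub>0 - M * \<tau>..x\<^sub>0 + M * \<tau>}" if "(t, x) \<in> K" for t x
      proof -
        have "M * (\<tau> - t) \<le> M * \<tau>"
          using that \<open>0 \<le> M\<close> by (intro mult_left_mono) (auto simp: K_def)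
        then show ?thesis using that by (auto simp: K_def)
      qed
      then have "K \<subseteq> {0..\<tau>} \<times> {x\<^sub>0 - M * \<tau>..x\<^sub>0 + M * \<tau>}" by (rule subrelI)
      then show ?thesis by blast
    qed
  qed (intro compact_Times compact_Icc)
  define Z where "Z = (\<Union>g\<in>F. {z \<in> K. 0 \<le> g z})"
  have "compact {z \<in> K. 0 \<le> g z}" if "g \<in> F" for g
  proof -
    have "closedin (top_of_set K) (K \<inter> g -` {0..})"
      using cont[OF that] by (intro continuous_closedin_preimage) auto
    then have "compact (K \<inter> g -` {0..})" using cK closedin_compact by blast
    moreover have "K \<inter> g -` {0..} = {z \<in> K. 0 \<le> g z}" by auto
    ultimately show ?thesis by simp
  qed
  then have "compact Z" unfolding Z_def using \<open>finite F\<close> by (intro compact_UN) auto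
  moreover have "p \<in> Z" using f_in p_in \<open>\<not> f p < 0\<close> by (auto simp: Z_def not_less)
  ultimately obtain z where z: "z \<in> Z" and zmin: "\<And>y. y \<in> Z \<Longrightarrow> fst z \<le> fst y"
    using continuous_attains_inf[of Z fst] continuous_on_fst[OF continuous_on_id, of Z] by blast
  obtain t x where tx: "z = (t, x)" by (cases z)
  have txK: "(t, x) \<in> K" using z tx by (auto simp: Z_def)
  then have t\<tau>: "0 \<le> t" "t \<le> \<tau>" and xc: "\<bar>x - x\<^sub>0\<bar> \<le> M * (\<tau> - t)" by (auto simp: K_def)
  obtain g where g: "g \<in> F" "0 \<le> g (t, x)" using z tx by (auto simp: Z_def)
  have before: "h (s, y) < 0" if "h \<in> F" "(s, y) \<in> K" "s < t" for h s y
    using zmin[of "(s, y)"] that tx by (force simp: Z_def)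
  have "0 < t" using init[of g x] g txK t\<tau> by (cases "t = 0") auto
  have inK: "(t - r, x - m * r) \<in> K" if "0 \<le> r" "r \<le> t" "\<bar>m\<bar> \<le> M" for r m
  proof -
    have "\<bar>m * r\<bar> \<le> M * r" using that by (auto simp: abs_mult intro: mult_right_mono)
    then have "\<bar>x - m * r - x\<^sub>0\<bar> \<le> M * (\<tau> - (t - r))" using xc by (auto simp: algebra_simps)
    then show ?thesis using that t\<tau> by (auto simp: K_def)
  qed
  \<comment> \<open>Approach from earlier times on a segment of slope 0, where everything is still
    negative.\<close>
  have le0: "h (t, x) \<le> 0" if h: "h \<in> F" for h
  proof -
    have "continuous_on {0..t} (\<lambda>r. h (t - r, x))"
    proof (rule continuous_on_compose2[OF cont[OF h], of _ "\<lambda>r. (t - r, x)"])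
      show "(\<lambda>r. (t - r, x)) ` {0..t} \<subseteq> K" using inK[of _ 0] \<open>0 \<le> M\<close> by auto
    qed (intro continuous_intros)
    then have "((\<lambda>r. h (t - r, x)) \<longlongrightarrow> h (t, x)) (at 0 within {0..t})"
      using t\<tau> by (auto simp: continuous_on_def dest: bspec[of _ _ 0])
    then have lim: "((\<lambda>r. h (t - r, x)) \<longlongrightarrow> h (t, x)) (at_right 0)"
      using \<open>0 < t\<close> by (simp add: at_within_Icc_at_right)
    have "eventually (\<lambda>r. h (t - r, x) \<le> 0) (at_right 0)"
      using eventually_at_right_real[OF \<open>0 < t\<close>]
    proof eventually_elim
      case (elim r)
      then show ?case using before[OF h, of "t - r" x] inK[of r 0] \<open>0 \<le> M\<close> by auto
    qed
    then show ?thesis by (rule tendsto_upperbound[OF lim]) simp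
  qed
  have "g (t, x) = 0" using le0[OF g(1)] g by simp
  then obtain m d where md: "\<bar>m\<bar> \<le> M" "d < 0"
    and der: "((\<lambda>r. g (t + r, x + m * r)) has_real_derivative d) (at 0)"
    using step[OF g(1) txK \<open>0 < t\<close>] le0 by blast
  from has_real_derivative_neg_dec_left[OF der md(2)] obtain \<delta> where \<delta>: "0 < \<delta>"
    "\<And>r. 0 < r \<Longrightarrow> r < \<delta> \<Longrightarrow> g (t, x) < g (t + (0 - r), x + m * (0 - r))"
    by auto
  define r where "r = min (\<delta> / 2) t"
  have r: "0 < r" "r < \<delta>" "r \<le> t" using \<delta>(1) \<open>0 < t\<close> by (auto simp: r_def)
  then have "g (t - r, x - m * r) > 0" using \<delta>(2)[of r] \<open>g (t, x) = 0\<close> by simp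
  moreover have "g (t - r, x - m * r) < 0" using before[OF g(1)] inK[of r m] r md by auto
  ultimately show False by simp
qed

section \<open>Functions of class C1 on strips\<close>

text \<open>Names the partial derivatives that \<open>C1_on\<close> hides under its quantifier, so
  that locales and estimates can refer to them.\<close>

definition C1_partials ::
  "(real \<times> real) set \<Rightarrow> (real \<times> real \<Rightarrow> real) \<Rightarrow> (real \<times> real \<Rightarrow> real) \<Rightarrow> (real \<times> real \<Rightarrow> real) \<Rightarrow> bool" where
  "C1_partials S f ft fx \<longleftrightarrow> continuous_on S ft \<and> continuous_on S fx \<and>
     (\<forall>p\<in>S. (f has_derivative (\<lambda>(h, k). ft p * h + fx p * k)) (at p within S))"

lemma C1_on_iff: "C1_on S f \<longleftrightarrow> (\<exists>ft fx. C1_partials S f ft fx)"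
  by (simp add: C1_on_def C1_partials_def)

lemma C1_partials_continuous: "C1_partials S f ft fx \<Longrightarrow> continuous_on S f"
  using has_derivative_continuous_on[of S f "\<lambda>p (h, k). ft p * h + fx p * k"]
  by (simp add: C1_partials_def)

text \<open>For \<open>t > 0\<close> the point is interior to the strip, so the derivative along a
  line is two-sided, as \<open>cone_first_time\<close> requires.\<close>

lemma C1_partials_line:
  assumes "C1_partials ({0..<T} \<times> UNIV) f ft fx" "0 < t" "t < T"
  shows "((\<lambda>r. f (t + k * r, x + m * r)) has_real_derivative (k * ft (t, x) + m * fx (t, x))) (at 0)"
proof -
  have "(t, x) \<in> {0<..<T} \<times> UNIV" using assms by auto
  moreover have "open ({0<..<T} \<times> (UNIV :: real set))" by (intro open_Times) auto
  moreover have "{0<..<T} \<times> (UNIV :: real set) \<subseteq> {0..<T} \<times> UNIV" by auto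
  ultimately have "at (t, x) within ({0..<T} \<times> UNIV) = at (t, x)"
    by (metis at_within_interior interiorI)
  moreover have "(f has_derivative (\<lambda>(h, k). ft (t, x) * h + fx (t, x) * k)) (at (t, x) within {0..<T} \<times> UNIV)"
    using assms unfolding C1_partials_def by force
  ultimately have "(f has_derivative (\<lambda>(h, k). ft (t, x) * h + fx (t, x) * k)) (at (t + k * 0, x + m * 0))"
    by simp
  moreover have "((\<lambda>r. (t + k * r, x + m * r)) has_derivative (\<lambda>h. (k * h, m * h))) (at 0)"
    by (auto intro!: derivative_eq_intros)
  ultimately have "((\<lambda>r. f (t + k * r, x + m * r)) has_derivative
      (\<lambda>h. case (k * h, m * h) of (h, k) \<Rightarrow> ft (t, x) * h + fx (t, x) * k)) (at 0)"
    by (rule has_derivative_compose[rotated])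
  then show ?thesis
    by (rule has_derivative_imp_has_field_derivative) (simp add: algebra_simps)
qed

text \<open>This includes \<open>t = 0\<close>, since the horizontal line through the point lies
  inside the strip.\<close>

lemma C1_partials_dx:
  assumes "C1_partials ({0..<T} \<times> UNIV) f ft fx" "0 \<le> t" "t < T"
  shows "((\<lambda>y. f (t, y)) has_real_derivative fx (t, x)) (at x)"
proof -
  have "(f has_derivative (\<lambda>(h, k). ft (t, x) * h + fx (t, x) * k)) (at (t, x) within {0..<T} \<times> UNIV)"
    using assms unfolding C1_partials_def by force
  moreover have "range (Pair t) \<subseteq> {0..<T} \<times> (UNIV :: real set)" using assms by auto
  ultimately have "(f has_derivative (\<lambda>(h, k). ft (t, x) * h + fx (t, x) * k)) (at (t, x) within range (Pair t))"
    by (rule has_derivative_subset)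
  moreover have "(Pair t has_derivative (\<lambda>h. (0, h))) (at x)"
    by (auto intro!: derivative_eq_intros)
  ultimately have "((\<lambda>y. f (t, y)) has_derivative (\<lambda>h. case (0, h) of (h, k) \<Rightarrow> ft (t, x) * h + fx (t, x) * k)) (at x)"
    by (rule has_derivative_in_compose[rotated])
  then show ?thesis
    by (rule has_derivative_imp_has_field_derivative) (simp add: algebra_simps)
qed

lemma C1_partials_dt:
  assumes "C1_partials ({0..<T} \<times> UNIV) f ft fx" "0 < t" "t < T"
  shows "((\<lambda>s. f (s, x)) has_real_derivative ft (t, x)) (at t)"
  using C1_partials_line[OF assms, of 1 x 0] DERIV_shift[of "\<lambda>s. f (s, x)" "ft (t, x)" 0 t]
  by (simp add: add.commute)

lemma C1_partials_subset:
  assumes "C1_partials S f ft fx" "R \<subseteq> S"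
  shows "C1_partials R f ft fx"
  unfolding C1_partials_def
proof (intro conjI ballI)
  show "continuous_on R ft" "continuous_on R fx"
    by (rule continuous_on_subset[OF _ assms(2)]; use assms(1) in \<open>simp add: C1_partials_def\<close>)+
  fix p assume "p \<in> R"
  then show "(f has_derivative (\<lambda>(h, k). ft p * h + fx p * k)) (at p within R)"
    by (intro has_derivative_subset[OF _ assms(2)]) (use assms in \<open>auto simp: C1_partials_def\<close>)
qed

lemma C1_partials_compose:
  assumes f: "\<And>x. (f has_real_derivative f' x) (at x)" "continuous_on UNIV f'"
    and a: "C1_partials S a a1 a2"
  shows "C1_partials S (\<lambda>w. f (a w)) (\<lambda>w. f' (a w) * a1 w) (\<lambda>w. f' (a w) * a2 w)"
  unfolding C1_partials_def
proof (intro conjI ballI)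
  have "continuous_on S (\<lambda>w. f' (a w))"
    by (rule continuous_on_compose2[OF f(2) C1_partials_continuous[OF a]]) auto
  then show "continuous_on S (\<lambda>w. f' (a w) * a1 w)" "continuous_on S (\<lambda>w. f' (a w) * a2 w)"
    using a by (auto simp: C1_partials_def intro!: continuous_intros)
  fix w assume "w \<in> S"
  then have "(a has_derivative (\<lambda>(h, k). a1 w * h + a2 w * k)) (at w within S)"
    using a by (auto simp: C1_partials_def)
  moreover have "(f has_derivative (\<lambda>h. f' (a w) * h)) (at (a w))"
    using f(1)[of "a w"] by (simp add: has_field_derivative_def)
  ultimately have "((\<lambda>w. f (a w)) has_derivative (\<lambda>h. f' (a w) * (case h of (h, k) \<Rightarrow> a1 w * h + a2 w * k))) (at w within S)"
    by (rule has_derivative_compose)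
  then show "((\<lambda>w. f (a w)) has_derivative (\<lambda>(h, k). f' (a w) * a1 w * h + f' (a w) * a2 w * k)) (at w within S)"
    by (rule has_derivative_eq_rhs) (auto simp: fun_eq_iff algebra_simps)
qed

section \<open>Riemann invariants of the fluid equations\<close>

text \<open>In fluid variables \<open>lam \<theta> w1 w2\<close> is
  \<open>\<beta> + \<sigma> powr \<theta>\<close> and \<open>lam \<theta> w2 w1\<close> is
  \<open>\<beta> - \<sigma> powr \<theta>\<close>. Swapping the arguments exchanges the two
  families, which lets one locale treat both.\<close>

definition lam :: "real \<Rightarrow> real \<Rightarrow> real \<Rightarrow> real" where
  "lam \<theta> u v = ((1 + \<theta>) * u + (1 - \<theta>) * v) / 2"

lemma lam_diff: "lam \<theta> u v - lam \<theta> v u = \<theta> * (u - v)"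
  by (simp add: lam_def field_simps)

text \<open>For 0 < \<theta> < 1 the value is a convex combination of the arguments, hence
  1-Lipschitz in the maximum norm. With (0, 0) as second point this also bounds the speed
  itself.\<close>

lemma lam_lipschitz:
  assumes "0 < \<theta>" "\<theta> < 1" "\<bar>u - u'\<bar> \<le> \<eta>" "\<bar>v - v'\<bar> \<le> \<eta>"
  shows "\<bar>lam \<theta> u v - lam \<theta> u' v'\<bar> \<le> \<eta>"
proof -
  have "lam \<theta> u v - lam \<theta> u' v' = (1 + \<theta>) / 2 * (u - u') + (1 - \<theta>) / 2 * (v - v')"
    by (simp add: lam_def field_simps)
  also have "\<bar>\<dots>\<bar> \<le> (1 + \<theta>) / 2 * \<bar>u - u'\<bar> + (1 - \<theta>) / 2 * \<bar>v - v'\<bar>"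
    using assms by (intro order_trans[OF abs_triangle_ineq]) (simp add: abs_mult)
  also have "\<dots> \<le> (1 + \<theta>) / 2 * \<eta> + (1 - \<theta>) / 2 * \<eta>"
    using assms by (intro add_mono mult_left_mono) auto
  also have "\<dots> = \<eta>" by (simp add: field_simps)
  finally show ?thesis .
qed

lemma w12_diff: "\<theta> \<noteq> 0 \<Longrightarrow> \<theta> * (w1 \<theta> \<sigma> \<beta> p - w2 \<theta> \<sigma> \<beta> p) = 2 * \<sigma> p powr \<theta>"
  by (simp add: w1_def w2_def field_simps)

lemma w12_inverse:
  assumes "\<theta> > 0" "\<sigma> p \<ge> 0"
  shows "\<sigma> p = (\<theta> * (w1 \<theta> \<sigma> \<beta> p - w2 \<theta> \<sigma> \<beta> p) / 2) powr (1 / \<theta>)"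
    and "\<beta> p = (w1 \<theta> \<sigma> \<beta> p + w2 \<theta> \<sigma> \<beta> p) / 2"
  using assms w12_diff[of \<theta> \<sigma> \<beta> p] by (simp_all add: powr_powr w1_def w2_def)

lemma fluid_derivatives:
  assumes p\<sigma>: "C1_partials ({0..<T} \<times> UNIV) \<sigma> \<sigma>t \<sigma>x" and p\<beta>: "C1_partials ({0..<T} \<times> UNIV) \<beta> \<beta>t \<beta>x"
    and t: "0 < t" "t < T" and pos: "0 < \<sigma> (t, x)" and \<gamma>: "\<gamma> \<noteq> 0"
  shows "dt (\<lambda>p. \<sigma> p * \<beta> p) t x = \<sigma>t (t, x) * \<beta> (t, x) + \<sigma> (t, x) * \<beta>t (t, x)"
    and "dx \<sigma> t x = \<sigma>x (t, x)"
    and "dt (\<lambda>p. inverse \<gamma> * \<sigma> p powr \<gamma> + \<sigma> p * (\<beta> p)\<^sup>2) t x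
      = \<sigma> (t, x) powr (\<gamma> - 1) * \<sigma>t (t, x) + (\<sigma>t (t, x) * (\<beta> (t, x))\<^sup>2 + \<sigma> (t, x) * (2 * \<beta> (t, x) * \<beta>t (t, x)))"
    and "dx (\<lambda>p. \<sigma> p * \<beta> p) t x = \<sigma>x (t, x) * \<beta> (t, x) + \<sigma> (t, x) * \<beta>x (t, x)"
proof -
  note [derivative_intros] = C1_partials_dt[OF p\<sigma> t] C1_partials_dt[OF p\<beta> t]
    C1_partials_dx[OF p\<sigma> less_imp_le[OF t(1)] t(2)] C1_partials_dx[OF p\<beta> less_imp_le[OF t(1)] t(2)]
  show "dt (\<lambda>p. \<sigma> p * \<beta> p) t x = \<sigma>t (t, x) * \<beta> (t, x) + \<sigma> (t, x) * \<beta>t (t, x)"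
    unfolding dt_def by (rule DERIV_imp_deriv) (auto intro!: derivative_eq_intros)
  show "dx \<sigma> t x = \<sigma>x (t, x)"
    unfolding dx_def by (rule DERIV_imp_deriv) (auto intro!: derivative_eq_intros)
  show "dx (\<lambda>p. \<sigma> p * \<beta> p) t x = \<sigma>x (t, x) * \<beta> (t, x) + \<sigma> (t, x) * \<beta>x (t, x)"
    unfolding dx_def by (rule DERIV_imp_deriv) (auto intro!: derivative_eq_intros)
  show "dt (\<lambda>p. inverse \<gamma> * \<sigma> p powr \<gamma> + \<sigma> p * (\<beta> p)\<^sup>2) t x
      = \<sigma> (t, x) powr (\<gamma> - 1) * \<sigma>t (t, x) + (\<sigma>t (t, x) * (\<beta> (t, x))\<^sup>2 + \<sigma> (t, x) * (2 * \<beta> (t, x) * \<beta>t (t, x)))"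
    unfolding dt_def using pos \<gamma>
    by (intro DERIV_imp_deriv) (auto intro!: derivative_eq_intros)
qed

locale fluid_solution =
  fixes \<gamma> \<theta> T :: real and \<sigma> \<beta> \<sigma>t \<sigma>x \<beta>t \<beta>x :: "real \<times> real \<Rightarrow> real"
  assumes gamma: "1 < \<gamma>" "\<gamma> < 3" and theta_eq: "\<theta> = (\<gamma> - 1) / 2"
    and sol: "C1_solution \<gamma> T \<sigma> \<beta>"
    and sigma_partials: "C1_partials ({0..<T} \<times> UNIV) \<sigma> \<sigma>t \<sigma>x"
    and beta_partials: "C1_partials ({0..<T} \<times> UNIV) \<beta> \<beta>t \<beta>x"
begin

lemma theta: "0 < \<theta>" "\<theta> < 1"
  using gamma by (auto simp: theta_eq)

definition w1t where "w1t p = \<beta>t p + \<sigma> p powr (\<theta> - 1) * \<sigma>t p"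
definition w1x where "w1x p = \<beta>x p + \<sigma> p powr (\<theta> - 1) * \<sigma>x p"
definition w2t where "w2t p = \<beta>t p - \<sigma> p powr (\<theta> - 1) * \<sigma>t p"
definition w2x where "w2x p = \<beta>x p - \<sigma> p powr (\<theta> - 1) * \<sigma>x p"

lemma riemann_equations:
  assumes "0 < t" "t < T" "0 < \<sigma> (t, x)"
  shows "lam \<theta> (w1 \<theta> \<sigma> \<beta> (t, x)) (w2 \<theta> \<sigma> \<beta> (t, x)) * w1t (t, x) + w1x (t, x) = 0"
    and "lam \<theta> (w2 \<theta> \<sigma> \<beta> (t, x)) (w1 \<theta> \<sigma> \<beta> (t, x)) * w2t (t, x) + w2x (t, x) = 0"
proof -
  define s b st sx bt bx where "s = \<sigma> (t, x)" and "b = \<beta> (t, x)" and "st = \<sigma>t (t, x)" and "sx = \<sigma>x (t, x)"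
    and "bt = \<beta>t (t, x)" and "bx = \<beta>x (t, x)"
  note defs = this
  have eqs: "dt (\<lambda>p. \<sigma> p * \<beta> p) t x + dx \<sigma> t x = 0"
    "dt (\<lambda>p. inverse \<gamma> * \<sigma> p powr \<gamma> + \<sigma> p * (\<beta> p)\<^sup>2) t x + dx (\<lambda>p. \<sigma> p * \<beta> p) t x = 0"
    using sol assms(1,2) unfolding C1_solution_def by auto
  have "\<gamma> \<noteq> 0" using gamma by simp
  note fd = fluid_derivatives[OF sigma_partials beta_partials assms this]
  have 1: "st * b + s * bt + sx = 0" using eqs(1) unfolding fd(1,2) defs .
  have 2: "s powr (\<gamma> - 1) * st + (st * b\<^sup>2 + s * (2 * b * bt)) + (sx * b + s * bx) = 0"
    using eqs(2) unfolding fd(3,4) defs .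
  have s0: "s > 0" using assms by (simp add: defs)
  define r where "r = s powr (\<theta> - 1)"
  have r: "s powr \<theta> = s * r" "s powr (\<gamma> - 1) = s\<^sup>2 * r\<^sup>2"
    using s0 powr_add[of s 1 "\<theta> - 1"] powr_add[of s \<theta> \<theta>]
    by (auto simp: r_def theta_eq power2_eq_square)
  \<comment> \<open>The second equation minus \<open>b\<close> times the first has the common factor
    \<open>s\<close>. Afterwards, equation 3 plus or minus \<open>r\<close> times equation 1 is the
    equation for \<open>w1\<close> or \<open>w2\<close>.\<close>
  from 1 2 have "s * (s * r\<^sup>2 * st + b * bt + bx) = 0" unfolding r by algebra
  then have 3: "s * r\<^sup>2 * st + b * bt + bx = 0" using s0 by simp
  have l: "lam \<theta> (w1 \<theta> \<sigma> \<beta> (t, x)) (w2 \<theta> \<sigma> \<beta> (t, x)) = b + s * r"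
    "lam \<theta> (w2 \<theta> \<sigma> \<beta> (t, x)) (w1 \<theta> \<sigma> \<beta> (t, x)) = b - s * r"
    unfolding r(1)[symmetric] using theta by (simp_all add: lam_def w1_def w2_def defs field_simps)
  show "lam \<theta> (w1 \<theta> \<sigma> \<beta> (t, x)) (w2 \<theta> \<sigma> \<beta> (t, x)) * w1t (t, x) + w1x (t, x) = 0"
    unfolding l w1t_def w1x_def defs(1-6)[symmetric] r_def[symmetric]
    using 1 3 by algebra
  show "lam \<theta> (w2 \<theta> \<sigma> \<beta> (t, x)) (w1 \<theta> \<sigma> \<beta> (t, x)) * w2t (t, x) + w2x (t, x) = 0"
    unfolding l w2t_def w2x_def defs(1-6)[symmetric] r_def[symmetric]
    using 1 3 by algebra
qed

lemma w_line:
  assumes "0 < t" "t < T" "0 < \<sigma> (t, x)"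
  shows "((\<lambda>r. w1 \<theta> \<sigma> \<beta> (t + r, x + m * r)) has_real_derivative w1t (t, x) + m * w1x (t, x)) (at 0)"
    and "((\<lambda>r. w2 \<theta> \<sigma> \<beta> (t + r, x + m * r)) has_real_derivative w2t (t, x) + m * w2x (t, x)) (at 0)"
proof -
  have "((\<lambda>r. \<sigma> (t + 1 * r, x + m * r) powr \<theta>) has_real_derivative
      \<theta> * \<sigma> (t, x) powr (\<theta> - 1) * (1 * \<sigma>t (t, x) + m * \<sigma>x (t, x))) (at 0)"
    by (rule DERIV_chain2[OF _ C1_partials_line[OF sigma_partials assms(1,2)]])
      (use assms has_real_derivative_powr[of "\<sigma> (t, x)" \<theta>] in auto)
  from DERIV_cdivide[OF this, of \<theta>]
  have \<sigma>': "((\<lambda>r. \<sigma> (t + 1 * r, x + m * r) powr \<theta> / \<theta>) has_real_derivative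
      \<sigma> (t, x) powr (\<theta> - 1) * (1 * \<sigma>t (t, x) + m * \<sigma>x (t, x))) (at 0)"
    using theta by simp
  note \<beta>' = C1_partials_line[OF beta_partials assms(1,2), of 1 x m]
  show "((\<lambda>r. w1 \<theta> \<sigma> \<beta> (t + r, x + m * r)) has_real_derivative w1t (t, x) + m * w1x (t, x)) (at 0)"
    unfolding w1_def w1t_def w1x_def
    using DERIV_add[OF \<beta>' \<sigma>'] theta by (simp add: algebra_simps)
  show "((\<lambda>r. w2 \<theta> \<sigma> \<beta> (t + r, x + m * r)) has_real_derivative w2t (t, x) + m * w2x (t, x)) (at 0)"
    unfolding w2_def w2t_def w2x_def
    using DERIV_diff[OF \<beta>' \<sigma>'] theta by (simp add: algebra_simps)
qed

text \<open>Vacuum is allowed here because \<theta> > 0; derivatives, in contrast, are available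
  only where \<open>\<sigma>\<close> is positive.\<close>

lemma w_continuous:
  shows "continuous_on ({0..<T} \<times> UNIV) (w1 \<theta> \<sigma> \<beta>)" and "continuous_on ({0..<T} \<times> UNIV) (w2 \<theta> \<sigma> \<beta>)"
proof -
  have "continuous_on ({0..<T} \<times> UNIV) (\<lambda>p. \<sigma> p powr \<theta>)"
    using C1_partials_continuous[OF sigma_partials] sol theta
    by (intro continuous_on_powr' continuous_intros) (auto simp: C1_solution_def)
  then show "continuous_on ({0..<T} \<times> UNIV) (w1 \<theta> \<sigma> \<beta>)" "continuous_on ({0..<T} \<times> UNIV) (w2 \<theta> \<sigma> \<beta>)"
    unfolding w1_def w2_def using C1_partials_continuous[OF beta_partials] theta
    by (intro continuous_on_add continuous_on_diff continuous_on_divide continuous_on_const; simp)+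
qed

lemma w_partials:
  assumes pos: "\<And>t x. 0 \<le> t \<Longrightarrow> t < T \<Longrightarrow> 0 < \<sigma> (t, x)"
  shows "C1_partials ({0..<T} \<times> UNIV) (w1 \<theta> \<sigma> \<beta>) w1t w1x"
    and "C1_partials ({0..<T} \<times> UNIV) (w2 \<theta> \<sigma> \<beta>) w2t w2x"
proof -
  let ?S = "{0..<T} \<times> (UNIV :: real set)"
  have c: "continuous_on ?S (\<lambda>p. \<sigma> p powr (\<theta> - 1))"
    using C1_partials_continuous[OF sigma_partials] pos
    by (intro continuous_on_powr continuous_on_const) (auto simp: less_imp_neq[symmetric])
  have cont: "continuous_on ?S w1t" "continuous_on ?S w1x" "continuous_on ?S w2t" "continuous_on ?S w2x"
    unfolding w1t_def w1x_def w2t_def w2x_def using c sigma_partials beta_partials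
    by (auto intro!: continuous_intros simp: C1_partials_def)
  have "((\<lambda>p. \<sigma> p powr \<theta>) has_derivative
      (\<lambda>h. (\<theta> * \<sigma> p powr (\<theta> - 1)) * (case h of (h, k) \<Rightarrow> \<sigma>t p * h + \<sigma>x p * k))) (at p within ?S)" if "p \<in> ?S" for p
  proof (rule has_derivative_in_compose[where g = "\<lambda>y. y powr \<theta>" and g' = "\<lambda>y. \<theta> * \<sigma> p powr (\<theta> - 1) * y"])
    show "(\<sigma> has_derivative (\<lambda>(h, k). \<sigma>t p * h + \<sigma>x p * k)) (at p within ?S)"
      using that sigma_partials unfolding C1_partials_def by blast
    have "\<sigma> p > 0" using that pos by force
    from has_real_derivative_powr[OF this, of \<theta>]
    show "((\<lambda>y. y powr \<theta>) has_derivative (\<lambda>y. \<theta> * \<sigma> p powr (\<theta> - 1) * y)) (at (\<sigma> p) within \<sigma> ` ?S)"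
      by (simp add: has_field_derivative_def has_derivative_at_withinI)
  qed
  from bounded_linear.has_derivative[OF bounded_linear_divide this, of _ \<theta>]
  have s: "((\<lambda>p. \<sigma> p powr \<theta> / \<theta>) has_derivative
      (\<lambda>h. \<sigma> p powr (\<theta> - 1) * (case h of (h, k) \<Rightarrow> \<sigma>t p * h + \<sigma>x p * k))) (at p within ?S)" if "p \<in> ?S" for p
    using that theta by simp
  have b: "(\<beta> has_derivative (\<lambda>(h, k). \<beta>t p * h + \<beta>x p * k)) (at p within ?S)" if "p \<in> ?S" for p
    using that beta_partials unfolding C1_partials_def by blast
  have "(w1 \<theta> \<sigma> \<beta> has_derivative (\<lambda>(h, k). w1t p * h + w1x p * k)) (at p within ?S)"
    "(w2 \<theta> \<sigma> \<beta> has_derivative (\<lambda>(h, k). w2t p * h + w2x p * k)) (at p within ?S)" if "p \<in> ?S" for p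
    unfolding w1_def w2_def w1t_def w1x_def w2t_def w2x_def
     apply (rule has_derivative_eq_rhs[OF has_derivative_add[OF b[OF that] s[OF that]]])
     apply (simp add: fun_eq_iff algebra_simps)
    apply (rule has_derivative_eq_rhs[OF has_derivative_diff[OF b[OF that] s[OF that]]])
    apply (simp add: fun_eq_iff algebra_simps)
    done
  then show "C1_partials ?S (w1 \<theta> \<sigma> \<beta>) w1t w1x" "C1_partials ?S (w2 \<theta> \<sigma> \<beta>) w2t w2x"
    using cont by (auto simp: C1_partials_def)
qed

text \<open>A bootstrap: while the invariants stay within \<open>\<eta> \<le> \<kappa> / 2\<close>
  of the box, \<open>lam_lipschitz\<close> keeps the speeds at distance \<open>\<kappa> / 2\<close>
  from 0, which excludes vacuum and makes the Riemann equations available. The bounds are relaxed by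
  a barrier that grows in time, because invariants constant along characteristics only give
  derivative 0 and the cone principle needs a strict sign.\<close>

lemma invariant_region_approx:
  assumes init: "\<And>x. m1 \<le> w1 \<theta> \<sigma> \<beta> (0, x)" "\<And>x. w1 \<theta> \<sigma> \<beta> (0, x) \<le> M1"
      "\<And>x. m2 \<le> w2 \<theta> \<sigma> \<beta> (0, x)" "\<And>x. w2 \<theta> \<sigma> \<beta> (0, x) \<le> M2"
    and box: "\<And>a b. m1 \<le> a \<Longrightarrow> a \<le> M1 \<Longrightarrow> m2 \<le> b \<Longrightarrow> b \<le> M2 \<Longrightarrow> \<kappa> \<le> lam \<theta> a b \<and> lam \<theta> b a \<le> -\<kappa>"
    and \<tau>: "0 \<le> \<tau>" "\<tau> < T" and \<eta>: "0 < \<eta>" "\<eta> \<le> \<kappa> / 2"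
  shows "0 < \<sigma> (\<tau>, x0)" "m1 - \<eta> < w1 \<theta> \<sigma> \<beta> (\<tau>, x0)" "w1 \<theta> \<sigma> \<beta> (\<tau>, x0) < M1 + \<eta>"
    "m2 - \<eta> < w2 \<theta> \<sigma> \<beta> (\<tau>, x0)" "w2 \<theta> \<sigma> \<beta> (\<tau>, x0) < M2 + \<eta>"
proof -
  \<comment> \<open>The barrier \<open>\<epsilon> * (1 + t)\<close> is positive at time 0 and at
    most \<open>\<eta>\<close> up to time \<open>\<tau>\<close>.\<close>
  define \<epsilon> where "\<epsilon> = \<eta> / (1 + \<tau>)"
  have \<epsilon>: "0 < \<epsilon>" "\<epsilon> * (1 + \<tau>) = \<eta>" using \<tau> \<eta> by (auto simp: \<epsilon>_def)
  have \<kappa>: "0 < \<kappa>" using \<eta> by simp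
  let ?w1 = "w1 \<theta> \<sigma> \<beta>" and ?w2 = "w2 \<theta> \<sigma> \<beta>"
  define K where "K = {(t, x). 0 \<le> t \<and> t \<le> \<tau> \<and> \<bar>x - x0\<bar> \<le> (2 / \<kappa>) * (\<tau> - t)}"
  have KS: "K \<subseteq> {0..<T} \<times> UNIV" using \<tau> by (auto simp: K_def)
  have le: "m1 \<le> M1" "m2 \<le> M2" using init order_trans by blast+
  have near: "0 < \<sigma> (t, x) \<and> \<kappa> / 2 \<le> lam \<theta> (?w1 (t, x)) (?w2 (t, x)) \<and> lam \<theta> (?w2 (t, x)) (?w1 (t, x)) \<le> - (\<kappa> / 2)"
    if "0 \<le> t" "t \<le> \<tau>" "m1 - \<eta> \<le> ?w1 (t, x)" "?w1 (t, x) \<le> M1 + \<eta>" "m2 - \<eta> \<le> ?w2 (t, x)" "?w2 (t, x) \<le> M2 + \<eta>" for t x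
  proof -
    \<comment> \<open>Projection onto the box, where the hypothesis \<open>box\<close>
      applies.\<close>
    define a b where "a = max m1 (min M1 (?w1 (t, x)))" and "b = max m2 (min M2 (?w2 (t, x)))"
    have ab: "\<bar>?w1 (t, x) - a\<bar> \<le> \<eta>" "\<bar>?w2 (t, x) - b\<bar> \<le> \<eta>" "\<kappa> \<le> lam \<theta> a b" "lam \<theta> b a \<le> -\<kappa>"
      using that le \<eta> box[of a b] by (auto simp: a_def b_def)
    have l: "\<kappa> / 2 \<le> lam \<theta> (?w1 (t, x)) (?w2 (t, x))" "lam \<theta> (?w2 (t, x)) (?w1 (t, x)) \<le> - (\<kappa> / 2)"
      using lam_lipschitz[OF theta ab(1,2)] lam_lipschitz[OF theta ab(2,1)] ab(3,4) \<eta> by linarith+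
    then have "\<theta> * (?w1 (t, x) - ?w2 (t, x)) > 0"
      using lam_diff[of \<theta> "?w1 (t, x)" "?w2 (t, x)"] \<kappa> by linarith
    then have "\<sigma> (t, x) \<noteq> 0" using w12_diff[of \<theta> \<sigma> \<beta> "(t, x)"] theta by auto
    moreover have "\<sigma> (t, x) \<ge> 0" using sol that \<tau> by (auto simp: C1_solution_def)
    ultimately show ?thesis using l by simp
  qed
  define F where "F = {\<lambda>p. ?w1 p - M1 - \<epsilon> * (1 + fst p), \<lambda>p. m1 - ?w1 p - \<epsilon> * (1 + fst p),
    \<lambda>p. ?w2 p - M2 - \<epsilon> * (1 + fst p), \<lambda>p. m2 - ?w2 p - \<epsilon> * (1 + fst p)}"
  have main: "f (\<tau>, x0) < 0" if "f \<in> F" for f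
  proof (rule cone_first_time[where F = F and M = "2 / \<kappa>" and \<tau> = \<tau> and x\<^sub>0 = x0, folded K_def, OF _ _ _ _ _ that])
    show "finite F" "0 \<le> 2 / \<kappa>" "(\<tau>, x0) \<in> K" using \<kappa> \<tau> by (auto simp: F_def K_def)
    show "continuous_on K f" if "f \<in> F" for f
      using that continuous_on_subset[OF w_continuous(1) KS] continuous_on_subset[OF w_continuous(2) KS]
      by (auto simp: F_def intro!: continuous_intros)
    show "f (0, x) < 0" if "f \<in> F" for f x
      using that init[of x] \<epsilon>(1) by (auto simp: F_def)
    show "\<exists>m d. \<bar>m\<bar> \<le> 2 / \<kappa> \<and> d < 0 \<and> ((\<lambda>r. f (t + r, x + m * r)) has_real_derivative d) (at 0)"
      if f: "f \<in> F" and tx: "(t, x) \<in> K" "0 < t" and le0: "\<forall>g\<in>F. g (t, x) \<le> 0" for f t x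
    proof -
      have t: "0 < t" "t \<le> \<tau>" "t < T" using tx \<tau> by (auto simp: K_def)
      have "\<epsilon> * (1 + t) \<le> \<eta>" using \<epsilon> t by (metis add_left_mono less_imp_le mult_left_mono)
      then have n: "0 < \<sigma> (t, x)" "\<kappa> / 2 \<le> lam \<theta> (?w1 (t, x)) (?w2 (t, x))" "lam \<theta> (?w2 (t, x)) (?w1 (t, x)) \<le> - (\<kappa> / 2)"
        using near[of t x] le0 t unfolding F_def by auto
      define a b where "a = 1 / lam \<theta> (?w1 (t, x)) (?w2 (t, x))" and "b = 1 / lam \<theta> (?w2 (t, x)) (?w1 (t, x))"
      have ab: "\<bar>a\<bar> \<le> 2 / \<kappa>" "\<bar>b\<bar> \<le> 2 / \<kappa>"
        using n(2,3) \<kappa> by (auto simp: a_def b_def abs_if field_simps)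
      have z: "w1t (t, x) + a * w1x (t, x) = 0" "w2t (t, x) + b * w2x (t, x) = 0"
        using riemann_equations[OF t(1,3) n(1)] n(2,3) \<kappa>
        by (auto simp: a_def b_def field_simps)
      have d1: "((\<lambda>r. ?w1 (t + r, x + a * r)) has_real_derivative 0) (at 0)"
        and d2: "((\<lambda>r. ?w2 (t + r, x + b * r)) has_real_derivative 0) (at 0)"
        using w_line[OF t(1,3) n(1)] z by metis+
      have e: "((\<lambda>r. \<epsilon> * (1 + fst (t + r, x + m * r))) has_real_derivative \<epsilon>) (at 0)" for m
        by (auto intro!: derivative_eq_intros)
      have "((\<lambda>r. ?w1 (t + r, x + a * r) - M1 - \<epsilon> * (1 + fst (t + r, x + a * r))) has_real_derivative - \<epsilon>) (at 0)"
        "((\<lambda>r. m1 - ?w1 (t + r, x + a * r) - \<epsilon> * (1 + fst (t + r, x + a * r))) has_real_derivative - \<epsilon>) (at 0)"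
        "((\<lambda>r. ?w2 (t + r, x + b * r) - M2 - \<epsilon> * (1 + fst (t + r, x + b * r))) has_real_derivative - \<epsilon>) (at 0)"
        "((\<lambda>r. m2 - ?w2 (t + r, x + b * r) - \<epsilon> * (1 + fst (t + r, x + b * r))) has_real_derivative - \<epsilon>) (at 0)"
        using d1 d2 e by (auto intro!: derivative_eq_intros)
      note D = this
      show ?thesis using f unfolding F_def
        apply (elim insertE emptyE)
        subgoal using D(1) ab(1) \<epsilon>(1) by (intro exI[of _ a] exI[of _ "- \<epsilon>"]) simp
        subgoal using D(2) ab(1) \<epsilon>(1) by (intro exI[of _ a] exI[of _ "- \<epsilon>"]) simp
        subgoal using D(3) ab(2) \<epsilon>(1) by (intro exI[of _ b] exI[of _ "- \<epsilon>"]) simp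
        subgoal using D(4) ab(2) \<epsilon>(1) by (intro exI[of _ b] exI[of _ "- \<epsilon>"]) simp
        done
    qed
  qed
  have main': "\<forall>f\<in>F. f (\<tau>, x0) < 0" using main by blast
  show b: "m1 - \<eta> < w1 \<theta> \<sigma> \<beta> (\<tau>, x0)" "w1 \<theta> \<sigma> \<beta> (\<tau>, x0) < M1 + \<eta>"
    "m2 - \<eta> < w2 \<theta> \<sigma> \<beta> (\<tau>, x0)" "w2 \<theta> \<sigma> \<beta> (\<tau>, x0) < M2 + \<eta>"
    using main' \<epsilon>(2) unfolding F_def by auto
  show "0 < \<sigma> (\<tau>, x0)" using near[of \<tau> x0] b \<tau> by auto
qed

lemma invariant_region:
  assumes init: "\<And>x. m1 \<le> w1 \<theta> \<sigma> \<beta> (0, x)" "\<And>x. w1 \<theta> \<sigma> \<beta> (0, x) \<le> M1"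
      "\<And>x. m2 \<le> w2 \<theta> \<sigma> \<beta> (0, x)" "\<And>x. w2 \<theta> \<sigma> \<beta> (0, x) \<le> M2"
    and box: "\<And>a b. m1 \<le> a \<Longrightarrow> a \<le> M1 \<Longrightarrow> m2 \<le> b \<Longrightarrow> b \<le> M2 \<Longrightarrow> \<kappa> \<le> lam \<theta> a b \<and> lam \<theta> b a \<le> -\<kappa>"
    and "0 < \<kappa>" and t: "0 \<le> t" "t < T"
  shows "0 < \<sigma> (t, x)" "m1 \<le> w1 \<theta> \<sigma> \<beta> (t, x)" "w1 \<theta> \<sigma> \<beta> (t, x) \<le> M1"
    "m2 \<le> w2 \<theta> \<sigma> \<beta> (t, x)" "w2 \<theta> \<sigma> \<beta> (t, x) \<le> M2"
proof -
  note approx = invariant_region_approx[OF init box t]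
  show "0 < \<sigma> (t, x)" using approx(1)[of "\<kappa> / 2"] \<open>0 < \<kappa>\<close> by simp
  have *: "a \<le> b" if "\<And>\<eta>. 0 < \<eta> \<Longrightarrow> \<eta> \<le> \<kappa> / 2 \<Longrightarrow> a < b + \<eta>" for a b :: real
  proof (rule field_le_epsilon)
    fix e :: real assume "0 < e"
    then show "a \<le> b + e" using that[of "min e (\<kappa> / 2)"] \<open>0 < \<kappa>\<close> by linarith
  qed
  show "m1 \<le> w1 \<theta> \<sigma> \<beta> (t, x)" by (rule *) (use approx(2) in \<open>simp add: diff_less_eq\<close>)
  show "w1 \<theta> \<sigma> \<beta> (t, x) \<le> M1" by (rule *) (rule approx(3))
  show "m2 \<le> w2 \<theta> \<sigma> \<beta> (t, x)" by (rule *) (use approx(4) in \<open>simp add: diff_less_eq\<close>)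
  show "w2 \<theta> \<sigma> \<beta> (t, x) \<le> M2" by (rule *) (rule approx(5))
qed

end

section \<open>Uniqueness for the Riemann system\<close>

text \<open>The roles of \<open>w1\<close> and \<open>w2\<close> are interchangeable up to the sign \<open>s\<close> of the speed of \<open>u\<close>, so that each
  estimate below is proved once and used for both invariants.\<close>

locale riemann_pair =
  fixes \<theta> \<kappa> B T s :: real and u ut ux v vt vx :: "real \<times> real \<Rightarrow> real"
  assumes theta: "0 < \<theta>" "\<theta> < 1" and kappa: "0 < \<kappa>" and s: "s = 1 \<or> s = -1"
    and u_partials: "C1_partials ({0..<T} \<times> UNIV) u ut ux"
    and v_partials: "C1_partials ({0..<T} \<times> UNIV) v vt vx"
    and u_eq: "\<And>t x. 0 < t \<Longrightarrow> t < T \<Longrightarrow> lam \<theta> (u (t, x)) (v (t, x)) * ut (t, x) + ux (t, x) = 0"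
    and v_eq: "\<And>t x. 0 < t \<Longrightarrow> t < T \<Longrightarrow> lam \<theta> (v (t, x)) (u (t, x)) * vt (t, x) + vx (t, x) = 0"
    and u_speed: "\<And>t x. 0 \<le> t \<Longrightarrow> t < T \<Longrightarrow> \<kappa> \<le> s * lam \<theta> (u (t, x)) (v (t, x))"
    and v_speed: "\<And>t x. 0 \<le> t \<Longrightarrow> t < T \<Longrightarrow> s * lam \<theta> (v (t, x)) (u (t, x)) \<le> - \<kappa>"
    and bound: "\<And>t x. 0 \<le> t \<Longrightarrow> t < T \<Longrightarrow> \<bar>u (t, x)\<bar> \<le> B \<and> \<bar>v (t, x)\<bar> \<le> B"
begin

lemma abs_speed:
  assumes "0 \<le> t" "t < T"
  shows "\<kappa> \<le> \<bar>lam \<theta> (u (t, x)) (v (t, x))\<bar>" "\<kappa> \<le> \<bar>lam \<theta> (v (t, x)) (u (t, x))\<bar>"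
  using u_speed[OF assms, of x] v_speed[OF assms, of x] s by auto

lemma speed_nonzero:
  assumes "0 \<le> t" "t < T"
  shows "lam \<theta> (u (t, x)) (v (t, x)) \<noteq> 0" "lam \<theta> (v (t, x)) (u (t, x)) \<noteq> 0"
  using abs_speed[OF assms, of x] kappa by auto

lemma abs_slope:
  assumes "0 \<le> t" "t < T"
  shows "\<bar>1 / lam \<theta> (u (t, x)) (v (t, x))\<bar> \<le> 1 / \<kappa>" "\<bar>1 / lam \<theta> (v (t, x)) (u (t, x))\<bar> \<le> 1 / \<kappa>"
  using abs_speed[OF assms, of x] kappa by (auto simp: abs_divide intro!: frac_le)

lemma line:
  assumes "0 < t" "t < T"
  shows "((\<lambda>r. u (t + r, x + m * r)) has_real_derivative ut (t, x) + m * ux (t, x)) (at 0)"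
    "((\<lambda>r. v (t + r, x + m * r)) has_real_derivative vt (t, x) + m * vx (t, x)) (at 0)"
  using C1_partials_line[OF u_partials assms, of 1 x m] C1_partials_line[OF v_partials assms, of 1 x m] by auto

lemma time_derivative:
  assumes "0 < t" "t < T"
  shows "ut (t, x) = - (1 / lam \<theta> (u (t, x)) (v (t, x))) * ux (t, x)"
    "vt (t, x) = - (1 / lam \<theta> (v (t, x)) (u (t, x))) * vx (t, x)"
  using u_eq[OF assms, of x] v_eq[OF assms, of x] speed_nonzero[of t x] assms
  by (auto simp: field_simps)

end

lemma slope_lipschitz:
  assumes "0 < \<theta>" "\<theta> < 1" "0 < \<kappa>" "\<bar>u - u'\<bar> \<le> \<eta>" "\<bar>v - v'\<bar> \<le> \<eta>"
    "\<kappa> \<le> \<bar>lam \<theta> u v\<bar>" "\<kappa> \<le> \<bar>lam \<theta> u' v'\<bar>"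
  shows "\<bar>1 / lam \<theta> u v - 1 / lam \<theta> u' v'\<bar> \<le> \<eta> / \<kappa>\<^sup>2"
proof -
  have "\<bar>1 / lam \<theta> u v - 1 / lam \<theta> u' v'\<bar> = \<bar>lam \<theta> u v - lam \<theta> u' v'\<bar> / (\<bar>lam \<theta> u v\<bar> * \<bar>lam \<theta> u' v'\<bar>)"
    using assms by (subst diff_divide_eq_iff) (auto simp: field_simps abs_mult abs_divide abs_minus_commute divide_simps)
  also have "\<dots> \<le> \<eta> / (\<kappa> * \<kappa>)"
    using lam_lipschitz[OF assms(1,2,4,5)] assms by (intro frac_le mult_mono) auto
  finally show ?thesis by (simp add: power2_eq_square)
qed

text \<open>On a characteristic of the first solution \<open>u\<close> is constant, and
  \<open>u'\<close> changes only by the difference of the two slopes times \<open>ux'\<close>. So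
  bounds are needed only for derivatives of the second solution, and the differences stay below
  \<open>\<epsilon> * exp (L * t)\<close> for every positive \<open>\<epsilon>\<close>.\<close>

lemma riemann_unique:
  assumes P: "riemann_pair \<theta> \<kappa> B T s u ut ux v vt vx" and Q: "riemann_pair \<theta> \<kappa> B T s u' ut' ux' v' vt' vx'"
    and init: "\<And>x. u (0, x) = u' (0, x)" "\<And>x. v (0, x) = v' (0, x)"
    and \<tau>: "0 \<le> \<tau>" "\<tau> < T"
  shows "u (\<tau>, x0) = u' (\<tau>, x0)" "v (\<tau>, x0) = v' (\<tau>, x0)"
proof -
  interpret P: riemann_pair \<theta> \<kappa> B T s u ut ux v vt vx by (rule P)
  interpret Q: riemann_pair \<theta> \<kappa> B T s u' ut' ux' v' vt' vx' by (rule Q)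
  note \<kappa> = P.kappa
  define K where "K = {(t, x). 0 \<le> t \<and> t \<le> \<tau> \<and> \<bar>x - x0\<bar> \<le> (1 / \<kappa>) * (\<tau> - t)}"
  define R where "R = {0..\<tau>} \<times> {x0 - \<tau> / \<kappa>..x0 + \<tau> / \<kappa>}"
  have KR: "K \<subseteq> R"
  proof (rule subrelI)
    fix t x assume "(t, x) \<in> K"
    moreover from this have "(1 / \<kappa>) * (\<tau> - t) \<le> (1 / \<kappa>) * \<tau>"
      using \<kappa> by (intro mult_left_mono) (auto simp: K_def)
    ultimately show "(t, x) \<in> R" by (auto simp: K_def R_def)
  qed
  have RS: "R \<subseteq> {0..<T} \<times> UNIV" using \<tau> by (auto simp: R_def)
  have KS: "K \<subseteq> {0..<T} \<times> UNIV" using KR RS by blast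
  have bdd: "\<exists>N\<ge>0. \<forall>p\<in>R. \<bar>f p\<bar> \<le> N" if "continuous_on ({0..<T} \<times> UNIV) f" for f :: "real \<times> real \<Rightarrow> real"
  proof -
    have "compact (f ` R)"
      using continuous_on_subset[OF that RS] by (intro compact_continuous_image) (auto simp: R_def intro!: compact_Times)
    then obtain N where "\<forall>y\<in>f ` R. norm y \<le> N" using compact_imp_bounded bounded_iff by blast
    then show ?thesis by (intro exI[of _ "max 0 N"]) (auto simp: max.coboundedI2)
  qed
  obtain N1 N2 where N1: "N1 \<ge> 0" "\<And>p. p \<in> R \<Longrightarrow> \<bar>ux' p\<bar> \<le> N1" and N2: "N2 \<ge> 0" "\<And>p. p \<in> R \<Longrightarrow> \<bar>vx' p\<bar> \<le> N2"
    using bdd[of ux'] bdd[of vx'] Q.u_partials Q.v_partials unfolding C1_partials_def by metis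
  \<comment> \<open>The Lipschitz constant of the slopes from \<open>slope_lipschitz\<close> times
    bounds on the derivatives; the added 1 makes the estimates of \<open>da\<close> and
    \<open>db\<close> strict.\<close>
  define L where "L = (N1 + N2) / \<kappa>\<^sup>2 + 1"
  have close: "\<bar>u (\<tau>, x0) - u' (\<tau>, x0)\<bar> < \<epsilon> * exp (L * \<tau>) \<and> \<bar>v (\<tau>, x0) - v' (\<tau>, x0)\<bar> < \<epsilon> * exp (L * \<tau>)"
    if \<epsilon>: "0 < \<epsilon>" for \<epsilon>
  proof -
    define F where "F = {\<lambda>p. u p - u' p - \<epsilon> * exp (L * fst p), \<lambda>p. u' p - u p - \<epsilon> * exp (L * fst p),
      \<lambda>p. v p - v' p - \<epsilon> * exp (L * fst p), \<lambda>p. v' p - v p - \<epsilon> * exp (L * fst p)}"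
    have main: "f (\<tau>, x0) < 0" if "f \<in> F" for f
    proof (rule cone_first_time[where F = F and M = "1 / \<kappa>" and \<tau> = \<tau> and x\<^sub>0 = x0, folded K_def, OF _ _ _ _ _ that])
      show "finite F" "0 \<le> 1 / \<kappa>" "(\<tau>, x0) \<in> K" using \<kappa> \<tau> by (auto simp: F_def K_def)
      show "continuous_on K f" if "f \<in> F" for f
        using that continuous_on_subset[OF C1_partials_continuous KS]
          P.u_partials P.v_partials Q.u_partials Q.v_partials
        unfolding F_def by (elim insertE emptyE) (auto intro!: continuous_intros)
      show "f (0, x) < 0" if "f \<in> F" for f x
        using that init[of x] \<epsilon> by (auto simp: F_def)
      show "\<exists>m d. \<bar>m\<bar> \<le> 1 / \<kappa> \<and> d < 0 \<and> ((\<lambda>r. f (t + r, x + m * r)) has_real_derivative d) (at 0)"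
        if f: "f \<in> F" and tx: "(t, x) \<in> K" "0 < t" and le0: "\<forall>g\<in>F. g (t, x) \<le> 0" for f t x
      proof -
        have t: "0 < t" "t < T" "0 \<le> t" and R: "(t, x) \<in> R" using tx \<tau> KR by (auto simp: K_def)
        define \<eta> where "\<eta> = \<epsilon> * exp (L * t)"
        have \<eta>: "0 < \<eta>" using \<epsilon> by (simp add: \<eta>_def)
        have du: "\<bar>u (t, x) - u' (t, x)\<bar> \<le> \<eta>" and dv: "\<bar>v (t, x) - v' (t, x)\<bar> \<le> \<eta>"
          using le0 unfolding F_def \<eta>_def by auto
        define a b where "a = 1 / lam \<theta> (u (t, x)) (v (t, x))" and "b = 1 / lam \<theta> (v (t, x)) (u (t, x))"
        have ab: "\<bar>a\<bar> \<le> 1 / \<kappa>" "\<bar>b\<bar> \<le> 1 / \<kappa>"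
          using P.abs_slope[OF t(3,2), of x] by (auto simp: a_def b_def)
        define da db where "da = ut' (t, x) + a * ux' (t, x)" and "db = vt' (t, x) + b * vx' (t, x)"
        have da: "\<bar>da\<bar> < L * \<eta>"
        proof -
          have "da = (a - 1 / lam \<theta> (u' (t, x)) (v' (t, x))) * ux' (t, x)"
            using Q.time_derivative(1)[OF t(1,2), of x] by (simp add: da_def algebra_simps)
          also have "\<bar>\<dots>\<bar> \<le> \<eta> / \<kappa>\<^sup>2 * N1"
            using slope_lipschitz[OF P.theta \<kappa> du dv P.abs_speed(1)[OF t(3,2)] Q.abs_speed(1)[OF t(3,2)]] N1(2)[OF R] \<eta>
            unfolding abs_mult a_def by (intro mult_mono) auto
          also have "\<dots> \<le> \<eta> * ((N1 + N2) / \<kappa>\<^sup>2)"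
            using \<eta> N2(1) by (simp add: divide_right_mono mult_left_mono)
          also have "\<dots> < L * \<eta>" using \<eta> by (simp add: L_def algebra_simps)
          finally show ?thesis .
        qed
        have db: "\<bar>db\<bar> < L * \<eta>"
        proof -
          have "db = (b - 1 / lam \<theta> (v' (t, x)) (u' (t, x))) * vx' (t, x)"
            using Q.time_derivative(2)[OF t(1,2), of x] by (simp add: db_def algebra_simps)
          also have "\<bar>\<dots>\<bar> \<le> \<eta> / \<kappa>\<^sup>2 * N2"
            using slope_lipschitz[OF P.theta \<kappa> dv du P.abs_speed(2)[OF t(3,2)] Q.abs_speed(2)[OF t(3,2)]] N2(2)[OF R] \<eta>
            unfolding abs_mult b_def by (intro mult_mono) auto
          also have "\<dots> \<le> \<eta> * ((N1 + N2) / \<kappa>\<^sup>2)"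
            using \<eta> N1(1) by (simp add: divide_right_mono mult_left_mono)
          also have "\<dots> < L * \<eta>" using \<eta> by (simp add: L_def algebra_simps)
          finally show ?thesis .
        qed
        have d: "((\<lambda>r. u (t + r, x + a * r)) has_real_derivative 0) (at 0)"
          "((\<lambda>r. v (t + r, x + b * r)) has_real_derivative 0) (at 0)"
          "((\<lambda>r. u' (t + r, x + a * r)) has_real_derivative da) (at 0)"
          "((\<lambda>r. v' (t + r, x + b * r)) has_real_derivative db) (at 0)"
          using P.line(1)[OF t(1,2), of x a] P.line(2)[OF t(1,2), of x b] Q.line(1)[OF t(1,2), of x a] Q.line(2)[OF t(1,2), of x b]
            P.time_derivative[OF t(1,2), of x] by (simp_all add: a_def b_def da_def db_def)
        have e: "((\<lambda>r. \<epsilon> * exp (L * fst (t + r, x + m * r))) has_real_derivative L * \<eta>) (at 0)" for m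
          by (auto intro!: derivative_eq_intros simp: \<eta>_def)
        have "((\<lambda>r. u (t + r, x + a * r) - u' (t + r, x + a * r) - \<epsilon> * exp (L * fst (t + r, x + a * r))) has_real_derivative 0 - da - L * \<eta>) (at 0)"
          "((\<lambda>r. u' (t + r, x + a * r) - u (t + r, x + a * r) - \<epsilon> * exp (L * fst (t + r, x + a * r))) has_real_derivative da - 0 - L * \<eta>) (at 0)"
          "((\<lambda>r. v (t + r, x + b * r) - v' (t + r, x + b * r) - \<epsilon> * exp (L * fst (t + r, x + b * r))) has_real_derivative 0 - db - L * \<eta>) (at 0)"
          "((\<lambda>r. v' (t + r, x + b * r) - v (t + r, x + b * r) - \<epsilon> * exp (L * fst (t + r, x + b * r))) has_real_derivative db - 0 - L * \<eta>) (at 0)"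
          by (intro DERIV_diff d e)+
        note D = this
        have neg: "0 - da - L * \<eta> < 0" "da - 0 - L * \<eta> < 0" "0 - db - L * \<eta> < 0" "db - 0 - L * \<eta> < 0"
          using da db by linarith+
        show ?thesis using f unfolding F_def
          apply (elim insertE emptyE)
          subgoal using D(1) ab(1) neg(1) by (intro exI[of _ a] exI[of _ "0 - da - L * \<eta>"]) simp
          subgoal using D(2) ab(1) neg(2) by (intro exI[of _ a] exI[of _ "da - 0 - L * \<eta>"]) simp
          subgoal using D(3) ab(2) neg(3) by (intro exI[of _ b] exI[of _ "0 - db - L * \<eta>"]) simp
          subgoal using D(4) ab(2) neg(4) by (intro exI[of _ b] exI[of _ "db - 0 - L * \<eta>"]) simp
          done
      qed
    qed
    have main': "\<forall>f\<in>F. f (\<tau>, x0) < 0" using main by blast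
    show ?thesis using main' unfolding F_def by auto
  qed
  have "\<bar>u (\<tau>, x0) - u' (\<tau>, x0)\<bar> \<le> e" "\<bar>v (\<tau>, x0) - v' (\<tau>, x0)\<bar> \<le> e" if "0 < e" for e
    using close[of "e / exp (L * \<tau>)"] that by auto
  then have "\<bar>u (\<tau>, x0) - u' (\<tau>, x0)\<bar> \<le> 0" "\<bar>v (\<tau>, x0) - v' (\<tau>, x0)\<bar> \<le> 0"
    by (meson dense_ge)+
  then show "u (\<tau>, x0) = u' (\<tau>, x0)" "v (\<tau>, x0) = v' (\<tau>, x0)" by auto
qed

section \<open>Riccati estimates\<close>

context riemann_pair
begin

section \<open>Difference quotients and the integrating factor along characteristics\<close>

definition ell where "ell p = lam \<theta> (u p) (v p)"

text \<open>For \<open>h > 0\<close> these are the difference quotients in \<open>x\<close>; as averages of derivatives they are jointly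
  continuous down to \<open>h = 0\<close>.\<close>

definition Q where "Q h p = integral {0..1} (\<lambda>r. ux (fst p, snd p + r * h))"
definition Qv where "Qv h p = integral {0..1} (\<lambda>r. vx (fst p, snd p + r * h))"

text \<open>Along a characteristic of \<open>u\<close>, the mixed term of the evolution of \<open>\<partial>\<^sub>x u\<close> is a logarithmic
  derivative; \<open>weight\<close> is the corresponding integrating factor.\<close>

definition weight where
  "weight p = (s * (u p - v p)) powr - ((1 - \<theta>) / (2 * \<theta>)) / (s * ell p)"

text \<open>The defect of \<open>Q h\<close> in the Riccati equation.\<close>

definition err where
  "err h p = ((1 + \<theta>) / 2 * Q h p + (1 - \<theta>) / 2 * Qv h p) * ux (fst p, snd p + h) / (ell p * ell (fst p, snd p + h))
     - (1 - \<theta>) / 2 * vx p * Q h p / (ell p)\<^sup>2 - (1 + \<theta>) / 2 * (Q h p)\<^sup>2 / (ell p)\<^sup>2"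

lemma Q_diff:
  assumes "0 \<le> t" "t < T" "h > 0"
  shows "h * Q h (t, x) = u (t, x + h) - u (t, x)" "h * Qv h (t, x) = v (t, x + h) - v (t, x)"
proof -
  have *: "h * integral {0..1} (\<lambda>r. fx (t, x + r * h)) = f (t, x + h) - f (t, x)"
    if f: "C1_partials ({0..<T} \<times> UNIV) f ft fx" for f ft fx
  proof -
    have "((\<lambda>r. h * fx (t, x + r * h)) has_integral f (t, x + 1 * h) - f (t, x + 0 * h)) {0..1}"
    proof (rule fundamental_theorem_of_calculus)
      fix r :: real assume "r \<in> {0..1}"
      have "((\<lambda>r. f (t, x + r * h)) has_real_derivative fx (t, x + r * h) * h) (at r within {0..1})"
        by (rule DERIV_chain2[OF C1_partials_dx[OF f assms(1,2)]]) (auto intro!: derivative_eq_intros)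
      then show "((\<lambda>r. f (t, x + r * h)) has_vector_derivative h * fx (t, x + r * h)) (at r within {0..1})"
        by (simp add: has_real_derivative_iff_has_vector_derivative mult.commute)
    qed simp
    from integral_unique[OF this] show ?thesis by simp
  qed
  show "h * Q h (t, x) = u (t, x + h) - u (t, x)" "h * Qv h (t, x) = v (t, x + h) - v (t, x)"
    using *[OF u_partials] *[OF v_partials] by (simp_all add: Q_def Qv_def)
qed

lemma Q_zero: "Q 0 p = ux p" "Qv 0 p = vx p"
  by (simp_all add: Q_def Qv_def)

lemma err_zero: "err 0 p = 0"
  by (cases "ell p = 0") (simp_all add: err_def Q_zero field_simps power2_eq_square)

lemma ux_vx_continuous: "continuous_on ({0..<T} \<times> UNIV) ux" "continuous_on ({0..<T} \<times> UNIV) vx"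
  using u_partials v_partials by (auto simp: C1_partials_def)

lemma Q_continuous:
  "continuous_on (UNIV \<times> ({0..<T} \<times> UNIV)) (\<lambda>z. Q (fst z) (snd z))"
  "continuous_on (UNIV \<times> ({0..<T} \<times> UNIV)) (\<lambda>z. Qv (fst z) (snd z))"
proof -
  have *: "continuous_on (UNIV \<times> ({0..<T} \<times> UNIV)) (\<lambda>z. integral (cbox 0 1) (\<lambda>r. f (fst (snd z), snd (snd z) + r * fst z)))"
    if f: "continuous_on ({0..<T} \<times> (UNIV :: real set)) f" for f :: "real \<times> real \<Rightarrow> real"
  proof (rule integral_continuous_on_param)
    show "continuous_on ((UNIV \<times> {0..<T} \<times> UNIV) \<times> cbox 0 1) (\<lambda>(z, r). f (fst (snd z), snd (snd z) + r * fst z))"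
      unfolding case_prod_beta'
      by (rule continuous_on_compose2[OF f]) (auto intro!: continuous_intros)
  qed
  show "continuous_on (UNIV \<times> ({0..<T} \<times> UNIV)) (\<lambda>z. Q (fst z) (snd z))"
    "continuous_on (UNIV \<times> ({0..<T} \<times> UNIV)) (\<lambda>z. Qv (fst z) (snd z))"
    using *[OF ux_vx_continuous(1)] *[OF ux_vx_continuous(2)] by (simp_all add: Q_def Qv_def)
qed

lemma ell_continuous: "continuous_on ({0..<T} \<times> UNIV) ell"
  unfolding ell_def lam_def
  using C1_partials_continuous[OF u_partials] C1_partials_continuous[OF v_partials]
  by (intro continuous_intros) auto

lemma ell_nonzero: "0 \<le> t \<Longrightarrow> t < T \<Longrightarrow> ell (t, x) \<noteq> 0"
  using speed_nonzero by (simp add: ell_def)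

lemma ell_bounds: "0 \<le> t \<Longrightarrow> t < T \<Longrightarrow> \<kappa> \<le> s * ell (t, x) \<and> s * ell (t, x) \<le> B"
proof -
  assume t: "0 \<le> t" "t < T"
  have "\<bar>lam \<theta> (u (t, x)) (v (t, x)) - lam \<theta> 0 0\<bar> \<le> B"
    by (rule lam_lipschitz[OF theta]) (use bound[OF t] in auto)
  then show ?thesis using u_speed[OF t, of x] s by (auto simp: ell_def lam_def)
qed

lemma gap_bounds:
  assumes t: "0 \<le> t" "t < T"
  shows "2 * \<kappa> / \<theta> \<le> s * (u (t, x) - v (t, x))" "s * (u (t, x) - v (t, x)) \<le> 2 * B"
proof -
  have "\<theta> * (s * (u (t, x) - v (t, x))) = s * (lam \<theta> (u (t, x)) (v (t, x)) - lam \<theta> (v (t, x)) (u (t, x)))"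
    by (simp add: lam_diff)
  also have "\<dots> \<ge> 2 * \<kappa>" using u_speed[OF t, of x] v_speed[OF t, of x] by (simp add: right_diff_distrib)
  finally show "2 * \<kappa> / \<theta> \<le> s * (u (t, x) - v (t, x))" using theta by (simp add: field_simps)
  show "s * (u (t, x) - v (t, x)) \<le> 2 * B" using bound[OF t, of x] s by auto
qed

lemma gap_pos: "0 \<le> t \<Longrightarrow> t < T \<Longrightarrow> 0 < s * (u (t, x) - v (t, x))"
  using gap_bounds(1)[of t x] kappa theta by (meson divide_pos_pos less_le_trans mult_pos_pos zero_less_numeral)

lemma weight_continuous: "continuous_on ({0..<T} \<times> UNIV) weight"
proof -
  have "s * (u p - v p) \<noteq> 0" "s * ell p \<noteq> 0" if "p \<in> {0..<T} \<times> UNIV" for p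
    using that gap_pos[of "fst p" "snd p"] ell_bounds[of "fst p" "snd p"] kappa by auto
  then show ?thesis
    unfolding weight_def
    using C1_partials_continuous[OF u_partials] C1_partials_continuous[OF v_partials] ell_continuous
    by (intro continuous_on_divide continuous_on_powr continuous_on_mult continuous_on_diff continuous_on_const) auto
qed

lemma err_continuous: "continuous_on (UNIV \<times> ({0..<T} \<times> UNIV)) (\<lambda>z. err (fst z) (snd z))"
proof -
  let ?S = "UNIV \<times> ({0..<T} \<times> (UNIV :: real set)) :: (real \<times> real \<times> real) set"
  have shift: "continuous_on ?S (\<lambda>z. f (fst (snd z), snd (snd z) + fst z))"
    if "continuous_on ({0..<T} \<times> UNIV) f" for f :: "real \<times> real \<Rightarrow> real"
    by (rule continuous_on_compose2[OF that]) (auto intro!: continuous_intros)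
  have proj: "continuous_on ?S (\<lambda>z. f (snd z))"
    if "continuous_on ({0..<T} \<times> UNIV) f" for f :: "real \<times> real \<Rightarrow> real"
    by (rule continuous_on_compose2[OF that]) (auto intro!: continuous_intros)
  have nz: "ell p \<noteq> 0" if "p \<in> {0..<T} \<times> UNIV" for p using that ell_nonzero[of "fst p" "snd p"] by auto
  note c = Q_continuous shift[OF ux_vx_continuous(1)] proj[OF ux_vx_continuous(2)] shift[OF ell_continuous] proj[OF ell_continuous]
  show ?thesis
    unfolding err_def
    by (intro continuous_on_diff continuous_on_divide continuous_on_mult continuous_on_add continuous_on_power continuous_on_const c)
      (auto simp: ell_nonzero)
qed

text \<open>The defect is jointly continuous and vanishes at \<open>h = 0\<close>, so comparing
  \<open>(h, p)\<close> with \<open>(0, p)\<close> by uniform continuity makes it small on all of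
  \<open>K\<close> at once.\<close>

lemma small_error:
  assumes "compact K" "K \<subseteq> {0..<T} \<times> UNIV" "0 < \<eta>"
  obtains h0 where "0 < h0" "\<And>h p. 0 < h \<Longrightarrow> h < h0 \<Longrightarrow> p \<in> K \<Longrightarrow> \<bar>weight p * err h p\<bar> < \<eta>"
proof -
  define f where "f z = weight (snd z) * err (fst z) (snd z)" for z
  have "continuous_on ({0..1} \<times> K) (\<lambda>z. weight (snd z))"
    by (rule continuous_on_compose2[OF weight_continuous continuous_on_snd[OF continuous_on_id]]) (use assms(2) in auto)
  moreover have "continuous_on ({0..1} \<times> K) (\<lambda>z. err (fst z) (snd z))"
    by (rule continuous_on_subset[OF err_continuous]) (use assms(2) in auto)
  ultimately have "continuous_on ({0..1} \<times> K) f"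
    unfolding f_def by (rule continuous_on_mult)
  then have "uniformly_continuous_on ({0..1} \<times> K) f"
    using assms by (intro compact_uniformly_continuous compact_Times) auto
  then obtain d where d: "d > 0" "\<And>z z'. z \<in> {0..1} \<times> K \<Longrightarrow> z' \<in> {0..1} \<times> K \<Longrightarrow> dist z' z < d \<Longrightarrow> dist (f z') (f z) < \<eta>"
    using \<open>0 < \<eta>\<close> by (rule uniformly_continuous_onE) (rule that)
  show ?thesis
  proof (rule that[of "min d 1"])
    fix h p assume "0 < h" "h < min d 1" "p \<in> K"
    then show "\<bar>weight p * err h p\<bar> < \<eta>"
      using d(2)[of "(0, p)" "(h, p)"] by (auto simp: f_def err_zero dist_Pair_Pair dist_real_def)
  qed (use d in auto)
qed

lemma Q_tendsto:
  assumes "0 \<le> t" "t < T"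
  shows "((\<lambda>h. Q h (t, x)) \<longlongrightarrow> ux (t, x)) (at_right 0)"
proof -
  have "continuous_on UNIV (\<lambda>h. Q (fst (h, t, x)) (snd (h, t, x)))"
    by (rule continuous_on_compose2[OF Q_continuous(1)]) (use assms in \<open>auto intro!: continuous_intros\<close>)
  then have "continuous_on UNIV (\<lambda>h. Q h (t, x))" by simp
  then have "((\<lambda>h. Q h (t, x)) \<longlongrightarrow> Q 0 (t, x)) (at 0)"
    by (simp add: continuous_on_def)
  then show ?thesis unfolding Q_zero by (rule filterlim_mono) (auto simp: at_le)
qed

text \<open>On a characteristic of \<open>u\<close> only \<open>v\<close> varies, at the rate
  \<open>Dv = vx * (1 / l - 1 / l')\<close>, which by \<open>lam_diff\<close> is proportional to the
  gap \<open>u - v\<close>. The exponent \<open>e\<close> is fixed by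
  \<open>2 * \<theta> * e = 1 - \<theta>\<close>: exactly then the speed \<open>l'\<close> of the
  other family cancels and the coefficient of the mixed term remains.\<close>

lemma weight_line:
  assumes t: "0 < t" "t < T"
  shows "((\<lambda>r. weight (t + r, x + 1 / ell (t, x) * r)) has_real_derivative
      - weight (t, x) * ((1 - \<theta>) / 2 * vx (t, x) / (ell (t, x))\<^sup>2)) (at 0)"
proof -
  define l l' y e Dv where "l = ell (t, x)" and "l' = lam \<theta> (v (t, x)) (u (t, x))" and "y = s * (u (t, x) - v (t, x))"
    and "e = (1 - \<theta>) / (2 * \<theta>)" and "Dv = vt (t, x) + 1 / l * vx (t, x)"
  have y: "y > 0" and l: "l \<noteq> 0" "l' \<noteq> 0" and s2: "s * s = 1" "s \<noteq> 0"
    using gap_pos[of t x] ell_nonzero[of t x] speed_nonzero[of t x] t s by (auto simp: y_def l_def l'_def)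
  have du: "((\<lambda>r. u (t + r, x + 1 / l * r)) has_real_derivative 0) (at 0)"
    using line(1)[OF t, of x "1 / l"] time_derivative(1)[OF t, of x] by (simp add: l_def ell_def)
  have dv: "((\<lambda>r. v (t + r, x + 1 / l * r)) has_real_derivative Dv) (at 0)"
    using line(2)[OF t, of x "1 / l"] by (simp add: Dv_def)
  have dy: "((\<lambda>r. s * (u (t + r, x + 1 / l * r) - v (t + r, x + 1 / l * r))) has_real_derivative s * (0 - Dv)) (at 0)"
    by (intro DERIV_cmult DERIV_diff du dv)
  have dp: "((\<lambda>r. (s * (u (t + r, x + 1 / l * r) - v (t + r, x + 1 / l * r))) powr - e) has_real_derivative
      (- e * y powr (- e - 1)) * (s * (0 - Dv))) (at 0)"
    by (rule DERIV_chain2[OF _ dy]) (use has_real_derivative_powr[OF y, of "- e"] in \<open>simp add: y_def\<close>)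
  have dl: "((\<lambda>r. s * ell (t + r, x + 1 / l * r)) has_real_derivative s * ((1 - \<theta>) * Dv / 2)) (at 0)"
    unfolding ell_def lam_def
    using DERIV_cmult[OF DERIV_cdivide[OF DERIV_add[OF DERIV_cmult[OF du, of "1 + \<theta>"] DERIV_cmult[OF dv, of "1 - \<theta>"]], of 2], of s] by simp
  have "((\<lambda>r. weight (t + r, x + 1 / l * r)) has_real_derivative
     ((- e * y powr (- e - 1)) * (s * (0 - Dv)) * (s * l) - y powr - e * (s * ((1 - \<theta>) * Dv / 2))) / (s * l * (s * l))) (at 0)"
    using DERIV_divide[OF dp dl] l s2 unfolding weight_def e_def[symmetric] by (simp add: l_def y_def)
  moreover have "((- e * y powr (- e - 1)) * (s * (0 - Dv)) * (s * l) - y powr - e * (s * ((1 - \<theta>) * Dv / 2))) / (s * l * (s * l))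
     = - weight (t, x) * ((1 - \<theta>) / 2 * vx (t, x) / l\<^sup>2)"
  proof -
    define P where "P = y powr - e"
    have P: "y powr (- e - 1) = P / y" using y by (simp add: P_def powr_diff)
    have W: "weight (t, x) = P / (s * l)" by (simp add: weight_def P_def y_def e_def l_def)
    have Dv: "Dv * (l * l') = vx (t, x) * (l' - l)"
      using time_derivative(2)[OF t, of x] l by (simp add: Dv_def l'_def field_simps)
    define g where "g = u (t, x) - v (t, x)"
    have g: "y = s * g" "g \<noteq> 0" using y by (auto simp: y_def g_def)
    have ll: "l - l' = \<theta> * g" by (simp add: l_def l'_def ell_def lam_diff g_def)
    have e: "2 * \<theta> * e = 1 - \<theta>" using theta by (simp add: e_def)
    have "l' - l = - (\<theta> * g)" using ll by simp
    then have Dv': "Dv = - (vx (t, x) * \<theta> * g) / (l * l')"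
      using Dv l by (intro eq_divide_imp) (auto simp: mult_ac)
    have "((- e * (P / y)) * (s * (0 - Dv)) * (s * l) - P * (s * ((1 - \<theta>) * Dv / 2))) / (s * l * (s * l))
       = P / (s * l) * (Dv * (e / g - (1 - \<theta>) / 2 / l))"
      unfolding g(1) using s l g(2) by (elim disjE) (simp_all add: field_simps)
    also have "Dv * (e / g - (1 - \<theta>) / 2 / l) = - (vx (t, x) / (l * l')) * (\<theta> * e - (1 - \<theta>) / 2 * (\<theta> * g) / l)"
      unfolding Dv' using l g(2) by (simp add: field_simps)
    also have "\<theta> * e - (1 - \<theta>) / 2 * (\<theta> * g) / l = (1 - \<theta>) / 2 * l' / l"
    proof -
      have "\<theta> * e = (1 - \<theta>) / 2" using e by simp
      show ?thesis unfolding \<open>\<theta> * e = (1 - \<theta>) / 2\<close> using l unfolding ll[symmetric] by (simp add: field_simps)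
    qed
    finally show ?thesis unfolding P W P_def[symmetric] using l s2 by (simp add: power2_eq_square mult_ac)
  qed
  ultimately show ?thesis by (simp add: l_def)
qed

text \<open>Both \<open>x\<close> and \<open>x + h\<close> are moved with the slope at
  \<open>x\<close>. The first contributes 0, the second \<open>ux (t, x + h)\<close> times a
  difference of inverse speeds, so no second derivative of \<open>u\<close> appears.\<close>

lemma Q_line:
  assumes t: "0 < t" "t < T" and h: "0 < h"
  shows "((\<lambda>r. Q h (t + r, x + 1 / ell (t, x) * r)) has_real_derivative
      ((1 + \<theta>) / 2 * Q h (t, x) + (1 - \<theta>) / 2 * Qv h (t, x)) * ux (t, x + h) / (ell (t, x) * ell (t, x + h))) (at 0)"
proof -
  define m where "m = 1 / ell (t, x)"
  have t0: "0 \<le> t" using t by simp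
  have 1: "((\<lambda>r. u (t + r, x + m * r)) has_real_derivative 0) (at 0)"
    using line(1)[OF t, of x m] time_derivative(1)[OF t, of x] by (simp add: m_def ell_def)
  have "((\<lambda>r. u (t + r, (x + h) + m * r)) has_real_derivative ut (t, x + h) + m * ux (t, x + h)) (at 0)"
    using line(1)[OF t] .
  from DERIV_cdivide[OF DERIV_diff[OF this 1], of h]
  have "((\<lambda>r. (u (t + r, (x + h) + m * r) - u (t + r, x + m * r)) / h) has_real_derivative (ut (t, x + h) + m * ux (t, x + h)) / h) (at 0)"
    by simp
  moreover have "(ut (t, x + h) + m * ux (t, x + h)) / h =
      ((1 + \<theta>) / 2 * Q h (t, x) + (1 - \<theta>) / 2 * Qv h (t, x)) * ux (t, x + h) / (ell (t, x) * ell (t, x + h))"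
  proof -
    have "ell (t, x + h) - ell (t, x) = (1 + \<theta>) / 2 * (h * Q h (t, x)) + (1 - \<theta>) / 2 * (h * Qv h (t, x))"
      unfolding Q_diff[OF t0 t(2) h] by (simp add: ell_def lam_def field_simps)
    then have *: "(1 + \<theta>) / 2 * Q h (t, x) + (1 - \<theta>) / 2 * Qv h (t, x) = (ell (t, x + h) - ell (t, x)) / h"
      using h by (simp add: field_simps)
    have ut: "ut (t, x + h) = - (1 / ell (t, x + h)) * ux (t, x + h)"
      using time_derivative(1)[OF t] by (simp add: ell_def)
    show ?thesis
      unfolding * ut m_def using ell_nonzero[OF t0 t(2)] h by (simp add: field_simps)
  qed
  ultimately have d: "((\<lambda>r. (u (t + r, (x + h) + m * r) - u (t + r, x + m * r)) / h) has_real_derivative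
     ((1 + \<theta>) / 2 * Q h (t, x) + (1 - \<theta>) / 2 * Qv h (t, x)) * ux (t, x + h) / (ell (t, x) * ell (t, x + h))) (at 0)"
    by simp
  show ?thesis unfolding m_def[symmetric]
  proof (rule has_field_derivative_transform_within_open[OF d])
    show "open {- t <..< T - t}" "0 \<in> {- t <..< T - t}" using t by auto
    fix r assume "r \<in> {- t <..< T - t}"
    then show "(u (t + r, (x + h) + m * r) - u (t + r, x + m * r)) / h = Q h (t + r, x + m * r)"
      using Q_diff(1)[of "t + r" h "x + m * r"] h by (simp add: field_simps)
  qed
qed

lemma weighted_line:
  assumes t: "0 < t" "t < T" and h: "0 < h"
  shows "((\<lambda>r. weight (t + r, x + 1 / ell (t, x) * r) * Q h (t + r, x + 1 / ell (t, x) * r)) has_real_derivative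
     weight (t, x) * ((1 + \<theta>) / 2 * (Q h (t, x))\<^sup>2 / (ell (t, x))\<^sup>2) + weight (t, x) * err h (t, x)) (at 0)"
proof -
  have *: "- W * (c * V / l) * q + A * W = W * (a * q\<^sup>2 / l) + W * (A - c * V * q / l - a * q\<^sup>2 / l)"
    for W c V l q A a :: real by (simp add: algebra_simps)
  show ?thesis
    unfolding err_def *[symmetric] using DERIV_mult[OF weight_line[OF t] Q_line[OF t h]] by simp
qed

section \<open>The Riccati inequality and its two consequences\<close>

lemma B_pos: "0 < T \<Longrightarrow> 0 < B"
  using ell_bounds[of 0 0] kappa by linarith

lemma weight_lower:
  assumes "0 \<le> t" "t < T"
  shows "(2 * B) powr - ((1 - \<theta>) / (2 * \<theta>)) / B \<le> weight (t, x)"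
proof -
  have "(2 * B) powr - ((1 - \<theta>) / (2 * \<theta>)) \<le> (s * (u (t, x) - v (t, x))) powr - ((1 - \<theta>) / (2 * \<theta>))"
    using theta gap_pos[OF assms] gap_bounds[OF assms] by (intro powr_mono2') auto
  then show ?thesis
    unfolding weight_def using ell_bounds[OF assms, of x] kappa by (intro frac_le) auto
qed

lemma weight_pos:
  assumes "0 \<le> t" "t < T"
  shows "0 < weight (t, x)"
  unfolding weight_def using gap_pos[OF assms, of x] ell_bounds[OF assms, of x] kappa
  by (intro divide_pos_pos) auto

text \<open>A lower bound for \<open>(1 + \<theta>) / 2 / (weight p * (ell p)\<^sup>2)\<close>, so
  that Z = \<open>weight * Q h\<close> satisfies Z' \<ge> \<open>growth\<close> Z^2 up to the
  defect. Only \<theta>, \<open>\<kappa>\<close> and \<open>B\<close> enter, so the value is the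
  same for all solutions with these bounds and for every \<open>T\<close>.\<close>

definition growth where
  "growth = (1 + \<theta>) / 2 * (2 * \<kappa> / \<theta>) powr ((1 - \<theta>) / (2 * \<theta>)) / B"

lemma growth_pos: "0 < T \<Longrightarrow> 0 < growth"
  using B_pos theta kappa by (simp add: growth_def)

lemma growth_le:
  assumes t: "0 \<le> t" "t < T"
  shows "growth * (weight (t, x) * q)\<^sup>2 \<le> weight (t, x) * ((1 + \<theta>) / 2 * q\<^sup>2 / (ell (t, x))\<^sup>2)"
proof -
  define y l e where "y = s * (u (t, x) - v (t, x))" and "l = s * ell (t, x)" and "e = (1 - \<theta>) / (2 * \<theta>)"
  have y: "0 < y" "2 * \<kappa> / \<theta> \<le> y" and l: "0 < l" "l \<le> B" and e: "0 < e"
    using gap_pos[OF t] gap_bounds[OF t] ell_bounds[OF t, of x] kappa theta by (auto simp: y_def l_def e_def)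
  have l2: "(ell (t, x))\<^sup>2 = l\<^sup>2" using s by (auto simp: l_def)
  have W: "weight (t, x) = 1 / (y powr e * l)"
    by (simp add: weight_def y_def l_def e_def powr_minus field_simps)
  have "growth = (1 + \<theta>) / 2 * (2 * \<kappa> / \<theta>) powr e / B" by (simp add: growth_def e_def)
  also have "\<dots> \<le> (1 + \<theta>) / 2 * y powr e / l"
    using y l e theta kappa by (intro frac_le mult_left_mono powr_mono2) auto
  finally have "growth * (weight (t, x) * q)\<^sup>2 \<le> (1 + \<theta>) / 2 * y powr e / l * (weight (t, x) * q)\<^sup>2"
    by (intro mult_right_mono) auto
  also have "\<dots> = weight (t, x) * ((1 + \<theta>) / 2 * q\<^sup>2 / (ell (t, x))\<^sup>2)"
    unfolding l2 W using y l by (simp add: field_simps power2_eq_square)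
  finally show ?thesis .
qed

lemma abs_inverse_ell:
  assumes "0 \<le> t" "t < T"
  shows "\<bar>1 / ell (t, x)\<bar> \<le> 1 / \<kappa>"
  using abs_slope(1)[OF assms] by (simp add: ell_def)

lemma weighted_Q_continuous:
  assumes "0 < h" "K \<subseteq> {0..<T} \<times> UNIV"
  shows "continuous_on K (\<lambda>p. weight p * Q h p)"
proof -
  have "continuous_on K (\<lambda>p. Q (fst (h, p)) (snd (h, p)))"
    by (rule continuous_on_compose2[OF Q_continuous(1)]) (use assms(2) in \<open>auto intro!: continuous_intros\<close>)
  then show ?thesis
    by (intro continuous_on_mult continuous_on_subset[OF weight_continuous assms(2)]) simp
qed

lemma le_of_tendsto_Q:
  assumes "0 \<le> t" "t < T" "0 < h0" "\<And>h. 0 < h \<Longrightarrow> h < h0 \<Longrightarrow> a * Q h (t, x) \<le> b"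
  shows "a * ux (t, x) \<le> b"
proof (rule tendsto_upperbound)
  show "((\<lambda>h. a * Q h (t, x)) \<longlongrightarrow> a * ux (t, x)) (at_right 0)"
    by (intro tendsto_mult_left Q_tendsto assms)
  show "\<forall>\<^sub>F h in at_right 0. a * Q h (t, x) \<le> b"
    using eventually_at_right_real[OF assms(3)] by eventually_elim (use assms(4) in auto)
qed simp

text \<open>With Z the weighted quotient, -t Z is compared with the constant \<open>c\<close>. It is
  0 at time 0 regardless of the initial slope. At contact the Riccati term contributes at least
  \<open>growth * c\<^sup>2 = 2 * c\<close> to t^2 Z', while differentiating the factor t costs only
  \<open>c\<close>; the remaining \<open>c\<close> absorbs the defect.\<close>

lemma lower_bound:
  assumes \<tau>: "0 < \<tau>" "\<tau> < T"
  shows "- (2 / growth) / (weight (\<tau>, x0) * \<tau>) \<le> ux (\<tau>, x0)"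
proof -
  have T: "0 < T" using \<tau> by simp
  define c where "c = 2 / growth"
  have c: "0 < c" "growth * c = 2" using growth_pos[OF T] by (auto simp: c_def)
  define K where "K = {(t, x). 0 \<le> t \<and> t \<le> \<tau> \<and> \<bar>x - x0\<bar> \<le> (1 / \<kappa>) * (\<tau> - t)}"
  define R where "R = {0..\<tau>} \<times> {x0 - \<tau> / \<kappa>..x0 + \<tau> / \<kappa>}"
  have KR: "K \<subseteq> R"
  proof (rule subrelI)
    fix t x assume "(t, x) \<in> K"
    moreover from this have "(1 / \<kappa>) * (\<tau> - t) \<le> (1 / \<kappa>) * \<tau>"
      using kappa by (intro mult_left_mono) (auto simp: K_def)
    ultimately show "(t, x) \<in> R" by (auto simp: K_def R_def)
  qed
  have R: "compact R" "R \<subseteq> {0..<T} \<times> UNIV" using \<tau> by (auto simp: R_def intro!: compact_Times)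
  have KS: "K \<subseteq> {0..<T} \<times> UNIV" using KR R(2) by blast
  \<comment> \<open>This size of the defect gives \<open>t * t * \<bar>G\<bar> < c\<close> for all
    times up to \<open>\<tau>\<close>.\<close>
  have "0 < c / (\<tau>\<^sup>2 + 1)" using c by (intro divide_pos_pos) (auto intro: add_nonneg_pos)
  then obtain h0 where h0: "0 < h0" "\<And>h p. 0 < h \<Longrightarrow> h < h0 \<Longrightarrow> p \<in> R \<Longrightarrow> \<bar>weight p * err h p\<bar> < c / (\<tau>\<^sup>2 + 1)"
    using small_error[OF R] by metis
  have "(- \<tau> * weight (\<tau>, x0)) * Q h (\<tau>, x0) \<le> c" if h: "0 < h" "h < h0" for h
  proof -
    define f where "f = (\<lambda>p. - fst p * (weight p * Q h p) - c)"
    have "f (\<tau>, x0) < 0"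
    proof (rule cone_first_time[where F = "{f}" and M = "1 / \<kappa>" and \<tau> = \<tau> and x\<^sub>0 = x0, folded K_def])
      show "finite {f}" "0 \<le> 1 / \<kappa>" "(\<tau>, x0) \<in> K" "f \<in> {f}" using kappa \<tau> by (auto simp: K_def)
      show "continuous_on K g" if "g \<in> {f}" for g
        using that weighted_Q_continuous[OF h(1) KS] by (auto simp: f_def intro!: continuous_intros)
      show "g (0, x) < 0" if "g \<in> {f}" for g x using that c by (simp add: f_def)
      show "\<exists>m d. \<bar>m\<bar> \<le> 1 / \<kappa> \<and> d < 0 \<and> ((\<lambda>r. g (t + r, x + m * r)) has_real_derivative d) (at 0)"
        if g: "g \<in> {f}" and tx: "(t, x) \<in> K" "0 < t" and g0: "g (t, x) = 0" for g t x
      proof -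
        have t: "0 < t" "t < T" "0 \<le> t" "t \<le> \<tau>" and R: "(t, x) \<in> R" using tx \<tau> KR by (auto simp: K_def)
        define P G d where "P = weight (t, x) * Q h (t, x)" and "G = weight (t, x) * err h (t, x)"
          and "d = weight (t, x) * ((1 + \<theta>) / 2 * (Q h (t, x))\<^sup>2 / (ell (t, x))\<^sup>2)"
        have "((\<lambda>r. f (t + r, x + 1 / ell (t, x) * r)) has_real_derivative - 1 * P - t * (d + G)) (at 0)"
          unfolding f_def
          by (rule derivative_eq_intros weighted_line[OF t(1,2) h(1)] refl | simp add: P_def G_def d_def)+
        moreover have "- 1 * P - t * (d + G) < 0"
        proof -
          have P: "t * P = - c" using g g0 by (simp add: f_def P_def)
          have "t * (t * d) \<ge> t * (t * (growth * P\<^sup>2))"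
            using growth_le[OF t(3,2), of x "Q h (t, x)"] t unfolding P_def d_def by (intro mult_left_mono) auto
          moreover have "t * (t * (growth * P\<^sup>2)) = growth * (t * P) * (t * P)" by (simp add: power2_eq_square)
          moreover have "growth * (t * P) * (t * P) = 2 * c" unfolding P using c by simp
          ultimately have 1: "t * (t * d) \<ge> 2 * c" by simp
          have "t * t * \<bar>G\<bar> \<le> \<tau>\<^sup>2 * (c / (\<tau>\<^sup>2 + 1))"
            using h0(2)[OF h R] t unfolding G_def power2_eq_square by (intro mult_mono) auto
          also have "\<dots> < c"
          proof -
            have "\<tau>\<^sup>2 / (\<tau>\<^sup>2 + 1) < 1" by (simp add: divide_less_eq add_nonneg_pos)
            then have "c * (\<tau>\<^sup>2 / (\<tau>\<^sup>2 + 1)) < c * 1" using c by (intro mult_strict_left_mono) auto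
            then show ?thesis by (simp add: mult.commute)
          qed
          finally have 2: "t * t * \<bar>G\<bar> < c" .
          have "t * t * G \<ge> - (t * t * \<bar>G\<bar>)" by (metis abs_ge_minus_self abs_mult abs_mult_self_eq minus_le_iff)
          with 1 2 have "t * (- 1 * P - t * (d + G)) < 0" using P by (simp add: algebra_simps)
          then show ?thesis using t by (simp add: mult_less_0_iff)
        qed
        ultimately show ?thesis using g abs_inverse_ell[OF t(3,2)] by blast
      qed
    qed
    then show ?thesis by (simp add: f_def algebra_simps)
  qed
  then have "(- \<tau> * weight (\<tau>, x0)) * ux (\<tau>, x0) \<le> c"
    by (rule le_of_tendsto_Q[OF less_imp_le[OF \<tau>(1)] \<tau>(2) h0(1)])
  then show ?thesis
    using weight_pos[of \<tau> x0] \<tau> unfolding c_def[symmetric] by (simp add: field_simps)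
qed

text \<open>The cone principle is run backward. If the solution lasted longer, Z =
  \<open>weight * Q h\<close> would be bounded by some \<open>N\<close> on a compact set, and the
  function \<open>\<phi>\<close>, which explodes at \<open>T1\<close>, exceeds \<open>N\<close> at
  some \<open>\<tau> < T1\<close>. Going back from there Z stays below \<open>\<phi>\<close>,
  because at contact Z grows faster; at \<open>(t0, x0)\<close> this leaves at most half of the
  actual value.\<close>

lemma blow_up:
  assumes t0: "0 < t0" "t0 < T" and pos: "0 < ux (t0, x0)"
  shows "T \<le> t0 + 4 / (growth * (weight (t0, x0) * ux (t0, x0)))"
proof (rule ccontr)
  \<comment> \<open>Starting \<open>\<phi>\<close> at half the actual value makes the final
    inequality contradictory after \<open>h\<close> tends to 0; giving it half of
    \<open>growth\<close> as its rate leaves room for the defect. The explosion time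
    \<open>T1\<close> is the time in the claim.\<close>
  define y where "y = weight (t0, x0) * ux (t0, x0) / 2"
  define T1 where "T1 = 2 / (growth * y)"
  assume "\<not> ?thesis"
  then have T1T: "t0 + T1 < T" by (simp add: T1_def y_def)
  have y: "0 < y" using pos weight_pos[of t0 x0] t0 by (simp add: y_def)
  have gr: "0 < growth" using growth_pos t0 by simp
  have T1: "0 < T1" "growth = 2 / (y * T1)" using y gr by (auto simp: T1_def field_simps)
  define R where "R = {t0..t0 + T1} \<times> {x0 - T1 / \<kappa>..x0 + T1 / \<kappa>}"
  have R: "compact R" "R \<subseteq> {0..<T} \<times> UNIV" using T1T t0 by (auto simp: R_def intro!: compact_Times)
  obtain N where N: "\<And>h p. 0 \<le> h \<Longrightarrow> h \<le> 1 \<Longrightarrow> p \<in> R \<Longrightarrow> weight p * Q h p \<le> N"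
  proof -
    have "continuous_on ({0..1} \<times> R) (\<lambda>z. weight (snd z))"
      by (rule continuous_on_compose2[OF weight_continuous continuous_on_snd[OF continuous_on_id]]) (use R(2) in auto)
    moreover have "continuous_on ({0..1} \<times> R) (\<lambda>z. Q (fst z) (snd z))"
      by (rule continuous_on_subset[OF Q_continuous(1)]) (use R(2) in auto)
    ultimately have "continuous_on ({0..1} \<times> R) (\<lambda>z. weight (snd z) * Q (fst z) (snd z))"
      by (rule continuous_on_mult)
    then have "compact ((\<lambda>z. weight (snd z) * Q (fst z) (snd z)) ` ({0..1} \<times> R))"
      by (intro compact_continuous_image compact_Times R(1)) auto
    then obtain N where "\<forall>w\<in>(\<lambda>z. weight (snd z) * Q (fst z) (snd z)) ` ({0..1} \<times> R). norm w \<le> N"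
      using compact_imp_bounded bounded_iff by blast
    then show ?thesis by (intro that[of N]) force
  qed
  define N' where "N' = max N y + 1"
  have N': "N < N'" "y < N'" by (auto simp: N'_def)
  \<comment> \<open>The time at which \<open>\<phi>\<close> reaches \<open>N'\<close>.\<close>
  define \<tau> where "\<tau> = T1 * (1 - y / N')"
  have \<tau>: "0 < \<tau>" "\<tau> < T1" using T1 y N' by (auto simp: \<tau>_def field_simps)
  define \<phi> where "\<phi> r = y / (1 - r / T1)" for r
  have \<phi>0: "\<phi> 0 = y" by (simp add: \<phi>_def)
  have \<phi>\<tau>: "\<phi> \<tau> = N'" using T1 y N' by (simp add: \<phi>_def \<tau>_def)
  have \<phi>y: "y \<le> \<phi> r" if "0 \<le> r" "r < T1" for r
    using that y T1 unfolding \<phi>_def by (simp add: field_simps)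
  have \<phi>': "(\<phi> has_real_derivative growth / 2 * (\<phi> r)\<^sup>2) (at r)" if "r < T1" for r
  proof -
    have "1 - r / T1 \<noteq> 0" using that T1 by (simp add: field_simps)
    then have "(\<phi> has_real_derivative (0 * (1 - r / T1) - y * (- (1 / T1))) / ((1 - r / T1) * (1 - r / T1))) (at r)"
      unfolding \<phi>_def using T1 by (auto intro!: derivative_eq_intros)
    moreover have "(0 * (1 - r / T1) - y * (- (1 / T1))) / ((1 - r / T1) * (1 - r / T1)) = growth / 2 * (\<phi> r)\<^sup>2"
      unfolding \<phi>_def T1(2) using y T1 by (simp add: power_divide power2_eq_square)
    ultimately show ?thesis by (rule DERIV_cong)
  qed
  define K where "K = {(t, x). 0 \<le> t \<and> t \<le> \<tau> \<and> \<bar>x - x0\<bar> \<le> (1 / \<kappa>) * (\<tau> - t)}"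
  have KR: "(t0 + \<tau> - t, x) \<in> R" if "(t, x) \<in> K" for t x
  proof -
    have "(1 / \<kappa>) * (\<tau> - t) \<le> (1 / \<kappa>) * T1"
      using kappa that \<tau> by (intro mult_left_mono) (auto simp: K_def)
    then show ?thesis using that \<tau> by (auto simp: K_def R_def)
  qed
  have "0 < growth / 2 * y\<^sup>2" using gr y by simp
  then obtain h0 where h0: "0 < h0" "\<And>h p. 0 < h \<Longrightarrow> h < h0 \<Longrightarrow> p \<in> R \<Longrightarrow> \<bar>weight p * err h p\<bar> < growth / 2 * y\<^sup>2"
    using small_error[OF R] by metis
  have "weight (t0, x0) * Q h (t0, x0) \<le> y" if h: "0 < h" "h < min h0 1" for h
  proof -
    \<comment> \<open>Time reversal: cone time 0 is the time \<open>t0 + \<tau>\<close>, and the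
      apex of the cone is \<open>(t0, x0)\<close>.\<close>
    define f where "f = (\<lambda>p. weight (t0 + \<tau> - fst p, snd p) * Q h (t0 + \<tau> - fst p, snd p) - \<phi> (\<tau> - fst p))"
    have "f (\<tau>, x0) < 0"
    proof (rule cone_first_time[where F = "{f}" and M = "1 / \<kappa>" and \<tau> = \<tau> and x\<^sub>0 = x0, folded K_def])
      show "finite {f}" "0 \<le> 1 / \<kappa>" "(\<tau>, x0) \<in> K" "f \<in> {f}" using kappa \<tau> by (auto simp: K_def)
      have "continuous_on K f"
        unfolding f_def
      proof (rule continuous_on_diff)
        show "continuous_on K (\<lambda>p. weight (t0 + \<tau> - fst p, snd p) * Q h (t0 + \<tau> - fst p, snd p))"
          by (rule continuous_on_compose2[OF weighted_Q_continuous[OF h(1) R(2)], of K "\<lambda>p. (t0 + \<tau> - fst p, snd p)"])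
            (use KR in \<open>auto intro!: continuous_intros\<close>)
        have "continuous_on {..<T1} \<phi>"
          by (rule continuous_at_imp_continuous_on) (use \<phi>' DERIV_isCont in blast)
        then show "continuous_on K (\<lambda>p. \<phi> (\<tau> - fst p))"
          by (rule continuous_on_compose2) (use \<tau> in \<open>auto simp: K_def intro!: continuous_intros\<close>)
      qed
      then show "continuous_on K g" if "g \<in> {f}" for g using that by simp
      show "g (0, x) < 0" if "g \<in> {f}" "(0, x) \<in> K" for g x
        using that KR[of 0 x] N[of h "(t0 + \<tau>, x)"] h N' by (simp add: f_def \<phi>\<tau>)
      show "\<exists>m d. \<bar>m\<bar> \<le> 1 / \<kappa> \<and> d < 0 \<and> ((\<lambda>r. g (t + r, x + m * r)) has_real_derivative d) (at 0)"
        if g: "g \<in> {f}" and tx: "(t, x) \<in> K" "0 < t" and g0: "g (t, x) = 0" for g t x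
      proof -
        define t' where "t' = t0 + \<tau> - t"
        have t: "0 < t'" "t' < T" "0 \<le> t'" "0 \<le> \<tau> - t" "\<tau> - t < T1" and R: "(t', x) \<in> R"
          using tx \<tau> KR[OF tx(1)] t0 T1T by (auto simp: K_def t'_def)
        define P G d m where "P = weight (t', x) * Q h (t', x)" and "G = weight (t', x) * err h (t', x)"
          and "d = weight (t', x) * ((1 + \<theta>) / 2 * (Q h (t', x))\<^sup>2 / (ell (t', x))\<^sup>2)" and "m = 1 / ell (t', x)"
        have 1: "((\<lambda>r. weight (t' + r, x + m * r) * Q h (t' + r, x + m * r)) has_real_derivative d + G) (at (- 0))"
          using weighted_line[OF t(1,2) h(1), of x] by (simp add: d_def G_def m_def)
        have 2: "((\<lambda>r. weight (t' + - r, x + m * - r) * Q h (t' + - r, x + m * - r)) has_real_derivative (d + G) * - 1) (at 0)"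
          by (rule DERIV_chain2[where f = "\<lambda>r. weight (t' + r, x + m * r) * Q h (t' + r, x + m * r)" and g = uminus, OF 1])
            (auto intro!: derivative_eq_intros)
        have 3: "((\<lambda>r. \<phi> (\<tau> - t - r)) has_real_derivative growth / 2 * (\<phi> (\<tau> - t))\<^sup>2 * - 1) (at 0)"
          by (rule DERIV_chain2[of \<phi>]) (use \<phi>'[OF t(5)] in \<open>auto intro!: derivative_eq_intros\<close>)
        have "(\<lambda>r. f (t + r, x + (- m) * r)) = (\<lambda>r. weight (t' + - r, x + m * - r) * Q h (t' + - r, x + m * - r) - \<phi> (\<tau> - t - r))"
          by (simp add: f_def t'_def fun_eq_iff algebra_simps)
        with DERIV_diff[OF 2 3]
        have "((\<lambda>r. f (t + r, x + (- m) * r)) has_real_derivative (d + G) * - 1 - growth / 2 * (\<phi> (\<tau> - t))\<^sup>2 * - 1) (at 0)"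
          by simp
        moreover have "(d + G) * - 1 - growth / 2 * (\<phi> (\<tau> - t))\<^sup>2 * - 1 < 0"
        proof -
          have P: "\<phi> (\<tau> - t) = P" using g g0 by (simp add: f_def P_def t'_def)
          have "y\<^sup>2 \<le> P\<^sup>2" using \<phi>y[OF t(4,5)] y by (intro power_mono) (auto simp: P)
          then have "growth * y\<^sup>2 \<le> growth * P\<^sup>2" using gr by (intro mult_left_mono) auto
          moreover have "growth * P\<^sup>2 \<le> d" using growth_le[OF t(3,2), of x "Q h (t', x)"] by (simp add: P_def d_def)
          moreover have "\<bar>G\<bar> < growth * y\<^sup>2 / 2" using h0(2)[of h, OF _ _ R] h by (simp add: G_def)
          moreover have "- d - g + A / 2 < 0" if "Y \<le> A" "A \<le> d" "\<bar>g\<bar> < Y / 2" for Y A d g :: real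
            using that by linarith
          ultimately have "- d - G + growth * P\<^sup>2 / 2 < 0" by blast
          then show ?thesis unfolding P by simp
        qed
        moreover have "\<bar>- m\<bar> \<le> 1 / \<kappa>" using abs_inverse_ell[OF t(3,2)] by (simp add: m_def)
        ultimately show ?thesis using g by blast
      qed
    qed
    then show ?thesis by (simp add: f_def \<phi>0)
  qed
  then have "weight (t0, x0) * ux (t0, x0) \<le> y"
    using le_of_tendsto_Q[of t0 "min h0 1"] t0 h0(1) by simp
  then show False using y unfolding y_def by linarith
qed

end

text \<open>The equations hold only at positive times, so a positive derivative at time 0 is first
  carried to some \<open>t0 > 0\<close> by continuity; then \<open>blow_up\<close> contradicts a
  sufficiently long existence time.\<close>

lemma no_growth:
  assumes P: "\<And>T. 0 < T \<Longrightarrow> \<exists>ut ux vt vx. riemann_pair \<theta> \<kappa> B T s u ut ux v vt vx"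
    and d: "((\<lambda>y. u (0, y)) has_real_derivative d) (at x0)"
  shows "d \<le> 0"
proof (rule ccontr)
  assume "\<not> d \<le> 0"
  obtain ut ux vt vx where "riemann_pair \<theta> \<kappa> B 1 s u ut ux v vt vx" using P[of 1] by auto
  then interpret P: riemann_pair \<theta> \<kappa> B 1 s u ut ux v vt vx .
  have "ux (0, x0) = d"
    using C1_partials_dx[OF P.u_partials, of 0 x0] d DERIV_unique by auto
  have "continuous_on {0..1/2} (\<lambda>t. ux (t, x0))"
    by (rule continuous_on_compose2[OF P.ux_vx_continuous(1)]) (auto intro!: continuous_intros)
  then have "((\<lambda>t. ux (t, x0)) \<longlongrightarrow> d) (at 0 within {0..1/2})"
    using \<open>ux (0, x0) = d\<close> by (auto simp: continuous_on_def)
  then have "((\<lambda>t. ux (t, x0)) \<longlongrightarrow> d) (at_right 0)"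
    by (simp add: at_within_Icc_at_right)
  then have "\<forall>\<^sub>F t in at_right 0. 0 < ux (t, x0)"
    using \<open>\<not> d \<le> 0\<close> by (intro order_tendstoD(1)) auto
  moreover have "\<forall>\<^sub>F t in at_right 0. t \<in> {0<..<1::real}"
    by (rule eventually_at_right_real) simp
  ultimately have "\<forall>\<^sub>F t in at_right 0. 0 < ux (t, x0) \<and> t \<in> {0<..<1}" by (rule eventually_conj)
  then have "\<exists>t. 0 < ux (t, x0) \<and> t \<in> {0<..<1}" by (rule eventually_happens'[rotated]) simp
  then obtain t0 where t0: "0 < t0" "t0 < 1" "0 < ux (t0, x0)" by auto
  \<comment> \<open>\<open>growth\<close> and \<open>weight\<close> involve neither the existence
    time nor the chosen partial derivatives, and \<open>ux (t0, x0)\<close> is determined by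
    \<open>u\<close>; hence \<open>c\<close> bounds every admissible \<open>T\<close> above
    \<open>t0\<close>.\<close>
  define c where "c = t0 + 4 / (P.growth * (P.weight (t0, x0) * ux (t0, x0)))"
  define T where "T = max 1 c + 1"
  have "0 < T" by (simp add: T_def)
  from P[OF this] obtain ut' ux' vt' vx' where "riemann_pair \<theta> \<kappa> B T s u ut' ux' v vt' vx'" by blast
  then interpret R: riemann_pair \<theta> \<kappa> B T s u ut' ux' v vt' vx' .
  have "t0 < T" using t0 by (simp add: T_def)
  then have "ux' (t0, x0) = ux (t0, x0)"
    using C1_partials_dx[OF P.u_partials, of t0 x0] C1_partials_dx[OF R.u_partials, of t0 x0] t0 DERIV_unique by auto
  then have "T \<le> c" using R.blow_up[OF t0(1) \<open>t0 < T\<close>, of x0] t0(3) by (simp add: c_def)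
  then show False by (simp add: T_def)
qed

section \<open>A linear Volterra equation in the plane\<close>

text \<open>The signed integral of \<open>f\<close> from \<open>a\<close> to \<open>b\<close>, meaningful also for \<open>b < a\<close>; the fixed domain of integration
  makes continuity in parameters immediate.\<close>

definition sint :: "(real \<Rightarrow> real) \<Rightarrow> real \<Rightarrow> real \<Rightarrow> real" where
  "sint f a b = integral {0..1} (\<lambda>r. (b - a) * f (a + (b - a) * r))"

lemma sint_antiderivative:
  assumes "\<And>x. (G has_real_derivative f x) (at x)"
  shows "sint f a b = G b - G a"
proof -
  have "((\<lambda>r. (b - a) * f (a + (b - a) * r)) has_integral G (a + (b - a) * 1) - G (a + (b - a) * 0)) {0..1}"
  proof (rule fundamental_theorem_of_calculus)
    fix r :: real assume "r \<in> {0..1}"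
    have "((\<lambda>r. G (a + (b - a) * r)) has_real_derivative f (a + (b - a) * r) * (b - a)) (at r within {0..1})"
      by (rule DERIV_chain2[OF assms]) (auto intro!: derivative_eq_intros)
    then show "((\<lambda>r. G (a + (b - a) * r)) has_vector_derivative (b - a) * f (a + (b - a) * r)) (at r within {0..1})"
      by (simp add: has_real_derivative_iff_has_vector_derivative mult.commute)
  qed simp
  from integral_unique[OF this] show ?thesis by (simp add: sint_def)
qed

lemma continuous_antiderivative:
  fixes f :: "real \<Rightarrow> real"
  assumes "continuous_on UNIV f"
  obtains G where "\<And>x. (G has_real_derivative f x) (at x)"
proof -
  have "\<exists>G. \<forall>x::real. - \<infinity> < ereal x \<longrightarrow> ereal x < \<infinity> \<longrightarrow> (G has_vector_derivative f x) (at x)"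
    using assms by (intro einterval_antiderivative) (auto simp: continuous_on_eq_continuous_at)
  then show ?thesis using that by (auto simp: has_real_derivative_iff_has_vector_derivative)
qed

lemma sint_has_derivative:
  assumes "continuous_on UNIV f"
  shows "((\<lambda>b. sint f a b) has_real_derivative f b) (at b)"
    and "((\<lambda>a. sint f a b) has_real_derivative - f a) (at a)"
proof -
  obtain G where G: "\<And>x. (G has_real_derivative f x) (at x)"
    using continuous_antiderivative[OF assms] by blast
  show "((\<lambda>b. sint f a b) has_real_derivative f b) (at b)" "((\<lambda>a. sint f a b) has_real_derivative - f a) (at a)"
    unfolding sint_antiderivative[OF G] by (auto intro!: derivative_eq_intros G)
qed

lemma sint_same [simp]: "sint f a a = 0"
  by (simp add: sint_def)

lemma sint_continuous:
  fixes a b :: "'a::topological_space \<Rightarrow> real" and f :: "'a \<Rightarrow> real \<Rightarrow> real"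
  assumes "continuous_on UNIV a" "continuous_on UNIV b" "continuous_on UNIV (\<lambda>(z, s). f z s)"
  shows "continuous_on UNIV (\<lambda>z. sint (f z) (a z) (b z))"
proof -
  have a: "continuous_on (UNIV \<times> {0..1::real}) (\<lambda>zr. a (fst zr))" and b: "continuous_on (UNIV \<times> {0..1::real}) (\<lambda>zr. b (fst zr))"
    by (rule continuous_on_compose2[OF assms(1)] continuous_on_compose2[OF assms(2)]; auto intro!: continuous_intros)+
  have "continuous_on (UNIV \<times> {0..1::real}) (\<lambda>zr. case (fst zr, a (fst zr) + (b (fst zr) - a (fst zr)) * snd zr) of (z, s) \<Rightarrow> f z s)"
    by (rule continuous_on_compose2[OF assms(3)]) (auto intro!: continuous_intros a b)
  then have "continuous_on (UNIV \<times> {0..1}) (\<lambda>(z, r). (b z - a z) * f z (a z + (b z - a z) * r))"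
    unfolding case_prod_beta' by (intro continuous_intros a b) simp
  from integral_continuous_on_param[OF this[folded cbox_interval]] show ?thesis by (simp add: sint_def)
qed

lemma sint_nonneg:
  assumes "a \<le> b" "\<And>s. a \<le> s \<Longrightarrow> s \<le> b \<Longrightarrow> 0 \<le> f s" 
  shows "0 \<le> sint f a b"
proof -
  have "0 \<le> (b - a) * f (a + (b - a) * r)" if r: "r \<in> {0..1}" for r
  proof -
    have "(b - a) * r \<le> (b - a) * 1" using r assms by (intro mult_left_mono) auto
    moreover have "0 \<le> (b - a) * r" using r assms by auto
    ultimately show ?thesis using assms by (intro mult_nonneg_nonneg) auto
  qed
  \<comment> \<open>If the integrand is not integrable, its \<open>integral\<close> is 0 by
    convention.\<close>
  then have "0 \<le> integral {0..1} (\<lambda>r. (b - a) * f (a + (b - a) * r))"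
    by (metis integral_nonneg not_integrable_integral order_refl)
  then show ?thesis by (simp only: sint_def)
qed

text \<open>\<open>k r\<close> is the distance of the point of integration from the end
  \<open>a\<close> or from the end \<open>b\<close>. The Volterra operator needs both, since its two
  integrals meet the diagonal at opposite ends. The divisor \<open>Suc n\<close> builds up the
  factorial in \<open>it_bound\<close>.\<close>

lemma sint_bound:
  assumes f: "continuous_on UNIV f" and bd: "\<And>r. 0 \<le> r \<Longrightarrow> r \<le> 1 \<Longrightarrow> \<bar>f (a + (b - a) * r)\<bar> \<le> c * (k r) ^ n"
    and k: "(k = (\<lambda>r. \<bar>b - a\<bar> * r)) \<or> (k = (\<lambda>r. \<bar>b - a\<bar> * (1 - r)))"
  shows "\<bar>sint f a b\<bar> \<le> c * \<bar>b - a\<bar> ^ Suc n / real (Suc n)"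
proof -
  have 1: "((\<lambda>r. r ^ n) has_integral 1 / real (Suc n)) {0..1}"
  proof -
    have "((\<lambda>r. r ^ n) has_integral 1 ^ Suc n / real (Suc n) - 0 ^ Suc n / real (Suc n)) {0..1::real}"
    proof (rule fundamental_theorem_of_calculus)
      show "((\<lambda>r. r ^ Suc n / real (Suc n)) has_vector_derivative r ^ n) (at r within {0..1})" for r :: real
        using DERIV_cdivide[OF DERIV_power_Suc[OF DERIV_ident, where n = n], where c = "real (Suc n)"]
        by (simp add: has_real_derivative_iff_has_vector_derivative[symmetric] del: power_Suc)
    qed simp
    then show ?thesis by simp
  qed
  have 2: "((\<lambda>r. (1 - r) ^ n) has_integral 1 / real (Suc n)) {0..1}"
  proof -
    have "((\<lambda>r. (1 - r) ^ n) has_integral - ((1 - 1) ^ Suc n / real (Suc n)) - - ((1 - 0) ^ Suc n / real (Suc n))) {0..1::real}"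
    proof (rule fundamental_theorem_of_calculus)
      have "((\<lambda>r::real. 1 - r) has_real_derivative - 1) (at r within {0..1})" for r
        by (auto intro!: derivative_eq_intros)
      from DERIV_minus[OF DERIV_cdivide[OF DERIV_power_Suc[OF this, where n = n], where c = "real (Suc n)"]]
      show "((\<lambda>r. - ((1 - r) ^ Suc n / real (Suc n))) has_vector_derivative (1 - r) ^ n) (at r within {0..1})" for r :: real
        by (simp add: has_real_derivative_iff_has_vector_derivative[symmetric] del: power_Suc)
    qed simp
    then show ?thesis by simp
  qed
  have "((\<lambda>r. (k r) ^ n) has_integral \<bar>b - a\<bar> ^ n * (1 / real (Suc n))) {0..1}"
    using k has_integral_mult_right[OF 1, of "\<bar>b - a\<bar> ^ n"] has_integral_mult_right[OF 2, of "\<bar>b - a\<bar> ^ n"]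
    by (auto simp: power_mult_distrib)
  from has_integral_mult_right[OF this, of "\<bar>b - a\<bar> * c"]
  have 3: "((\<lambda>r. \<bar>b - a\<bar> * c * (k r) ^ n) has_integral \<bar>b - a\<bar> * c * (\<bar>b - a\<bar> ^ n * (1 / real (Suc n)))) {0..1}" .
  have "norm (integral {0..1} (\<lambda>r. (b - a) * f (a + (b - a) * r))) \<le> integral {0..1} (\<lambda>r. \<bar>b - a\<bar> * c * (k r) ^ n)"
  proof (rule integral_norm_bound_integral)
    show "(\<lambda>r. (b - a) * f (a + (b - a) * r)) integrable_on {0..1}"
      by (intro integrable_continuous_real continuous_intros continuous_on_compose2[OF f]) auto
    show "(\<lambda>r. \<bar>b - a\<bar> * c * (k r) ^ n) integrable_on {0..1}" using 3 by blast
    fix r :: real assume "r \<in> {0..1}"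
    then show "norm ((b - a) * f (a + (b - a) * r)) \<le> \<bar>b - a\<bar> * c * (k r) ^ n"
      using bd[of r] by (auto simp: abs_mult mult.assoc intro!: mult_left_mono)
  qed
  also have "\<dots> = c * \<bar>b - a\<bar> ^ Suc n / real (Suc n)" using integral_unique[OF 3] by simp
  finally show ?thesis by (simp add: sint_def)
qed

lemma sint_add:
  assumes "continuous_on UNIV f" "continuous_on UNIV g"
  shows "sint (\<lambda>s. f s + g s) a b = sint f a b + sint g a b"
proof -
  obtain F G where F: "\<And>x. (F has_real_derivative f x) (at x)" and G: "\<And>x. (G has_real_derivative g x) (at x)"
    using assms continuous_antiderivative by metis
  have "((\<lambda>x. F x + G x) has_real_derivative f x + g x) (at x)" for x
    by (intro derivative_intros F G)
  from sint_antiderivative[OF this] show ?thesis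
    unfolding sint_antiderivative[OF F] sint_antiderivative[OF G] by simp
qed

lemma sint_tendsto:
  assumes u: "uniform_limit (closed_segment a b) f g sequentially" and c: "\<And>n::nat. continuous_on UNIV (f n)"
  shows "(\<lambda>n. sint (f n) a b) \<longlonglongrightarrow> sint g a b"
proof -
  have seg: "a + (b - a) * r \<in> closed_segment a b" if "r \<in> {0..1}" for r
    using that by (auto simp: closed_segment_def algebra_simps intro!: exI[of _ r])
  have "uniform_limit {0..1} (\<lambda>n r. f n (a + (b - a) * r)) (\<lambda>r. g (a + (b - a) * r)) sequentially"
    using seg by (intro uniform_limit_compose'[OF u, where h = "\<lambda>r. a + (b - a) * r"]) auto
  then have u': "uniform_limit {0..1} (\<lambda>n r. (b - a) * f n (a + (b - a) * r)) (\<lambda>r. (b - a) * g (a + (b - a) * r)) sequentially"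
    by (rule bounded_linear.uniform_limit[OF bounded_linear_mult_right])
  have "continuous_on {0..1} (\<lambda>r. (b - a) * f n (a + (b - a) * r))" for n
    by (intro continuous_intros continuous_on_compose2[OF c]) auto
  from uniform_limit_integral[OF u' this sequentially_bot]
  obtain I J where I: "\<And>n. ((\<lambda>r. (b - a) * f n (a + (b - a) * r)) has_integral I n) {0..1}"
    and J: "((\<lambda>r. (b - a) * g (a + (b - a) * r)) has_integral J) {0..1}" and "I \<longlonglongrightarrow> J" by blast
  moreover have "I = (\<lambda>n. sint (f n) a b)" "J = sint g a b"
    unfolding sint_def fun_eq_iff by (simp_all only: integral_unique[OF I] integral_unique[OF J] simp_thms)
  ultimately show ?thesis by simp
qed

text \<open>The unknown is a function equal to \<open>A * p + B * q\<close>, where p and q agree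
  with \<open>g\<close> on the diagonal and arise by integrating the unknown between a point and the
  diagonal, in the first and in the second variable. Its Neumann series is summed on the whole
  plane; only sign statements are restricted to one side of the diagonal.\<close>

locale volterra =
  fixes A B :: "real \<times> real \<Rightarrow> real" and g :: "real \<Rightarrow> real"
  assumes A: "continuous_on UNIV A" and B: "continuous_on UNIV B" and g: "continuous_on UNIV g"
begin

definition step where
  "step F z = A z * sint (\<lambda>s. F (s, snd z)) (fst z) (snd z) + B z * sint (\<lambda>s. F (fst z, s)) (fst z) (snd z)"

definition start where "start z = A z * g (snd z) + B z * g (fst z)"

definition it where "it n = (step ^^ n) start"

definition lim where "lim z = (\<Sum>n. it n z)"

lemma start_continuous: "continuous_on UNIV start"
  unfolding start_def
  by (intro continuous_intros A B continuous_on_compose2[OF g]) auto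

lemma slice_continuous:
  fixes F :: "real \<times> real \<Rightarrow> real"
  assumes "continuous_on UNIV F"
  shows "continuous_on UNIV (\<lambda>s. F (s, y))" "continuous_on UNIV (\<lambda>s. F (x, s))"
  by (rule continuous_on_compose2[OF assms]; auto intro!: continuous_intros)+

lemma step_continuous:
  assumes "continuous_on UNIV F"
  shows "continuous_on UNIV (step F)"
  unfolding step_def
  by (intro continuous_intros A B sint_continuous)
    (auto simp: case_prod_beta' intro!: continuous_intros continuous_on_compose2[OF assms])

lemma it_Suc: "it (Suc n) = step (it n)"
  by (simp add: it_def)

lemma it_continuous: "continuous_on UNIV (it n)"
  by (induction n) (simp_all add: it_Suc step_continuous, simp add: it_def start_continuous)

text \<open>Each step integrates a power of the distance to the diagonal, which produces the
  factorial; the 2 counts the two integrals. A square is used because it contains both segments from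
  a point to the diagonal.\<close>

lemma it_bound:
  assumes K: "\<And>z. z \<in> {-N..N} \<times> {-N..N} \<Longrightarrow> \<bar>A z\<bar> \<le> K \<and> \<bar>B z\<bar> \<le> K \<and> \<bar>start z\<bar> \<le> C"
  shows "z \<in> {-N..N} \<times> {-N..N} \<Longrightarrow> \<bar>it n z\<bar> \<le> C * (2 * K) ^ n / fact n * \<bar>snd z - fst z\<bar> ^ n"
proof (induction n arbitrary: z)
  case 0
  then show ?case using K[OF 0] by (simp add: it_def)
next
  case (Suc n)
  obtain x y where z: "z = (x, y)" by (cases z)
  have xy: "x \<in> {-N..N}" "y \<in> {-N..N}" using Suc.prems z by auto
  have seg: "x + (y - x) * r \<in> {-N..N}" if "0 \<le> r" "r \<le> 1" for r
  proof -
    have "x + (y - x) * r \<in> closed_segment x y"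
      using that by (auto simp: closed_segment_def algebra_simps intro!: exI[of _ r])
    moreover have "closed_segment x y \<subseteq> {-N..N}" using xy by (intro closed_segment_subset) auto
    ultimately show ?thesis by blast
  qed
  define c where "c = C * (2 * K) ^ n / fact n"
  have "\<bar>sint (\<lambda>s. it n (s, y)) x y\<bar> \<le> c * \<bar>y - x\<bar> ^ Suc n / real (Suc n)"
  proof (rule sint_bound[where k = "\<lambda>r. \<bar>y - x\<bar> * (1 - r)"])
    fix r :: real assume r: "0 \<le> r" "r \<le> 1"
    have "y - (x + (y - x) * r) = (y - x) * (1 - r)" by (simp add: algebra_simps)
    then have "\<bar>y - (x + (y - x) * r)\<bar> = \<bar>y - x\<bar> * (1 - r)" using r by (simp add: abs_mult)
    then show "\<bar>it n (x + (y - x) * r, y)\<bar> \<le> c * (\<bar>y - x\<bar> * (1 - r)) ^ n"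
      using Suc.IH[of "(x + (y - x) * r, y)"] seg[OF r] xy by (auto simp: c_def)
  qed (auto intro: slice_continuous it_continuous)
  moreover have "\<bar>sint (\<lambda>s. it n (x, s)) x y\<bar> \<le> c * \<bar>y - x\<bar> ^ Suc n / real (Suc n)"
  proof (rule sint_bound[where k = "\<lambda>r. \<bar>y - x\<bar> * r"])
    fix r :: real assume r: "0 \<le> r" "r \<le> 1"
    have "\<bar>x + (y - x) * r - x\<bar> = \<bar>y - x\<bar> * r" using r by (simp add: abs_mult)
    then show "\<bar>it n (x, x + (y - x) * r)\<bar> \<le> c * (\<bar>y - x\<bar> * r) ^ n"
      using Suc.IH[of "(x, x + (y - x) * r)"] seg[OF r] xy by (auto simp: c_def)
  qed (auto intro: slice_continuous it_continuous)
  moreover define e where "e = c * \<bar>y - x\<bar> ^ Suc n / real (Suc n)"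
  ultimately have S: "\<bar>sint (\<lambda>s. it n (s, y)) x y\<bar> \<le> e" "\<bar>sint (\<lambda>s. it n (x, s)) x y\<bar> \<le> e" by simp_all
  have AB: "\<bar>A z\<bar> \<le> K" "\<bar>B z\<bar> \<le> K" "0 \<le> K" using K[OF Suc.prems] by auto
  have "\<bar>A z * sint (\<lambda>s. it n (s, y)) x y\<bar> \<le> K * e" "\<bar>B z * sint (\<lambda>s. it n (x, s)) x y\<bar> \<le> K * e"
    unfolding abs_mult using AB S by (intro mult_mono; simp)+
  then have "\<bar>it (Suc n) z\<bar> \<le> K * e + K * e"
    unfolding it_Suc step_def z fst_conv snd_conv
    by (intro order_trans[OF abs_triangle_ineq] add_mono)
  also have "\<dots> = C * (2 * K) ^ Suc n / fact (Suc n) * \<bar>snd z - fst z\<bar> ^ Suc n"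
    by (simp add: c_def e_def z field_simps)
  finally show ?case .
qed

lemma uniform_limit_square: "uniform_limit ({-N..N} \<times> {-N..N}) (\<lambda>n z. \<Sum>i<n. it i z) lim sequentially"
proof -
  let ?S = "{-N..N} \<times> {-N..N} :: (real \<times> real) set"
  have "\<exists>K. \<forall>z\<in>?S. \<bar>f z\<bar> \<le> K" if "continuous_on UNIV f" for f :: "real \<times> real \<Rightarrow> real"
  proof -
    have "compact (f ` ?S)"
      by (intro compact_continuous_image continuous_on_subset[OF that] compact_Times) auto
    then obtain N where "\<forall>y\<in>f ` ?S. norm y \<le> N" using compact_imp_bounded bounded_iff by blast
    then show ?thesis by auto
  qed
  from this[OF A] this[OF B] this[OF start_continuous] obtain K1 K2 C where
    "\<And>z. z \<in> ?S \<Longrightarrow> \<bar>A z\<bar> \<le> K1" "\<And>z. z \<in> ?S \<Longrightarrow> \<bar>B z\<bar> \<le> K2" "\<And>z. z \<in> ?S \<Longrightarrow> \<bar>start z\<bar> \<le> C" by metis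
  then have K: "\<bar>A z\<bar> \<le> max K1 K2 \<and> \<bar>B z\<bar> \<le> max K1 K2 \<and> \<bar>start z\<bar> \<le> C" if "z \<in> ?S" for z
    using that by (simp add: max.coboundedI1 max.coboundedI2)
  define K where "K = max K1 K2"
  have b: "\<bar>it n z\<bar> \<le> C * (inverse (fact n) * (2 * K * (2 * N)) ^ n)" if z: "z \<in> ?S" for n z
  proof -
    have K0: "0 \<le> K" "0 \<le> C" using K[OF z] unfolding K_def by linarith+
    have "\<bar>it n z\<bar> \<le> C * (2 * K) ^ n / fact n * \<bar>snd z - fst z\<bar> ^ n"
      by (rule it_bound[OF _ z]) (use K K_def in auto)
    also have "\<dots> \<le> C * (2 * K) ^ n / fact n * (2 * N) ^ n"
      using z K0 by (intro mult_left_mono power_mono) auto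
    also have "\<dots> = C * (inverse (fact n) * (2 * K * (2 * N)) ^ n)"
      by (subst power_mult_distrib[of "2 * K" "2 * N"]) (simp only: divide_inverse mult_ac)
    finally show ?thesis .
  qed
  have "summable (\<lambda>n. C * (inverse (fact n) * (2 * K * (2 * N)) ^ n))"
    by (intro summable_mult summable_exp)
  from Weierstrass_m_test[OF _ this, of ?S it] b show ?thesis by (simp add: lim_def[abs_def])
qed

lemma lim_continuous: "continuous_on UNIV lim"
proof (rule continuous_at_imp_continuous_on, rule ballI)
  fix z :: "real \<times> real"
  define N where "N = \<bar>fst z\<bar> + \<bar>snd z\<bar> + 1"
  have "continuous_on ({-N..N} \<times> {-N..N}) lim"
    by (rule uniform_limit_theorem[OF _ uniform_limit_square])
      (auto intro!: always_eventually continuous_on_sum continuous_on_subset[OF it_continuous])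
  then have "continuous_on ({-N<..<N} \<times> {-N<..<N}) lim"
    by (rule continuous_on_subset) auto
  moreover have "open ({-N<..<N} \<times> {-N<..<N})" by (intro open_Times) auto
  moreover have "z \<in> {-N<..<N} \<times> {-N<..<N}" by (cases z) (auto simp: N_def)
  ultimately show "isCont lim z" by (metis continuous_on_eq_continuous_at)
qed

lemma lim_eq:
  "lim z = A z * (g (snd z) + sint (\<lambda>s. lim (s, snd z)) (fst z) (snd z))
     + B z * (g (fst z) + sint (\<lambda>s. lim (fst z, s)) (fst z) (snd z))"
proof -
  define P where "P n z = (\<Sum>i<n. it i z)" for n z
  have Pc: "continuous_on UNIV (P n)" for n
    unfolding P_def by (intro continuous_on_sum it_continuous)
  have PS: "P (Suc n) w = start w + step (P n) w" for n w
  proof (induction n arbitrary: w)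
    case 0
    show ?case by (simp add: P_def it_def step_def sint_def)
  next
    case (Suc n)
    have "step (\<lambda>w. P n w + it n w) w = step (P n) w + step (it n) w"
      unfolding step_def
      by (simp add: sint_add slice_continuous Pc it_continuous algebra_simps)
    moreover have "P (Suc n) = (\<lambda>w. P n w + it n w)" by (simp add: P_def fun_eq_iff)
    moreover have "P (Suc (Suc n)) w = P (Suc n) w + step (it n) w" by (simp add: P_def it_Suc)
    ultimately show ?case using Suc.IH[of w] by simp
  qed
  obtain x y where z: "z = (x, y)" by (cases z)
  define N where "N = \<bar>x\<bar> + \<bar>y\<bar>"
  have seg: "closed_segment x y \<subseteq> {-N..N}" by (intro closed_segment_subset) (auto simp: N_def)
  have xy: "x \<in> {-N..N}" "y \<in> {-N..N}" by (auto simp: N_def)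
  have u: "uniform_limit ({-N..N} \<times> {-N..N}) P lim sequentially"
    using uniform_limit_square[of N] by (simp add: P_def[abs_def])
  have "uniform_limit (closed_segment x y) (\<lambda>n s. P n (s, y)) (\<lambda>s. lim (s, y)) sequentially"
    by (rule uniform_limit_compose'[OF u, where h = "\<lambda>s. (s, y)"]) (use seg xy in auto)
  then have 1: "(\<lambda>n. sint (\<lambda>s. P n (s, y)) x y) \<longlonglongrightarrow> sint (\<lambda>s. lim (s, y)) x y"
    by (rule sint_tendsto) (rule slice_continuous[OF Pc])
  have "uniform_limit (closed_segment x y) (\<lambda>n s. P n (x, s)) (\<lambda>s. lim (x, s)) sequentially"
    by (rule uniform_limit_compose'[OF u, where h = "\<lambda>s. (x, s)"]) (use seg xy in auto)
  then have 2: "(\<lambda>n. sint (\<lambda>s. P n (x, s)) x y) \<longlonglongrightarrow> sint (\<lambda>s. lim (x, s)) x y"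
    by (rule sint_tendsto) (rule slice_continuous[OF Pc])
  have "(\<lambda>n. start z + step (P n) z) \<longlonglongrightarrow> start z + step lim z"
    unfolding step_def z fst_conv snd_conv by (intro tendsto_intros 1 2)
  moreover have "(\<lambda>n. P (Suc n) z) \<longlonglongrightarrow> lim z"
    using tendsto_uniform_limitI[OF u, of z] xy z LIMSEQ_Suc by auto
  ultimately have "lim z = start z + step lim z"
    unfolding PS using LIMSEQ_unique by blast
  then show ?thesis by (simp add: start_def step_def algebra_simps)
qed

text \<open>Above the diagonal each step integrates a nonnegative function in the positive
  direction.\<close>

lemma lim_nonneg:
  assumes "\<And>z. 0 \<le> A z" "\<And>z. 0 \<le> B z" "\<And>x. 0 \<le> g x" "x \<le> y"
  shows "0 \<le> lim (x, y)"
proof -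
  have it: "0 \<le> it n (x, y)" if "x \<le> y" for n x y
    using that
  proof (induction n arbitrary: x y)
    case 0
    then show ?case using assms by (simp add: it_def start_def)
  next
    case (Suc n)
    then show ?case using assms by (auto simp: it_Suc step_def intro!: add_nonneg_nonneg mult_nonneg_nonneg sint_nonneg)
  qed
  define N where "N = \<bar>x\<bar> + \<bar>y\<bar>"
  have "(x, y) \<in> {-N..N} \<times> {-N..N}" by (auto simp: N_def)
  then have "(\<lambda>n. \<Sum>i<n. it i (x, y)) \<longlonglongrightarrow> lim (x, y)"
    by (rule tendsto_uniform_limitI[OF uniform_limit_square])
  then show ?thesis
    by (rule tendsto_lowerbound) (auto intro!: always_eventually sum_nonneg it assms)
qed

end

text \<open>The integrability condition \<open>\<partial>\<^sub>x u = \<partial>\<^sub>y v\<close> yields a potential, although \<open>\<partial>\<^sub>y u\<close> and \<open>\<partial>\<^sub>x v\<close> need not exist.\<close>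

lemma potential_has_derivative:
  fixes u v f :: "real \<times> real \<Rightarrow> real" and c :: "real \<Rightarrow> real"
  assumes u: "continuous_on UNIV u" and f: "continuous_on UNIV f"
    and du: "\<And>x y. ((\<lambda>x. u (x, y)) has_real_derivative f (x, y)) (at x)"
    and dv: "\<And>x y. ((\<lambda>y. v (x, y)) has_real_derivative f (x, y)) (at y)"
    and dc: "\<And>x. (c has_real_derivative u (x, x) + v (x, x)) (at x)"
  shows "((\<lambda>z. c (fst z) + sint (\<lambda>s. u (fst z, s)) (fst z) (snd z)) has_derivative
    (\<lambda>(h, k). v z * h + u z * k)) (at z)"
proof -
  obtain x y where z: "z = (x, y)" by (cases z)
  have slice: "continuous_on UNIV (\<lambda>s. u (x, s))" "continuous_on UNIV (\<lambda>s. f (x, s))" for x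
    by (rule continuous_on_compose2[OF u] continuous_on_compose2[OF f]; auto intro!: continuous_intros)+
  have blin: "isCont (\<lambda>z. blinfun_mult_right (w z)) p" if "continuous_on UNIV w" for w :: "real \<times> real \<Rightarrow> real" and p
  proof -
    have "isCont w p" using that by (metis UNIV_I continuous_on_eq_continuous_at open_UNIV)
    then show ?thesis by (rule bounded_linear.continuous[OF bounded_linear_blinfun_mult_right])
  qed
  \<comment> \<open>\<open>x\<close> occurs in the integrand and as lower limit; the two occurrences
    are separated as independent variables and rejoined by the chain rule.\<close>
  have "((\<lambda>x. sint (\<lambda>s. u (x, s)) x y) has_real_derivative sint (\<lambda>s. f (x, s)) x y - u (x, x)) (at x)"
  proof -
    have 1: "((\<lambda>x'. sint (\<lambda>s. u (x', s)) x y) has_real_derivative sint (\<lambda>s. f (x, s)) x y) (at x within UNIV)"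
      unfolding sint_def cbox_interval[symmetric]
    proof (rule leibniz_rule_field_derivative[where f = "\<lambda>x' t. (y - x) * u (x', x + (y - x) * t)"
          and fx = "\<lambda>x' t. (y - x) * f (x', x + (y - x) * t)"])
      show "((\<lambda>x'. (y - x) * u (x', x + (y - x) * t)) has_real_derivative (y - x) * f (x', x + (y - x) * t)) (at x' within UNIV)" for x' t
        by (intro DERIV_cmult du)
      show "(\<lambda>t. (y - x) * u (x', x + (y - x) * t)) integrable_on cbox 0 1" for x'
        by (intro integrable_continuous continuous_intros continuous_on_compose2[OF slice(1)]) auto
      show "continuous_on (UNIV \<times> cbox 0 1) (\<lambda>(x', t). (y - x) * f (x', x + (y - x) * t))"
        unfolding case_prod_beta' by (intro continuous_intros continuous_on_compose2[OF f]) auto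
    qed auto
    have "continuous_on UNIV (\<lambda>z. - u z)" using u by (intro continuous_intros)
    from blin[OF this] have 2: "continuous (at (x, x) within UNIV \<times> UNIV) (\<lambda>(x', a). blinfun_mult_right (- u (x', a)))"
      by (simp add: case_prod_beta')
    have "((\<lambda>(x', a). sint (\<lambda>s. u (x', s)) a y) has_derivative
      (\<lambda>(tx, ty). sint (\<lambda>s. f (x, s)) x y * tx + blinfun_mult_right (- u (x, x)) ty)) (at (x, x) within UNIV \<times> UNIV)"
      by (rule has_derivative_partialsI[OF _ _ 2])
        (use 1 sint_has_derivative(2)[OF slice(1)] in \<open>auto simp: has_field_derivative_def\<close>)
    then have "((\<lambda>(x', a). sint (\<lambda>s. u (x', s)) a y) has_derivative
      (\<lambda>(tx, ty). sint (\<lambda>s. f (x, s)) x y * tx + - u (x, x) * ty)) (at (x, x))" by simp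
    moreover have "((\<lambda>x. (x, x)) has_derivative (\<lambda>h. (h, h))) (at x)"
      by (auto intro!: derivative_eq_intros)
    ultimately have "((\<lambda>x. case (x, x) of (x', a) \<Rightarrow> sint (\<lambda>s. u (x', s)) a y) has_derivative
        (\<lambda>h. case (h, h) of (tx, ty) \<Rightarrow> sint (\<lambda>s. f (x, s)) x y * tx + - u (x, x) * ty)) (at x)"
      by (rule has_derivative_compose[where f = "\<lambda>x. (x, x)", rotated])
    then have "((\<lambda>x. sint (\<lambda>s. u (x, s)) x y) has_derivative (\<lambda>h. sint (\<lambda>s. f (x, s)) x y * h + - u (x, x) * h)) (at x)"
      by simp
    then show ?thesis by (rule has_derivative_imp_has_field_derivative) (simp add: algebra_simps)
  qed
  \<comment> \<open>\<open>f\<close> integrates to \<open>v (x, y) - v (x, x)\<close>, and the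
    derivative of \<open>c\<close> cancels both diagonal values.\<close>
  from DERIV_add[OF dc this]
  have "((\<lambda>x. c x + sint (\<lambda>s. u (x, s)) x y) has_real_derivative v (x, y)) (at x)"
    by (simp add: sint_antiderivative[OF dv])
  then have fx: "((\<lambda>x. c x + sint (\<lambda>s. u (x, s)) x y) has_derivative (\<lambda>h. v (x, y) * h)) (at x within UNIV)"
    by (simp add: has_field_derivative_def)
  have "((\<lambda>y. c x + sint (\<lambda>s. u (x, s)) x y) has_real_derivative u (x, y)) (at y)" for x y
    using DERIV_add[OF DERIV_const sint_has_derivative(1)[OF slice(1)]] by simp
  then have fy: "((\<lambda>y. c x + sint (\<lambda>s. u (x, s)) x y) has_derivative blinfun_apply (blinfun_mult_right (u (x, y)))) (at y within UNIV)" for x y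
    by (simp add: has_field_derivative_def)
  have "continuous (at (x, y) within UNIV \<times> UNIV) (\<lambda>(x, y). blinfun_mult_right (u (x, y)))"
    using blin[OF u] by (simp add: case_prod_beta')
  from has_derivative_partialsI[OF fx fy this] show ?thesis
    by (simp add: z case_prod_beta')
qed

section \<open>Global solutions in characteristic coordinates\<close>

lemma partials_of_total:
  fixes f :: "real \<times> real \<Rightarrow> real"
  assumes "\<And>z. (f has_derivative (\<lambda>(h, k). v z * h + u z * k)) (at z)"
  shows "((\<lambda>x. f (x, y)) has_real_derivative v (x, y)) (at x)"
    and "((\<lambda>y. f (x, y)) has_real_derivative u (x, y)) (at y)"
proof -
  have "((\<lambda>x. (x, y)) has_derivative (\<lambda>h. (h, 0))) (at x)" "((\<lambda>y. (x, y)) has_derivative (\<lambda>h. (0, h))) (at y)"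
    by (auto intro!: derivative_eq_intros)
  from this[THEN has_derivative_compose, OF assms]
  show "((\<lambda>x. f (x, y)) has_real_derivative v (x, y)) (at x)" "((\<lambda>y. f (x, y)) has_real_derivative u (x, y)) (at y)"
    by (auto intro!: has_derivative_imp_has_field_derivative simp: mult.commute)
qed

lemma increase_ge_of_deriv_ge:
  fixes f :: "real \<Rightarrow> real"
  assumes "a \<le> b" "\<And>x. (f has_real_derivative f' x) (at x)" "\<And>x. a \<le> x \<Longrightarrow> x \<le> b \<Longrightarrow> \<delta> \<le> f' x"
  shows "\<delta> * (b - a) \<le> f b - f a"
proof -
  have "(\<lambda>x. f x - \<delta> * x) a \<le> (\<lambda>x. f x - \<delta> * x) b"
  proof (rule DERIV_nonneg_imp_nondecreasing[OF assms(1)])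
    fix x assume "a \<le> x" "x \<le> b"
    moreover have "((\<lambda>x. f x - \<delta> * x) has_real_derivative f' x - \<delta>) (at x)"
      by (auto intro!: derivative_eq_intros assms(2))
    ultimately show "\<exists>y. ((\<lambda>x. f x - \<delta> * x) has_real_derivative y) (at x) \<and> 0 \<le> y"
      using assms(3) by force
  qed
  then show ?thesis by (simp add: algebra_simps)
qed

locale rarefaction_data =
  fixes \<theta> \<kappa> \<Lambda> :: real and W1 W2 W1' W2' :: "real \<Rightarrow> real"
  assumes theta: "0 < \<theta>" "\<theta> < 1" and kappa: "0 < \<kappa>"
    and W1_deriv: "\<And>x. (W1 has_real_derivative W1' x) (at x)" and W1'_cont: "continuous_on UNIV W1'"
    and W2_deriv: "\<And>x. (W2 has_real_derivative W2' x) (at x)" and W2'_cont: "continuous_on UNIV W2'"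
    and W1'_nonpos: "\<And>x. W1' x \<le> 0" and W2'_nonpos: "\<And>x. W2' x \<le> 0"
    and speed1: "\<And>x y. \<kappa> \<le> lam \<theta> (W1 x) (W2 y)" and speed2: "\<And>x y. lam \<theta> (W2 y) (W1 x) \<le> - \<kappa>"
    and bound: "\<And>x. \<bar>W1 x\<bar> \<le> \<Lambda>" "\<And>x. \<bar>W2 x\<bar> \<le> \<Lambda>"
begin

text \<open>The speeds \<open>1 / \<lambda>\<^sub>j\<close>; \<open>m1a\<close> and \<open>m2b\<close> are \<open>\<partial>m1/\<partial>\<alpha>\<close> and \<open>\<partial>m2/\<partial>\<beta>\<close>.\<close>

definition m1 where "m1 z = 1 / lam \<theta> (W1 (fst z)) (W2 (snd z))"
definition m2 where "m2 z = 1 / lam \<theta> (W2 (snd z)) (W1 (fst z))"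
definition m1a where "m1a z = - ((1 + \<theta>) / 2 * W1' (fst z)) * (m1 z)\<^sup>2"
definition m2b where "m2b z = - ((1 + \<theta>) / 2 * W2' (snd z)) * (m2 z)\<^sup>2"
text \<open>Compatibility of x_\<beta> = \<open>m1\<close> t_\<beta> and x_\<alpha> =
  \<open>m2\<close> t_\<alpha> gives (\<open>m1 - m2\<close>) t_{\<alpha>\<beta>} =
  \<open>m2b\<close> t_\<alpha> - \<open>m1a\<close> t_\<beta>. With \<open>p\<close> for t_\<beta>
  and \<open>q\<close> for -t_\<alpha> this says that -t_{\<alpha>\<beta>} is
  \<open>A * p + B * q\<close>.\<close>

definition A where "A z = m1a z / (m1 z - m2 z)"
definition B where "B z = m2b z / (m1 z - m2 z)"
text \<open>On the diagonal t is 0 and x is the foot itself. Differentiating along it gives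
  \<open>p = q\<close> and \<open>m1 * p - m2 * q = 1\<close>.\<close>

definition g where "g x = 1 / (m1 (x, x) - m2 (x, x))"

lemma Lambda: "\<kappa> \<le> \<Lambda>" "0 < \<Lambda>"
proof -
  have "\<bar>lam \<theta> (W1 0) (W2 0) - lam \<theta> 0 0\<bar> \<le> \<Lambda>"
    by (rule lam_lipschitz[OF theta]) (use bound in auto)
  then show "\<kappa> \<le> \<Lambda>" using speed1[of 0 0] by (simp add: lam_def)
  then show "0 < \<Lambda>" using kappa by simp
qed

lemma m1_bounds: "1 / \<Lambda> \<le> m1 z" "m1 z \<le> 1 / \<kappa>"
proof -
  have "\<bar>lam \<theta> (W1 (fst z)) (W2 (snd z)) - lam \<theta> 0 0\<bar> \<le> \<Lambda>"
    by (rule lam_lipschitz[OF theta]) (use bound in auto)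
  then have "lam \<theta> (W1 (fst z)) (W2 (snd z)) \<le> \<Lambda>" by (simp add: lam_def)
  then show "1 / \<Lambda> \<le> m1 z" "m1 z \<le> 1 / \<kappa>"
    using speed1[of "fst z" "snd z"] kappa unfolding m1_def by (auto intro!: frac_le)
qed

lemma m2_bounds: "1 / \<Lambda> \<le> - m2 z" "- m2 z \<le> 1 / \<kappa>"
proof -
  have "\<bar>lam \<theta> (W2 (snd z)) (W1 (fst z)) - lam \<theta> 0 0\<bar> \<le> \<Lambda>"
    by (rule lam_lipschitz[OF theta]) (use bound in auto)
  moreover have "lam \<theta> 0 0 = 0" by (simp add: lam_def)
  ultimately have "- lam \<theta> (W2 (snd z)) (W1 (fst z)) \<le> \<Lambda>" by linarith
  then have "1 / \<Lambda> \<le> 1 / (- lam \<theta> (W2 (snd z)) (W1 (fst z)))" "1 / (- lam \<theta> (W2 (snd z)) (W1 (fst z))) \<le> 1 / \<kappa>"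
    using speed2[of "snd z" "fst z"] kappa by (auto intro!: frac_le simp del: divide_minus_right)
  then show "1 / \<Lambda> \<le> - m2 z" "- m2 z \<le> 1 / \<kappa>" unfolding m2_def by simp_all
qed

lemma gap: "0 < m1 z - m2 z" "m1 z - m2 z \<le> 2 / \<kappa>" "0 < m1 z" "m2 z < 0"
proof -
  have "0 < 1 / \<Lambda>" "1 / \<kappa> + 1 / \<kappa> = 2 / \<kappa>" using Lambda by auto
  then show "0 < m1 z - m2 z" "m1 z - m2 z \<le> 2 / \<kappa>" "0 < m1 z" "m2 z < 0"
    using m1_bounds[of z] m2_bounds[of z] by linarith+
qed

lemma W_cont: "continuous_on UNIV W1" "continuous_on UNIV W2"
  using DERIV_isCont[OF W1_deriv] DERIV_isCont[OF W2_deriv] by (auto intro: continuous_at_imp_continuous_on)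

lemma cont_compose:
  fixes f :: "real \<Rightarrow> real"
  assumes "continuous_on UNIV f"
  shows "continuous_on UNIV (\<lambda>z :: real \<times> real. f (fst z))" "continuous_on UNIV (\<lambda>z :: real \<times> real. f (snd z))"
  by (rule continuous_on_compose2[OF assms]; auto intro!: continuous_intros)+

lemma lam_nonzero: "lam \<theta> (W1 x) (W2 y) \<noteq> 0" "lam \<theta> (W2 y) (W1 x) \<noteq> 0"
  using speed1[of x y] speed2[of y x] kappa by auto

lemma m_cont: "continuous_on UNIV m1" "continuous_on UNIV m2"
proof -
  have "continuous_on UNIV (\<lambda>z. lam \<theta> (W1 (fst z)) (W2 (snd z)))" "continuous_on UNIV (\<lambda>z. lam \<theta> (W2 (snd z)) (W1 (fst z)))"
    unfolding lam_def by (intro continuous_intros cont_compose W_cont; simp)+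
  then show "continuous_on UNIV m1" "continuous_on UNIV m2"
    unfolding m1_def m2_def by (intro continuous_on_divide continuous_on_const; simp add: lam_nonzero)+
qed

lemma ab_cont: "continuous_on UNIV A" "continuous_on UNIV B" "continuous_on UNIV g"
proof -
  have nz: "m1 z - m2 z \<noteq> 0" for z using gap(1)[of z] by simp
  show "continuous_on UNIV A" "continuous_on UNIV B"
    unfolding A_def B_def m1a_def m2b_def
    by (intro continuous_on_divide continuous_on_mult continuous_on_minus continuous_on_power continuous_on_const
        continuous_on_diff cont_compose m_cont W1'_cont W2'_cont; use nz in simp)+
  have "continuous_on UNIV (\<lambda>x. m1 (x, x))" "continuous_on UNIV (\<lambda>x. m2 (x, x))"
    by (rule continuous_on_compose2[OF m_cont(1)] continuous_on_compose2[OF m_cont(2)]; auto intro!: continuous_intros)+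
  then show "continuous_on UNIV g"
    unfolding g_def by (intro continuous_on_divide continuous_on_diff continuous_on_const; use nz in simp)
qed

sublocale volterra A B g
  by unfold_locales (rule ab_cont)+

text \<open>The monotonicity of the data enters the construction here.\<close>

lemma sign: "0 \<le> A z" "0 \<le> B z" "\<kappa> / 2 \<le> g x" "0 \<le> g x"
proof -
  show "0 \<le> A z" "0 \<le> B z"
  proof -
    have "(1 + \<theta>) / 2 * W1' (fst z) \<le> 0" "(1 + \<theta>) / 2 * W2' (snd z) \<le> 0"
      using W1'_nonpos W2'_nonpos theta by (intro mult_nonneg_nonpos; simp)+
    then have "0 \<le> m1a z" "0 \<le> m2b z"
      unfolding m1a_def m2b_def by (intro mult_nonneg_nonneg; simp)+
    then show "0 \<le> A z" "0 \<le> B z"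
      using gap(1)[of z] by (simp_all add: A_def B_def)
  qed
  have "1 / (2 / \<kappa>) \<le> g x" unfolding g_def using gap(1,2)[of "(x, x)"] by (intro frac_le) auto
  then show "\<kappa> / 2 \<le> g x" by simp
  then show "0 \<le> g x" using kappa by linarith
qed

text \<open>\<open>p\<close> and \<open>q\<close> will be \<open>\<partial>t/\<partial>\<beta>\<close> and \<open>-\<partial>t/\<partial>\<alpha>\<close>.\<close>

definition p where "p z = g (snd z) + sint (\<lambda>s. lim (s, snd z)) (fst z) (snd z)"
definition q where "q z = g (fst z) + sint (\<lambda>s. lim (fst z, s)) (fst z) (snd z)"

lemma lim_pq: "lim z = A z * p z + B z * q z"
  using lim_eq[of z] by (simp add: p_def q_def)

lemma pq_diag: "p (x, x) = g x" "q (x, x) = g x"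
  by (simp_all add: p_def q_def)

lemma pq_cont: "continuous_on UNIV p" "continuous_on UNIV q"
  unfolding p_def q_def
  by (intro continuous_on_add cont_compose ab_cont sint_continuous continuous_intros;
      auto simp: case_prod_beta' intro!: continuous_intros continuous_on_compose2[OF lim_continuous])+

lemma p_deriv: "((\<lambda>x. p (x, y)) has_real_derivative - lim (x, y)) (at x)"
  unfolding p_def using DERIV_add[OF DERIV_const sint_has_derivative(2)[OF slice_continuous(1)[OF lim_continuous]]] by simp

lemma q_deriv: "((\<lambda>y. q (x, y)) has_real_derivative lim (x, y)) (at y)"
  unfolding q_def using DERIV_add[OF DERIV_const sint_has_derivative(1)[OF slice_continuous(2)[OF lim_continuous]]] by simp

lemma m1_deriv: "((\<lambda>x. m1 (x, y)) has_real_derivative m1a (x, y)) (at x)"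
  unfolding m1_def m1a_def lam_def using lam_nonzero(1)[of x y]
  by (auto intro!: derivative_eq_intros W1_deriv simp: lam_def power2_eq_square divide_simps)

lemma m2_deriv: "((\<lambda>y. m2 (x, y)) has_real_derivative m2b (x, y)) (at y)"
  unfolding m2_def m2b_def lam_def using lam_nonzero(2)[of y x]
  by (auto intro!: derivative_eq_intros W2_deriv simp: lam_def power2_eq_square divide_simps)

lemma pq_lower:
  assumes "x \<le> y"
  shows "\<kappa> / 2 \<le> p (x, y)" "\<kappa> / 2 \<le> q (x, y)"
proof -
  have n: "0 \<le> lim (a, b)" if "a \<le> b" for a b
    using sign that by (intro lim_nonneg) auto
  have "0 \<le> sint (\<lambda>s. lim (s, y)) x y" "0 \<le> sint (\<lambda>s. lim (x, s)) x y"
    using assms n by (auto intro!: sint_nonneg)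
  then show "\<kappa> / 2 \<le> p (x, y)" "\<kappa> / 2 \<le> q (x, y)"
    using sign(3)[of x] sign(3)[of y] by (simp_all add: p_def q_def)
qed

text \<open>\<open>tau\<close> and \<open>xi\<close> are the potentials of the fields
  \<open>(- q, p)\<close> and \<open>(- m2 * q, m1 * p)\<close>, integrated from the diagonal, where
  they equal 0 and the foot.\<close>

definition tau where "tau z = sint (\<lambda>s. p (fst z, s)) (fst z) (snd z)"
definition xi where "xi z = fst z + sint (\<lambda>s. m1 (fst z, s) * p (fst z, s)) (fst z) (snd z)"

lemma tau_deriv: "(tau has_derivative (\<lambda>(h, k). - q z * h + p z * k)) (at z)"
proof -
  have "((\<lambda>z. 0 + sint (\<lambda>s. p (fst z, s)) (fst z) (snd z)) has_derivative (\<lambda>(h, k). (\<lambda>z. - q z) z * h + p z * k)) (at z)"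
  proof (rule potential_has_derivative[where f = "\<lambda>z. - lim z" and c = "\<lambda>_. 0"])
    show "((\<lambda>y. - q (x, y)) has_real_derivative - lim (x, y)) (at y)" for x y
      by (intro DERIV_minus q_deriv)
  qed (auto intro!: pq_cont p_deriv continuous_intros lim_continuous simp: pq_diag)
  then show ?thesis unfolding tau_def by simp
qed

lemma xi_deriv: "(xi has_derivative (\<lambda>(h, k). - (m2 z * q z) * h + m1 z * p z * k)) (at z)"
proof -
  \<comment> \<open>The mixed derivative of \<open>xi\<close>: by \<open>lim_pq\<close> and the
    definitions of \<open>A\<close> and \<open>B\<close>, both \<open>m1a * p - m1 * lim\<close> and
    \<open>- m2b * q - m2 * lim\<close> reduce to it.\<close>
  define f where "f z = - m2 z * A z * p z - m1 z * B z * q z" for z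
  have nz: "m1 z - m2 z \<noteq> 0" for z using gap(1)[of z] by simp
  have "m1a z = A z * (m1 z - m2 z)" "m2b z = B z * (m1 z - m2 z)" for z
    using nz[of z] by (simp_all add: A_def B_def)
  note ab = this
  have "((\<lambda>z. fst z + sint (\<lambda>s. (\<lambda>z. m1 z * p z) (fst z, s)) (fst z) (snd z)) has_derivative
      (\<lambda>(h, k). (\<lambda>z. - (m2 z * q z)) z * h + (\<lambda>z. m1 z * p z) z * k)) (at z)"
  proof (rule potential_has_derivative[where f = f and c = "\<lambda>x. x"])
    show "continuous_on UNIV (\<lambda>z. m1 z * p z)" "continuous_on UNIV f"
      unfolding f_def by (intro continuous_intros m_cont pq_cont ab_cont)+
    show "((\<lambda>x. m1 (x, y) * p (x, y)) has_real_derivative f (x, y)) (at x)" for x y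
      by (rule DERIV_cong[OF DERIV_mult[OF m1_deriv p_deriv]])
        (simp add: f_def ab lim_pq algebra_simps)
    show "((\<lambda>y. - (m2 (x, y) * q (x, y))) has_real_derivative f (x, y)) (at y)" for x y
      by (rule DERIV_cong[OF DERIV_minus[OF DERIV_mult[OF m2_deriv q_deriv]]])
        (simp add: f_def ab lim_pq algebra_simps)
    have "(m1 (x, x) - m2 (x, x)) * g x = 1" for x
      using nz[of "(x, x)"] by (simp add: g_def)
    then have "m1 (x, x) * p (x, x) + - (m2 (x, x) * q (x, x)) = 1" for x
      by (simp add: pq_diag left_diff_distrib)
    then show "((\<lambda>x. x) has_real_derivative m1 (x, x) * p (x, x) + - (m2 (x, x) * q (x, x))) (at x)" for x
      by simp
  qed
  then show ?thesis unfolding xi_def by simp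
qed

text \<open>A common lower bound on the wedge for the absolute values of all four partial
  derivatives of \<open>tau\<close> and \<open>xi\<close>.\<close>

definition rate where "rate = min (\<kappa> / 2) (1 / \<Lambda> * (\<kappa> / 2))"

lemma rate_pos: "0 < rate"
  using kappa Lambda by (simp add: rate_def)

lemma rates:
  assumes "x \<le> y"
  shows "rate \<le> p (x, y)" "rate \<le> q (x, y)" "rate \<le> m1 (x, y) * p (x, y)" "rate \<le> - (m2 (x, y) * q (x, y))"
proof -
  show "rate \<le> p (x, y)" "rate \<le> q (x, y)" using pq_lower[OF assms] by (auto simp: rate_def)
  have "1 / \<Lambda> * (\<kappa> / 2) \<le> m1 (x, y) * p (x, y)" "1 / \<Lambda> * (\<kappa> / 2) \<le> (- m2 (x, y)) * q (x, y)"
    using m1_bounds[of "(x, y)"] m2_bounds[of "(x, y)"] pq_lower[OF assms] kappa Lambda gap[of "(x, y)"]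
    by (intro mult_mono; simp)+
  then show "rate \<le> m1 (x, y) * p (x, y)" "rate \<le> - (m2 (x, y) * q (x, y))" by (auto simp: rate_def)
qed

section \<open>Bijectivity of the coordinate map from the wedge to the half plane\<close>

lemmas tau_partials = partials_of_total[OF tau_deriv]
lemmas xi_partials = partials_of_total[OF xi_deriv]

text \<open>\<open>tau\<close> falls in the first and rises in the second variable, so it is
  monotone for inclusion of the intervals \<open>{a'..b'}\<close> and \<open>{a..b}\<close>. The
  path through \<open>(a, b')\<close> stays in the wedge, where the derivative bounds hold.\<close>

lemma tau_growth:
  assumes "a \<le> a'" "a' \<le> b'" "b' \<le> b"
  shows "rate * ((a' - a) + (b - b')) \<le> tau (a, b) - tau (a', b')"
proof -
  have "rate * (b - b') \<le> tau (a, b) - tau (a, b')"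
    by (rule increase_ge_of_deriv_ge[OF assms(3) tau_partials(2)]) (use assms rates in auto)
  moreover have "rate * (a' - a) \<le> (\<lambda>x. - tau (x, b')) a' - (\<lambda>x. - tau (x, b')) a"
    by (rule increase_ge_of_deriv_ge[OF assms(1) DERIV_minus[OF tau_partials(1)]]) (use assms rates in auto)
  ultimately show ?thesis by (simp add: algebra_simps)
qed

lemma xi_growth:
  assumes "a \<le> a'" "b \<le> b'" "a \<le> b" "a' \<le> b'"
  shows "rate * ((a' - a) + (b' - b)) \<le> xi (a', b') - xi (a, b)"
proof -
  have "rate * (b' - b) \<le> xi (a, b') - xi (a, b)"
    by (rule increase_ge_of_deriv_ge[OF assms(2) xi_partials(2)]) (use assms rates in auto)
  moreover have "rate * (a' - a) \<le> xi (a', b') - xi (a, b')"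
    by (rule increase_ge_of_deriv_ge[OF assms(1) xi_partials(1)]) (use assms rates in auto)
  ultimately show ?thesis by (simp add: algebra_simps)
qed

text \<open>Regarded as intervals, two points of the wedge are either nested, and \<open>tau\<close>
  separates them, or shifted in a common direction, and \<open>xi\<close> does.\<close>

lemma inverse_lipschitz:
  assumes "a \<le> b" "a' \<le> b'"
  shows "rate * (\<bar>a - a'\<bar> + \<bar>b - b'\<bar>) \<le> \<bar>tau (a, b) - tau (a', b')\<bar> + \<bar>xi (a, b) - xi (a', b')\<bar>"
proof -
  consider "a \<le> a'" "b \<le> b'" | "a \<le> a'" "b' \<le> b" | "a' \<le> a" "b \<le> b'" | "a' \<le> a" "b' \<le> b" by linarith
  then show ?thesis
  proof cases
    case 1 then show ?thesis using xi_growth[of a a' b b'] assms by auto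
  next
    case 2 then show ?thesis using tau_growth[of a a' b' b] assms by auto
  next
    case 3 then show ?thesis using tau_growth[of a' a b b'] assms by auto
  next
    case 4 then show ?thesis using xi_growth[of a' a b' b] assms by auto
  qed
qed

lemma tau_diag [simp]: "tau (x, x) = 0"
  by (simp add: tau_def)

lemma xi_diag [simp]: "xi (x, x) = x"
  by (simp add: xi_def)

lemma tau_xi_cont: "continuous_on UNIV tau" "continuous_on UNIV xi"
  using tau_deriv xi_deriv by (auto intro!: continuous_at_imp_continuous_on has_derivative_continuous)

lemma tau_nonneg: "a \<le> b \<Longrightarrow> 0 \<le> tau (a, b)"
  using tau_growth[of a a a b] rate_pos by (simp add: order_trans[rotated])

text \<open>Growth of \<open>tau\<close> from 0 on the diagonal bounds the distance of the level
  from it by \<open>t / rate\<close>. Continuity of \<open>b\<close> follows from strict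
  monotonicity in the second variable: the sign of \<open>tau (a, y) - t\<close> at
  \<open>a0\<close> persists nearby.\<close>

lemma level_curve:
  assumes "0 \<le> t"
  obtains b where "\<And>a. a \<le> b a" "\<And>a. tau (a, b a) = t" "continuous_on UNIV b" "\<And>a. b a \<le> a + t / rate"
proof -
  have "\<exists>b. a \<le> b \<and> b \<le> a + t / rate \<and> tau (a, b) = t" for a
  proof (rule IVT')
    show "tau (a, a) \<le> t" using assms by simp
    show "t \<le> tau (a, a + t / rate)" using tau_growth[of a a a "a + t / rate"] rate_pos assms by simp
    show "continuous_on {a..a + t / rate} (\<lambda>b. tau (a, b))"
      by (rule continuous_on_compose2[OF tau_xi_cont(1)]) (auto intro!: continuous_intros)
  qed (use assms rate_pos in auto)
  then obtain b where b: "\<And>a. a \<le> b a" "\<And>a. b a \<le> a + t / rate" "\<And>a. tau (a, b a) = t" by metis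
  have mono: "tau (a, c) < tau (a, d)" if "a \<le> c" "c < d" for a c d
  proof -
    have "rate * (d - c) \<le> tau (a, d) - tau (a, c)" using tau_growth[of a a c d] that by simp
    moreover have "0 < rate * (d - c)" using rate_pos that by simp
    ultimately show ?thesis by linarith
  qed
  have tc: "((\<lambda>a. tau (a, c)) \<longlongrightarrow> tau (a0, c)) (at a0)" for a0 c
  proof -
    have "continuous_on UNIV (\<lambda>a. tau (a, c))"
      by (rule continuous_on_compose2[OF tau_xi_cont(1)]) (auto intro!: continuous_intros)
    then show ?thesis by (simp add: continuous_on_def)
  qed
  have "(b \<longlongrightarrow> b a0) (at a0)" for a0
  proof (rule order_tendstoI)
    fix y assume y: "b a0 < y"
    have "tau (a0, y) > t" using mono[OF b(1) y] b(3) by simp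
    then have "\<forall>\<^sub>F a in at a0. t < tau (a, y)" using order_tendstoD(1)[OF tc] by blast
    moreover have "\<forall>\<^sub>F a in at a0. a < y"
      using order_tendstoD(2)[OF tendsto_ident_at, of a0 y] b(1)[of a0] y by simp
    ultimately show "\<forall>\<^sub>F a in at a0. b a < y"
    proof eventually_elim
      case (elim a)
      show ?case
      proof (rule ccontr)
        assume "\<not> b a < y"
        then have "tau (a, y) \<le> tau (a, b a)" using mono[of a y "b a"] elim by (cases "b a = y") auto
        then show False using elim b(3) by simp
      qed
    qed
  next
    fix y assume y: "y < b a0"
    show "\<forall>\<^sub>F a in at a0. y < b a"
    \<comment> \<open>Monotonicity is known only from the diagonal upwards; for \<open>y\<close>
      below it, \<open>b a \<ge> a > y\<close> near \<open>a0\<close> suffices.\<close>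
    proof (cases "y < a0")
      case True
      then have "\<forall>\<^sub>F a in at a0. y < a" using order_tendstoD(1)[OF tendsto_ident_at] by blast
      then show ?thesis by eventually_elim (use b(1) less_le_trans in blast)
    next
      case False
      then have "tau (a0, y) < t" using mono[of a0 y "b a0"] y b(3) by simp
      then have "\<forall>\<^sub>F a in at a0. tau (a, y) < t" using order_tendstoD(2)[OF tc] by blast
      then show ?thesis
      proof eventually_elim
        case (elim a)
        show ?case
        proof (rule ccontr)
          assume "\<not> y < b a"
          then have "tau (a, b a) \<le> tau (a, y)" using mono[of a "b a" y] b(1)[of a] by (cases "b a = y") auto
          then show False using elim b(3) by simp
        qed
      qed
    qed
  qed
  then have "continuous_on UNIV b" by (simp add: continuous_on_def)
  with b show ?thesis using that by blast
qed

text \<open>Comparison with the diagonal points \<open>(a, a)\<close> and \<open>(b a, b a)\<close>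
  gives \<open>a \<le> xi (a, b a) \<le> b a \<le> a + t / rate\<close>, so \<open>x\<close> is
  attained for some \<open>a\<close> between \<open>x - t / rate\<close> and
  \<open>x\<close>.\<close>

lemma surjective:
  assumes "0 \<le> t"
  obtains a b where "a \<le> b" "tau (a, b) = t" "xi (a, b) = x"
proof -
  obtain b where b: "\<And>a. a \<le> b a" "\<And>a. tau (a, b a) = t" "continuous_on UNIV b" "\<And>a. b a \<le> a + t / rate"
    using level_curve[OF assms] by blast
  have gr: "0 \<le> rate * (b a - a)" for a using rate_pos b(1)[of a] by simp
  have lo: "a \<le> xi (a, b a)" for a
  proof -
    have "rate * (b a - a) \<le> xi (a, b a) - a" using xi_growth[of a a a "b a"] b(1)[of a] by simp
    then show ?thesis using gr[of a] by linarith
  qed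
  have hi: "xi (a, b a) \<le> b a" for a
  proof -
    have "rate * (b a - a) \<le> b a - xi (a, b a)" using xi_growth[of a "b a" "b a" "b a"] b(1)[of a] by simp
    then show ?thesis using gr[of a] by linarith
  qed
  have "\<exists>a\<ge>x - t / rate. a \<le> x \<and> xi (a, b a) = x"
  proof (rule IVT')
    show "xi (x - t / rate, b (x - t / rate)) \<le> x" using hi[of "x - t / rate"] b(4)[of "x - t / rate"] by simp
    show "continuous_on {x - t / rate..x} (\<lambda>a. xi (a, b a))"
      by (rule continuous_on_compose2[OF tau_xi_cont(2)])
        (auto intro!: continuous_intros continuous_on_subset[OF b(3)])
  qed (use lo assms rate_pos in auto)
  then show ?thesis using that b by blast
qed

section \<open>The inverse coordinate map and the solution it defines\<close>

definition Phi where "Phi z = (tau z, xi z)"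

definition wedge :: "(real \<times> real) set" where "wedge = {z. fst z \<le> snd z}"

definition Psi where "Psi = inv_into wedge Phi"

lemma Phi_inj: "inj_on Phi wedge"
proof (rule inj_onI)
  fix z z' assume zz: "z \<in> wedge" "z' \<in> wedge" "Phi z = Phi z'"
  obtain a b a' b' where z: "z = (a, b)" "z' = (a', b')" by (cases z, cases z') blast
  have "rate * (\<bar>a - a'\<bar> + \<bar>b - b'\<bar>) \<le> 0"
    using inverse_lipschitz[of a b a' b'] zz z by (simp add: Phi_def wedge_def)
  then have "\<bar>a - a'\<bar> + \<bar>b - b'\<bar> \<le> 0" using rate_pos by (simp add: mult_le_0_iff)
  then have "a = a'" "b = b'" by linarith+
  then show "z = z'" using z by simp
qed

lemma Phi_image: "Phi ` wedge = {0..} \<times> UNIV"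
proof (intro set_eqI iffI)
  fix w assume "w \<in> Phi ` wedge"
  then show "w \<in> {0..} \<times> UNIV" using tau_nonneg by (auto simp: Phi_def wedge_def)
next
  fix w :: "real \<times> real" assume "w \<in> {0..} \<times> UNIV"
  then have "0 \<le> fst w" by auto
  then obtain a b where "a \<le> b" "tau (a, b) = fst w" "xi (a, b) = snd w"
    by (rule surjective[of "fst w" "snd w"])
  then have "(a, b) \<in> wedge" "Phi (a, b) = w" by (auto simp: Phi_def wedge_def)
  then show "w \<in> Phi ` wedge" by blast
qed

lemma Psi:
  assumes "w \<in> {0..} \<times> UNIV"
  shows "Psi w \<in> wedge" "Phi (Psi w) = w"
  using assms unfolding Psi_def Phi_image[symmetric] by (auto intro: inv_into_into f_inv_into_f)

lemma Psi_Phi: "z \<in> wedge \<Longrightarrow> Psi (Phi z) = z"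
  unfolding Psi_def by (rule inv_into_f_f[OF Phi_inj])

lemma Psi_cont: "continuous_on ({0..} \<times> UNIV) Psi"
proof (rule continuous_onI)
  show "\<exists>d>0. \<forall>w'\<in>{0..} \<times> UNIV. dist w' w < d \<longrightarrow> dist (Psi w') (Psi w) \<le> e" if "w \<in> {0..} \<times> UNIV" "0 < e"
    for w :: "real \<times> real" and e :: real
  proof (intro exI[of _ "rate * e / 2"] conjI ballI impI)
    show "0 < rate * e / 2" using rate_pos that by simp
    fix w' :: "real \<times> real" assume w': "w' \<in> {0..} \<times> UNIV" "dist w' w < rate * e / 2"
    obtain a b where ab: "Psi w = (a, b)" by (cases "Psi w")
    obtain a' b' where ab': "Psi w' = (a', b')" by (cases "Psi w'")
    have "rate * (\<bar>a' - a\<bar> + \<bar>b' - b\<bar>) \<le> \<bar>tau (a', b') - tau (a, b)\<bar> + \<bar>xi (a', b') - xi (a, b)\<bar>"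
      by (rule inverse_lipschitz) (use Psi(1)[OF that(1)] Psi(1)[OF w'(1)] ab ab' in \<open>auto simp: wedge_def\<close>)
    also have "\<dots> = \<bar>fst w' - fst w\<bar> + \<bar>snd w' - snd w\<bar>"
      using Psi(2)[OF that(1)] Psi(2)[OF w'(1)] ab ab' by (auto simp: Phi_def)
    also have "\<dots> \<le> dist w' w + dist w' w"
      using dist_fst_le[of w' w] dist_snd_le[of w' w] by (intro add_mono) (simp_all add: dist_real_def)
    also have "\<dots> \<le> rate * e" using w'(2) by simp
    finally have "\<bar>a' - a\<bar> + \<bar>b' - b\<bar> \<le> e" using rate_pos by simp
    moreover have "dist (Psi w') (Psi w) \<le> \<bar>a' - a\<bar> + \<bar>b' - b\<bar>"
      unfolding ab ab' dist_Pair_Pair dist_real_def by (rule sqrt_sum_squares_le_sum) auto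
    ultimately show "dist (Psi w') (Psi w) \<le> e" by linarith
  qed
qed

text \<open>In dx - \<open>m1\<close> dt only d\<alpha> survives and in dx - \<open>m2\<close> dt
  only d\<beta>. Differentiating the inverse relative to the wedge covers the line t = 0 as well,
  which is the image of the boundary diagonal.\<close>

lemma Psi_deriv:
  assumes w: "w \<in> {0..} \<times> UNIV"
  defines "z \<equiv> Psi w"
  shows "(Psi has_derivative (\<lambda>(h, k). ((k - m1 z * h) / ((m1 z - m2 z) * q z), (k - m2 z * h) / ((m1 z - m2 z) * p z))))
    (at w within {0..} \<times> UNIV)"
proof -
  let ?G = "\<lambda>(h, k). ((k - m1 z * h) / ((m1 z - m2 z) * q z), (k - m2 z * h) / ((m1 z - m2 z) * p z))"
  have z: "z \<in> wedge" "Phi z = w" using Psi[OF w] by (auto simp: z_def)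
  have nz: "m1 z - m2 z \<noteq> 0" "p z \<noteq> 0" "q z \<noteq> 0"
    using gap(1)[of z] pq_lower[of "fst z" "snd z"] z kappa by (auto simp: wedge_def)
  have "(Phi has_derivative (\<lambda>h. (case h of (h, k) \<Rightarrow> - q z * h + p z * k, case h of (h, k) \<Rightarrow> - (m2 z * q z) * h + m1 z * p z * k)))
      (at z within wedge)"
    unfolding Phi_def by (intro has_derivative_Pair has_derivative_at_withinI[OF tau_deriv] has_derivative_at_withinI[OF xi_deriv])
  then have "(Psi has_derivative ?G) (at (Phi z) within Phi ` wedge)"
  proof (rule has_derivative_inverse_within)
    show "continuous (at (Phi z) within Phi ` wedge) Psi"
      using Psi_cont w unfolding Phi_image z(2) by (metis continuous_on_eq_continuous_within)
    show "linear ?G"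
      by (rule linearI) (auto simp: case_prod_beta' algebra_simps add_divide_distrib diff_divide_distrib)
    show "?G \<circ> (\<lambda>h. (case h of (h, k) \<Rightarrow> - q z * h + p z * k, case h of (h, k) \<Rightarrow> - (m2 z * q z) * h + m1 z * p z * k)) = id"
    proof (rule ext)
      fix hk :: "real \<times> real"
      obtain h k where hk: "hk = (h, k)" by (cases hk)
      have "- (m2 z * q z) * h + m1 z * p z * k - m1 z * (- q z * h + p z * k) = h * ((m1 z - m2 z) * q z)"
        "- (m2 z * q z) * h + m1 z * p z * k - m2 z * (- q z * h + p z * k) = k * ((m1 z - m2 z) * p z)"
        by algebra+
      then show "(?G \<circ> (\<lambda>h. (case h of (h, k) \<Rightarrow> - q z * h + p z * k, case h of (h, k) \<Rightarrow> - (m2 z * q z) * h + m1 z * p z * k))) hk = id hk"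
        using nz by (simp add: hk)
    qed
  qed (use Psi_Phi z in auto)
  then show ?thesis unfolding Phi_image z(2) .
qed

lemma Psi_partials:
  "C1_partials ({0..} \<times> UNIV) (\<lambda>w. fst (Psi w)) (\<lambda>w. - m1 (Psi w) / ((m1 (Psi w) - m2 (Psi w)) * q (Psi w)))
     (\<lambda>w. 1 / ((m1 (Psi w) - m2 (Psi w)) * q (Psi w)))"
  "C1_partials ({0..} \<times> UNIV) (\<lambda>w. snd (Psi w)) (\<lambda>w. - m2 (Psi w) / ((m1 (Psi w) - m2 (Psi w)) * p (Psi w)))
     (\<lambda>w. 1 / ((m1 (Psi w) - m2 (Psi w)) * p (Psi w)))"
proof -
  let ?S = "{0..} \<times> UNIV :: (real \<times> real) set"
  have nz: "m1 (Psi w) - m2 (Psi w) \<noteq> 0" "p (Psi w) \<noteq> 0" "q (Psi w) \<noteq> 0" if "w \<in> ?S" for w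
    using gap(1)[of "Psi w"] pq_lower[of "fst (Psi w)" "snd (Psi w)"] Psi(1)[OF that] kappa by (auto simp: wedge_def)
  have c: "continuous_on ?S (\<lambda>w. f (Psi w))" if "continuous_on UNIV f" for f :: "real \<times> real \<Rightarrow> real"
    by (rule continuous_on_compose2[OF that Psi_cont]) auto
  note cs = c[OF m_cont(1)] c[OF m_cont(2)] c[OF pq_cont(1)] c[OF pq_cont(2)]
  show "C1_partials ?S (\<lambda>w. fst (Psi w)) (\<lambda>w. - m1 (Psi w) / ((m1 (Psi w) - m2 (Psi w)) * q (Psi w)))
     (\<lambda>w. 1 / ((m1 (Psi w) - m2 (Psi w)) * q (Psi w)))"
    unfolding C1_partials_def
  proof (intro conjI ballI)
    fix w assume w: "w \<in> ?S"
    show "((\<lambda>w. fst (Psi w)) has_derivative (\<lambda>(h, k). - m1 (Psi w) / ((m1 (Psi w) - m2 (Psi w)) * q (Psi w)) * h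
        + 1 / ((m1 (Psi w) - m2 (Psi w)) * q (Psi w)) * k)) (at w within ?S)"
      by (rule has_derivative_eq_rhs[OF has_derivative_fst[OF Psi_deriv[OF w]]])
        (auto simp: fun_eq_iff diff_divide_distrib)
  qed (intro continuous_on_divide continuous_on_mult continuous_on_diff continuous_on_minus continuous_on_const cs; use nz in simp)+
  show "C1_partials ?S (\<lambda>w. snd (Psi w)) (\<lambda>w. - m2 (Psi w) / ((m1 (Psi w) - m2 (Psi w)) * p (Psi w)))
     (\<lambda>w. 1 / ((m1 (Psi w) - m2 (Psi w)) * p (Psi w)))"
    unfolding C1_partials_def
  proof (intro conjI ballI)
    fix w assume w: "w \<in> ?S"
    show "((\<lambda>w. snd (Psi w)) has_derivative (\<lambda>(h, k). - m2 (Psi w) / ((m1 (Psi w) - m2 (Psi w)) * p (Psi w)) * h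
        + 1 / ((m1 (Psi w) - m2 (Psi w)) * p (Psi w)) * k)) (at w within ?S)"
      by (rule has_derivative_eq_rhs[OF has_derivative_snd[OF Psi_deriv[OF w]]])
        (auto simp: fun_eq_iff diff_divide_distrib)
  qed (intro continuous_on_divide continuous_on_mult continuous_on_diff continuous_on_minus continuous_on_const cs; use nz in simp)+
qed

text \<open>By \<open>Psi_partials\<close> the time derivative of each foot is minus the slope times
  its space derivative, so data composed with the foot solve the transport equation. The last
  conclusion keeps the values in the box, hence away from vacuum.\<close>

lemma global_riemann_solution:
  obtains u ut ux v vt vx where
    "C1_partials ({0..} \<times> UNIV) u ut ux" "C1_partials ({0..} \<times> UNIV) v vt vx"
    "\<And>w. lam \<theta> (u w) (v w) * ut w + ux w = 0" "\<And>w. lam \<theta> (v w) (u w) * vt w + vx w = 0"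
    "\<And>x. u (0, x) = W1 x" "\<And>x. v (0, x) = W2 x" "\<And>w. \<exists>a b. u w = W1 a \<and> v w = W2 b"
proof (rule that)
  show "C1_partials ({0..} \<times> UNIV) (\<lambda>w. W1 (fst (Psi w)))
      (\<lambda>w. W1' (fst (Psi w)) * (- m1 (Psi w) / ((m1 (Psi w) - m2 (Psi w)) * q (Psi w))))
      (\<lambda>w. W1' (fst (Psi w)) * (1 / ((m1 (Psi w) - m2 (Psi w)) * q (Psi w))))"
    by (rule C1_partials_compose[OF W1_deriv W1'_cont Psi_partials(1)])
  show "C1_partials ({0..} \<times> UNIV) (\<lambda>w. W2 (snd (Psi w)))
      (\<lambda>w. W2' (snd (Psi w)) * (- m2 (Psi w) / ((m1 (Psi w) - m2 (Psi w)) * p (Psi w))))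
      (\<lambda>w. W2' (snd (Psi w)) * (1 / ((m1 (Psi w) - m2 (Psi w)) * p (Psi w))))"
    by (rule C1_partials_compose[OF W2_deriv W2'_cont Psi_partials(2)])
  have 1: "lam \<theta> (W1 (fst z)) (W2 (snd z)) * m1 z = 1" "lam \<theta> (W2 (snd z)) (W1 (fst z)) * m2 z = 1" for z
    by (simp_all add: m1_def m2_def lam_nonzero)
  have alg: "l * (c * (- m / d)) + c * (1 / d) = 0" if "l * m = 1" for l m c d :: real
  proof -
    have "l * (c * (- m / d)) + c * (1 / d) = c / d * (1 - l * m)" by (simp add: algebra_simps)
    then show ?thesis using that by simp
  qed
  show "lam \<theta> (W1 (fst (Psi w))) (W2 (snd (Psi w))) * (W1' (fst (Psi w)) * (- m1 (Psi w) / ((m1 (Psi w) - m2 (Psi w)) * q (Psi w))))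
      + W1' (fst (Psi w)) * (1 / ((m1 (Psi w) - m2 (Psi w)) * q (Psi w))) = 0"
    "lam \<theta> (W2 (snd (Psi w))) (W1 (fst (Psi w))) * (W2' (snd (Psi w)) * (- m2 (Psi w) / ((m1 (Psi w) - m2 (Psi w)) * p (Psi w))))
      + W2' (snd (Psi w)) * (1 / ((m1 (Psi w) - m2 (Psi w)) * p (Psi w))) = 0" for w
    by (rule alg, rule 1)+
  have "Psi (0, x) = (x, x)" for x
    using Psi_Phi[of "(x, x)"] by (simp add: Phi_def wedge_def)
  then show "W1 (fst (Psi (0, x))) = W1 x" "W2 (snd (Psi (0, x))) = W2 x" for x by simp_all
  show "\<exists>a b. W1 (fst (Psi w)) = W1 a \<and> W2 (snd (Psi w)) = W2 b" for w by blast
qed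

end

section \<open>The fluid equations with admissible data\<close>

text \<open>The set where the essential bound fails is open and null, hence empty.\<close>

lemma Linfty_continuous_bounded:
  assumes "Linfty f" "continuous_on UNIV f"
  obtains K where "\<And>x. \<bar>f x\<bar> \<le> K"
proof -
  obtain K where "AE x in lborel. \<bar>f x\<bar> \<le> K" using assms by (auto simp: Linfty_def)
  then obtain N where N: "{x \<in> space lborel. \<not> \<bar>f x\<bar> \<le> K} \<subseteq> N" "emeasure lborel N = 0" "N \<in> sets lborel"
    by (rule AE_E)
  then have "negligible N"
    by (simp add: negligible_iff_null_sets null_sets_completionI null_setsI)
  then have "negligible {x. K < \<bar>f x\<bar>}"
    by (rule negligible_subset) (use N(1) in \<open>auto simp: not_le\<close>)
  moreover have "open {x. K < \<bar>f x\<bar>}"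
    using assms(2) by (intro open_Collect_less continuous_intros)
  ultimately have "{x. K < \<bar>f x\<bar>} = {}" using open_not_negligible by blast
  then show ?thesis using that[of K] by (auto simp: not_less)
qed

locale admissible_data =
  fixes \<gamma> \<theta> \<kappa> a1 b1 a2 b2 :: real and \<sigma>\<^sub>0 \<beta>\<^sub>0 :: "real \<Rightarrow> real"
  assumes gamma: "1 < \<gamma>" "\<gamma> < 3" and theta_eq: "\<theta> = (\<gamma> - 1) / 2"
    and C1: "\<sigma>\<^sub>0 C1_differentiable_on UNIV" "\<beta>\<^sub>0 C1_differentiable_on UNIV" and nonneg: "\<And>x. 0 \<le> \<sigma>\<^sub>0 x"
    and range: "\<And>x. a1 \<le> w1 \<theta> \<sigma>\<^sub>0 \<beta>\<^sub>0 x" "\<And>x. w1 \<theta> \<sigma>\<^sub>0 \<beta>\<^sub>0 x \<le> b1"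
      "\<And>x. a2 \<le> w2 \<theta> \<sigma>\<^sub>0 \<beta>\<^sub>0 x" "\<And>x. w2 \<theta> \<sigma>\<^sub>0 \<beta>\<^sub>0 x \<le> b2"
    and kappa: "0 < \<kappa>"
    and box: "\<And>a b. a1 \<le> a \<Longrightarrow> a \<le> b1 \<Longrightarrow> a2 \<le> b \<Longrightarrow> b \<le> b2 \<Longrightarrow> \<kappa> \<le> lam \<theta> a b \<and> lam \<theta> b a \<le> -\<kappa>"
begin

lemma theta: "0 < \<theta>" "\<theta> < 1"
  using gamma by (auto simp: theta_eq)

definition M where "M = \<bar>a1\<bar> + \<bar>b1\<bar> + \<bar>a2\<bar> + \<bar>b2\<bar>"

lemma abs_le_M:
  "a1 \<le> a \<Longrightarrow> a \<le> b1 \<Longrightarrow> \<bar>a\<bar> \<le> M" "a2 \<le> a \<Longrightarrow> a \<le> b2 \<Longrightarrow> \<bar>a\<bar> \<le> M"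
  by (auto simp: M_def)

lemma box_gap: "a1 \<le> a \<Longrightarrow> a \<le> b1 \<Longrightarrow> a2 \<le> b \<Longrightarrow> b \<le> b2 \<Longrightarrow> 0 < \<theta> * (a - b) / 2"
  using box[of a b] lam_diff[of \<theta> a b] kappa by linarith

lemma sigma0_pos: "0 < \<sigma>\<^sub>0 x"
proof -
  have "\<sigma>\<^sub>0 x \<noteq> 0"
    using box_gap[OF range(1)[of x] range(2)[of x] range(3)[of x] range(4)[of x]] w12_diff[of \<theta> \<sigma>\<^sub>0 \<beta>\<^sub>0 x] theta by auto
  then show ?thesis using nonneg[of x] by simp
qed

lemma riemann_initial_C1:
  obtains W1' W2' where
    "\<And>x. (w1 \<theta> \<sigma>\<^sub>0 \<beta>\<^sub>0 has_real_derivative W1' x) (at x)" "continuous_on UNIV W1'"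
    "\<And>x. (w2 \<theta> \<sigma>\<^sub>0 \<beta>\<^sub>0 has_real_derivative W2' x) (at x)" "continuous_on UNIV W2'"
proof -
  obtain S where S: "\<And>x. (\<sigma>\<^sub>0 has_real_derivative S x) (at x)" "continuous_on UNIV S"
    using C1(1) by (auto simp: C1_differentiable_on_def has_real_derivative_iff_has_vector_derivative)
  obtain R where R: "\<And>x. (\<beta>\<^sub>0 has_real_derivative R x) (at x)" "continuous_on UNIV R"
    using C1(2) by (auto simp: C1_differentiable_on_def has_real_derivative_iff_has_vector_derivative)
  have "((\<lambda>x. \<sigma>\<^sub>0 x powr \<theta>) has_real_derivative \<theta> * \<sigma>\<^sub>0 x powr (\<theta> - 1) * S x) (at x)" for x
    by (rule DERIV_chain2[OF has_real_derivative_powr[OF sigma0_pos] S(1)])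
  from DERIV_cdivide[OF this, where c = \<theta>]
  have P: "((\<lambda>x. \<sigma>\<^sub>0 x powr \<theta> / \<theta>) has_real_derivative \<sigma>\<^sub>0 x powr (\<theta> - 1) * S x) (at x)" for x
    using theta by simp
  have "continuous_on UNIV \<sigma>\<^sub>0" using S(1) by (auto intro!: continuous_at_imp_continuous_on DERIV_isCont)
  then have c: "continuous_on UNIV (\<lambda>x. \<sigma>\<^sub>0 x powr (\<theta> - 1))"
    using sigma0_pos by (intro continuous_on_powr continuous_on_const) (auto simp: less_imp_neq[symmetric])
  show ?thesis
  proof (rule that)
    show "(w1 \<theta> \<sigma>\<^sub>0 \<beta>\<^sub>0 has_real_derivative R x + \<sigma>\<^sub>0 x powr (\<theta> - 1) * S x) (at x)" for x
      unfolding w1_def by (rule DERIV_add[OF R(1) P])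
    show "(w2 \<theta> \<sigma>\<^sub>0 \<beta>\<^sub>0 has_real_derivative R x - \<sigma>\<^sub>0 x powr (\<theta> - 1) * S x) (at x)" for x
      unfolding w2_def by (rule DERIV_diff[OF R(1) P])
  qed (intro continuous_on_add continuous_on_diff continuous_on_mult c S R)+
qed

lemma initial_w:
  assumes "has_initial_data \<sigma> \<beta> \<sigma>\<^sub>0 \<beta>\<^sub>0"
  shows "w1 \<theta> \<sigma> \<beta> (0, x) = w1 \<theta> \<sigma>\<^sub>0 \<beta>\<^sub>0 x" "w2 \<theta> \<sigma> \<beta> (0, x) = w2 \<theta> \<sigma>\<^sub>0 \<beta>\<^sub>0 x"
  using assms by (simp_all add: w1_def w2_def has_initial_data_def)

text \<open>Both orders with the same partial derivatives, the second with sign \<open>- 1\<close>,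
  so that every estimate for \<open>u\<close> in \<open>riemann_pair\<close> applies to
  \<open>w1\<close> and to \<open>w2\<close>.\<close>

lemma riemann_pairs:
  assumes sol: "C1_solution \<gamma> T \<sigma> \<beta>" and init: "has_initial_data \<sigma> \<beta> \<sigma>\<^sub>0 \<beta>\<^sub>0"
  shows "\<exists>ut ux vt vx. riemann_pair \<theta> \<kappa> M T 1 (w1 \<theta> \<sigma> \<beta>) ut ux (w2 \<theta> \<sigma> \<beta>) vt vx \<and>
    riemann_pair \<theta> \<kappa> M T (- 1) (w2 \<theta> \<sigma> \<beta>) vt vx (w1 \<theta> \<sigma> \<beta>) ut ux"
proof -
  obtain \<sigma>t \<sigma>x \<beta>t \<beta>x where "C1_partials ({0..<T} \<times> UNIV) \<sigma> \<sigma>t \<sigma>x" "C1_partials ({0..<T} \<times> UNIV) \<beta> \<beta>t \<beta>x"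
    using sol by (auto simp: C1_solution_def C1_on_iff)
  then interpret fluid_solution \<gamma> \<theta> T \<sigma> \<beta> \<sigma>t \<sigma>x \<beta>t \<beta>x
    using gamma theta_eq sol by unfold_locales
  have "a1 \<le> w1 \<theta> \<sigma> \<beta> (0, x)" "w1 \<theta> \<sigma> \<beta> (0, x) \<le> b1" "a2 \<le> w2 \<theta> \<sigma> \<beta> (0, x)" "w2 \<theta> \<sigma> \<beta> (0, x) \<le> b2" for x
    unfolding initial_w[OF init] by (rule range)+
  note region = invariant_region[OF this box kappa]
  note partials = w_partials[OF region(1)]
  show ?thesis
  proof (intro exI conjI)
    show "riemann_pair \<theta> \<kappa> M T 1 (w1 \<theta> \<sigma> \<beta>) w1t w1x (w2 \<theta> \<sigma> \<beta>) w2t w2x"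
      using theta kappa partials riemann_equations region box abs_le_M
      by unfold_locales auto
    show "riemann_pair \<theta> \<kappa> M T (- 1) (w2 \<theta> \<sigma> \<beta>) w2t w2x (w1 \<theta> \<sigma> \<beta>) w1t w1x"
      using theta kappa partials riemann_equations region box abs_le_M
      by unfold_locales (auto simp: minus_le_iff le_minus_iff)
  qed
qed

lemma solution_unique:
  assumes "C1_solution \<gamma> T \<sigma> \<beta>" "has_initial_data \<sigma> \<beta> \<sigma>\<^sub>0 \<beta>\<^sub>0"
    and "C1_solution \<gamma> T \<sigma>' \<beta>'" "has_initial_data \<sigma>' \<beta>' \<sigma>\<^sub>0 \<beta>\<^sub>0" and t: "0 \<le> t" "t < T"
  shows "\<sigma>' (t, x) = \<sigma> (t, x) \<and> \<beta>' (t, x) = \<beta> (t, x)"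
proof -
  obtain ut ux vt vx where P: "riemann_pair \<theta> \<kappa> M T 1 (w1 \<theta> \<sigma> \<beta>) ut ux (w2 \<theta> \<sigma> \<beta>) vt vx"
    using riemann_pairs[OF assms(1,2)] by blast
  obtain ut' ux' vt' vx' where Q: "riemann_pair \<theta> \<kappa> M T 1 (w1 \<theta> \<sigma>' \<beta>') ut' ux' (w2 \<theta> \<sigma>' \<beta>') vt' vx'"
    using riemann_pairs[OF assms(3,4)] by blast
  have w: "w1 \<theta> \<sigma> \<beta> (t, x) = w1 \<theta> \<sigma>' \<beta>' (t, x)" "w2 \<theta> \<sigma> \<beta> (t, x) = w2 \<theta> \<sigma>' \<beta>' (t, x)"
    using riemann_unique[OF P Q _ _ t] by (simp_all add: initial_w[OF assms(2)] initial_w[OF assms(4)])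
  have "0 \<le> \<sigma> (t, x)" "0 \<le> \<sigma>' (t, x)" using assms t by (auto simp: C1_solution_def)
  then show ?thesis
    using w12_inverse[of \<theta> \<sigma> "(t, x)" \<beta>] w12_inverse[of \<theta> \<sigma>' "(t, x)" \<beta>'] theta(1) w by simp
qed

lemma one_sided_bound:
  obtains C where "0 < C"
    "\<And>T \<sigma> \<beta> t x. C1_solution \<gamma> T \<sigma> \<beta> \<Longrightarrow> has_initial_data \<sigma> \<beta> \<sigma>\<^sub>0 \<beta>\<^sub>0 \<Longrightarrow> 0 < t \<Longrightarrow> t < T \<Longrightarrow>
      - C / t \<le> dx (w1 \<theta> \<sigma> \<beta>) t x \<and> - C / t \<le> dx (w2 \<theta> \<sigma> \<beta>) t x"
proof -
  \<comment> \<open>\<open>growth\<close> and the bound of \<open>weight_lower\<close> with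
    \<open>M\<close> in place of \<open>B\<close>, written out before any solution is given, so that
    the constant depends on the data alone.\<close>
  define G where "G = (1 + \<theta>) / 2 * (2 * \<kappa> / \<theta>) powr ((1 - \<theta>) / (2 * \<theta>)) / M"
  define W where "W = (2 * M) powr - ((1 - \<theta>) / (2 * \<theta>)) / M"
  have main: "- (2 / G / W) / t \<le> dx u t x" if "riemann_pair \<theta> \<kappa> M T s u ut ux v vt vx" "0 < t" "t < T"
    for T s u ut ux v vt vx t x
  proof -
    interpret riemann_pair \<theta> \<kappa> M T s u ut ux v vt vx by (rule that(1))
    have t: "0 \<le> t" "0 < T" using that by auto
    have "dx u t x = ux (t, x)"
      unfolding dx_def by (rule DERIV_imp_deriv[OF C1_partials_dx[OF u_partials t(1) that(3)]])
    moreover have "- (2 / growth) / (weight (t, x) * t) \<le> ux (t, x)" by (rule lower_bound[OF that(2,3)])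
    moreover have "- (2 / G / W) / t \<le> - (2 / growth) / (weight (t, x) * t)"
    proof -
      have W: "0 < W" "W \<le> weight (t, x)" using B_pos[OF t(2)] weight_lower[OF t(1) that(3)] by (auto simp: W_def)
      have g: "growth = G" by (simp add: growth_def G_def)
      have "2 / growth / (weight (t, x) * t) \<le> 2 / growth / (W * t)"
        using W growth_pos[OF t(2)] that by (intro divide_left_mono mult_right_mono) auto
      then show ?thesis by (simp add: g)
    qed
    ultimately show ?thesis by linarith
  qed
  have "0 < M"
  proof -
    have "\<bar>lam \<theta> (w1 \<theta> \<sigma>\<^sub>0 \<beta>\<^sub>0 0) (w2 \<theta> \<sigma>\<^sub>0 \<beta>\<^sub>0 0) - lam \<theta> 0 0\<bar> \<le> M"
      by (rule lam_lipschitz[OF theta]) (use abs_le_M range in auto)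
    moreover have "lam \<theta> 0 0 = 0" by (simp add: lam_def)
    ultimately show ?thesis using box[OF range(1)[of 0] range(2)[of 0] range(3)[of 0] range(4)[of 0]] kappa by linarith
  qed
  then have "0 < 2 / G / W" using theta kappa by (simp add: G_def W_def)
  then show ?thesis
  proof (rule that)
    fix T \<sigma> \<beta> t x
    assume "C1_solution \<gamma> T \<sigma> \<beta>" "has_initial_data \<sigma> \<beta> \<sigma>\<^sub>0 \<beta>\<^sub>0" and t: "0 < t" "t < T"
    then obtain ut ux vt vx where
      P: "riemann_pair \<theta> \<kappa> M T 1 (w1 \<theta> \<sigma> \<beta>) ut ux (w2 \<theta> \<sigma> \<beta>) vt vx"
        "riemann_pair \<theta> \<kappa> M T (- 1) (w2 \<theta> \<sigma> \<beta>) vt vx (w1 \<theta> \<sigma> \<beta>) ut ux"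
      using riemann_pairs by blast
    show "- (2 / G / W) / t \<le> dx (w1 \<theta> \<sigma> \<beta>) t x \<and> - (2 / G / W) / t \<le> dx (w2 \<theta> \<sigma> \<beta>) t x"
      using main[OF P(1) t] main[OF P(2) t] by blast
  qed
qed

lemma global_imp_monotone:
  assumes "global_C1_solution \<gamma> \<sigma> \<beta>" and init: "has_initial_data \<sigma> \<beta> \<sigma>\<^sub>0 \<beta>\<^sub>0"
  shows "deriv (w1 \<theta> \<sigma>\<^sub>0 \<beta>\<^sub>0) x \<le> 0" "deriv (w2 \<theta> \<sigma>\<^sub>0 \<beta>\<^sub>0) x \<le> 0"
proof -
  obtain W1' W2' where d: "\<And>x. (w1 \<theta> \<sigma>\<^sub>0 \<beta>\<^sub>0 has_real_derivative W1' x) (at x)" "continuous_on UNIV W1'"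
    "\<And>x. (w2 \<theta> \<sigma>\<^sub>0 \<beta>\<^sub>0 has_real_derivative W2' x) (at x)" "continuous_on UNIV W2'"
    by (rule riemann_initial_C1) (rule that)
  have sol: "C1_solution \<gamma> T \<sigma> \<beta>" if "0 < T" for T
    using assms(1) that by (auto simp: global_C1_solution_def)
  have "\<exists>ut ux vt vx. riemann_pair \<theta> \<kappa> M T 1 (w1 \<theta> \<sigma> \<beta>) ut ux (w2 \<theta> \<sigma> \<beta>) vt vx"
    "\<exists>ut ux vt vx. riemann_pair \<theta> \<kappa> M T (- 1) (w2 \<theta> \<sigma> \<beta>) ut ux (w1 \<theta> \<sigma> \<beta>) vt vx" if "0 < T" for T
    using riemann_pairs[OF sol[OF that] init] by blast+
  note pairs = this
  have "W1' x \<le> 0" by (rule no_growth[OF pairs(1)]) (use d(1) in \<open>simp_all add: initial_w[OF init]\<close>)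
  moreover have "W2' x \<le> 0" by (rule no_growth[OF pairs(2)]) (use d(3) in \<open>simp_all add: initial_w[OF init]\<close>)
  ultimately show "deriv (w1 \<theta> \<sigma>\<^sub>0 \<beta>\<^sub>0) x \<le> 0" "deriv (w2 \<theta> \<sigma>\<^sub>0 \<beta>\<^sub>0) x \<le> 0"
    using DERIV_imp_deriv[OF d(1)] DERIV_imp_deriv[OF d(3)] by simp_all
qed

lemma monotone_imp_global:
  assumes "\<And>x. deriv (w1 \<theta> \<sigma>\<^sub>0 \<beta>\<^sub>0) x \<le> 0" "\<And>x. deriv (w2 \<theta> \<sigma>\<^sub>0 \<beta>\<^sub>0) x \<le> 0"
  shows "\<exists>\<sigma> \<beta>. global_C1_solution \<gamma> \<sigma> \<beta> \<and> has_initial_data \<sigma> \<beta> \<sigma>\<^sub>0 \<beta>\<^sub>0"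
proof -
  obtain W1' W2' where
    W1: "\<And>x. (w1 \<theta> \<sigma>\<^sub>0 \<beta>\<^sub>0 has_real_derivative W1' x) (at x)" "continuous_on UNIV W1'" and
    W2: "\<And>x. (w2 \<theta> \<sigma>\<^sub>0 \<beta>\<^sub>0 has_real_derivative W2' x) (at x)" "continuous_on UNIV W2'"
    by (rule riemann_initial_C1) (rule that)
  interpret rarefaction_data \<theta> \<kappa> M "w1 \<theta> \<sigma>\<^sub>0 \<beta>\<^sub>0" "w2 \<theta> \<sigma>\<^sub>0 \<beta>\<^sub>0" W1' W2'
  proof
    show "W1' x \<le> 0" "W2' x \<le> 0" for x
      using assms[of x] DERIV_imp_deriv[OF W1(1)] DERIV_imp_deriv[OF W2(1)] by auto
    show "\<kappa> \<le> lam \<theta> (w1 \<theta> \<sigma>\<^sub>0 \<beta>\<^sub>0 x) (w2 \<theta> \<sigma>\<^sub>0 \<beta>\<^sub>0 y)" "lam \<theta> (w2 \<theta> \<sigma>\<^sub>0 \<beta>\<^sub>0 y) (w1 \<theta> \<sigma>\<^sub>0 \<beta>\<^sub>0 x) \<le> - \<kappa>" for x y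
      using box[OF range(1)[of x] range(2)[of x] range(3)[of y] range(4)[of y]] by auto
  qed (use theta kappa W1 W2 range abs_le_M in auto)
  obtain u ut ux v vt vx where
    u: "C1_partials ({0..} \<times> UNIV) u ut ux" and v: "C1_partials ({0..} \<times> UNIV) v vt vx"
    and eqs: "\<And>w. lam \<theta> (u w) (v w) * ut w + ux w = 0" "\<And>w. lam \<theta> (v w) (u w) * vt w + vx w = 0"
    and init: "\<And>x. u (0, x) = w1 \<theta> \<sigma>\<^sub>0 \<beta>\<^sub>0 x" "\<And>x. v (0, x) = w2 \<theta> \<sigma>\<^sub>0 \<beta>\<^sub>0 x"
    and ran: "\<And>w. \<exists>a b. u w = w1 \<theta> \<sigma>\<^sub>0 \<beta>\<^sub>0 a \<and> v w = w2 \<theta> \<sigma>\<^sub>0 \<beta>\<^sub>0 b"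
    by (rule global_riemann_solution) (rule that)
  let ?S = "{0..} \<times> UNIV :: (real \<times> real) set"
  define y where "y w = \<theta> * (u w - v w) / 2" for w
  have y: "0 < y w" for w
    using ran[of w] range box_gap by (auto simp: y_def)
  define \<sigma> where "\<sigma> w = y w powr (1 / \<theta>)" for w
  define \<beta> where "\<beta> w = (u w + v w) / 2" for w
  define \<sigma>t where "\<sigma>t w = y w powr (1 / \<theta> - 1) * ((ut w - vt w) / 2)" for w
  define \<sigma>x where "\<sigma>x w = y w powr (1 / \<theta> - 1) * ((ux w - vx w) / 2)" for w
  define \<beta>t where "\<beta>t w = (ut w + vt w) / 2" for w
  define \<beta>x where "\<beta>x w = (ux w + vx w) / 2" for w
  have du: "(u has_derivative (\<lambda>(h, k). ut w * h + ux w * k)) (at w within ?S)"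
    and dv: "(v has_derivative (\<lambda>(h, k). vt w * h + vx w * k)) (at w within ?S)" if "w \<in> ?S" for w
    using that u v unfolding C1_partials_def by blast+
  have cy: "continuous_on ?S y"
    unfolding y_def using C1_partials_continuous[OF u] C1_partials_continuous[OF v]
    by (intro continuous_on_divide continuous_on_mult continuous_on_diff continuous_on_const) auto
  have "continuous_on ?S (\<lambda>w. y w powr (1 / \<theta> - 1))"
    using y by (intro continuous_on_powr cy continuous_on_const) (auto simp: less_imp_neq[symmetric])
  then have cont: "continuous_on ?S \<sigma>t" "continuous_on ?S \<sigma>x" "continuous_on ?S \<beta>t" "continuous_on ?S \<beta>x"
    unfolding \<sigma>t_def \<sigma>x_def \<beta>t_def \<beta>x_def using u v
    by (auto simp: C1_partials_def intro!: continuous_on_mult continuous_on_divide continuous_on_diff continuous_on_add continuous_on_const)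
  have "(\<sigma> has_derivative (\<lambda>(h, k). \<sigma>t w * h + \<sigma>x w * k)) (at w within ?S)" if w: "w \<in> ?S" for w
  proof -
    have "(y has_derivative (\<lambda>hk. \<theta> * ((case hk of (h, k) \<Rightarrow> ut w * h + ux w * k) - (case hk of (h, k) \<Rightarrow> vt w * h + vx w * k)) / 2)) (at w within ?S)"
      unfolding y_def
      by (intro bounded_linear.has_derivative[OF bounded_linear_divide] bounded_linear.has_derivative[OF bounded_linear_mult_right]
          has_derivative_diff du[OF w] dv[OF w])
    moreover have "((\<lambda>y. y powr (1 / \<theta>)) has_derivative (\<lambda>h. (1 / \<theta>) * y w powr (1 / \<theta> - 1) * h)) (at (y w))"
      by (rule has_real_derivative_powr[OF y, unfolded has_field_derivative_def])
    ultimately have "((\<lambda>w. y w powr (1 / \<theta>)) has_derivative (\<lambda>hk. (1 / \<theta>) * y w powr (1 / \<theta> - 1) *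
        (\<theta> * ((case hk of (h, k) \<Rightarrow> ut w * h + ux w * k) - (case hk of (h, k) \<Rightarrow> vt w * h + vx w * k)) / 2))) (at w within ?S)"
      by (rule has_derivative_compose)
    then show ?thesis
      unfolding \<sigma>_def \<sigma>t_def \<sigma>x_def
      by (rule has_derivative_eq_rhs) (use theta in \<open>auto simp: fun_eq_iff field_simps\<close>)
  qed
  then have p\<sigma>: "C1_partials ?S \<sigma> \<sigma>t \<sigma>x" using cont by (auto simp: C1_partials_def)
  have "(\<beta> has_derivative (\<lambda>(h, k). \<beta>t w * h + \<beta>x w * k)) (at w within ?S)" if w: "w \<in> ?S" for w
    unfolding \<beta>_def \<beta>t_def \<beta>x_def
    by (rule has_derivative_eq_rhs[OF bounded_linear.has_derivative[OF bounded_linear_divide has_derivative_add[OF du[OF w] dv[OF w]]]])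
      (auto simp: fun_eq_iff field_simps)
  then have p\<beta>: "C1_partials ?S \<beta> \<beta>t \<beta>x" using cont by (auto simp: C1_partials_def)
  have pos: "0 < \<sigma> w" for w using y[of w] by (simp add: \<sigma>_def)
  have sol: "C1_solution \<gamma> T \<sigma> \<beta>" if "0 < T" for T
  proof -
    have "{0..<T} \<times> UNIV \<subseteq> ?S" by auto
    note p = C1_partials_subset[OF p\<sigma> this] C1_partials_subset[OF p\<beta> this]
    have "dt (\<lambda>p. \<sigma> p * \<beta> p) t x + dx \<sigma> t x = 0 \<and>
        dt (\<lambda>p. inverse \<gamma> * \<sigma> p powr \<gamma> + \<sigma> p * (\<beta> p)\<^sup>2) t x + dx (\<lambda>p. \<sigma> p * \<beta> p) t x = 0"
      if t: "t \<in> {0<..<T}" for t x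
    proof -
      define s b st sx bt bx r where "s = \<sigma> (t, x)" and "b = \<beta> (t, x)" and "st = \<sigma>t (t, x)" and "sx = \<sigma>x (t, x)"
        and "bt = \<beta>t (t, x)" and "bx = \<beta>x (t, x)" and "r = s powr (\<theta> - 1)"
      note defs = this
      have s0: "0 < s" "0 < r" using pos[of "(t, x)"] by (auto simp: defs)
      have sy: "s powr \<theta> = y (t, x)" using theta y[of "(t, x)"] by (simp add: defs \<sigma>_def powr_powr)
      have r: "s powr \<theta> = s * r" "s powr (\<gamma> - 1) = s\<^sup>2 * r\<^sup>2"
        using s0 powr_add[of s 1 "\<theta> - 1"] powr_add[of s \<theta> \<theta>]
        by (auto simp: r_def theta_eq power2_eq_square)
      \<comment> \<open>By \<open>sy\<close> the second factor is
        \<open>s powr (1 - \<theta>)\<close>, the inverse of \<open>r\<close>.\<close>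
      have ry: "r * y (t, x) powr (1 / \<theta> - 1) = 1"
        unfolding r_def sy[symmetric] powr_powr
        using s0 theta by (simp add: powr_add[symmetric] field_simps)
      have "r * st = r * y (t, x) powr (1 / \<theta> - 1) * ((ut (t, x) - vt (t, x)) / 2)"
        "r * sx = r * y (t, x) powr (1 / \<theta> - 1) * ((ux (t, x) - vx (t, x)) / 2)"
        by (simp_all add: defs \<sigma>t_def \<sigma>x_def)
      then have rs: "r * st = (ut (t, x) - vt (t, x)) / 2" "r * sx = (ux (t, x) - vx (t, x)) / 2"
        unfolding ry by simp_all
      have l: "lam \<theta> (u (t, x)) (v (t, x)) = b + s * r" "lam \<theta> (v (t, x)) (u (t, x)) = b - s * r"
        unfolding r(1)[symmetric] sy by (simp_all add: lam_def y_def defs \<beta>_def field_simps)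
      have ub: "ut (t, x) = bt + r * st" "ux (t, x) = bx + r * sx" "vt (t, x) = bt - r * st" "vx (t, x) = bx - r * sx"
        unfolding rs by (simp_all add: defs \<beta>t_def \<beta>x_def field_simps)
      have e: "(b + s * r) * (bt + r * st) + (bx + r * sx) = 0" "(b - s * r) * (bt - r * st) + (bx - r * sx) = 0"
        using eqs[of "(t, x)"] unfolding l ub by auto
      \<comment> \<open>The derivation in \<open>riemann_equations\<close> reversed: the difference
        of the two transport equations is \<open>2 * r\<close> times the first fluid equation, and
        their sum is twice the reduced second one.\<close>
      then have "r * (st * b + s * bt + sx) = 0" by algebra
      then have 1: "st * b + s * bt + sx = 0" using s0 by simp
      have "2 * (s * r\<^sup>2 * st + b * bt + bx) = 0" using e by algebra
      then have 2: "s * r\<^sup>2 * st + b * bt + bx = 0" by simp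
      have 3: "s\<^sup>2 * r\<^sup>2 * st + (st * b\<^sup>2 + s * (2 * b * bt)) + (sx * b + s * bx) = 0" using 1 2 by algebra
      show ?thesis
        using fluid_derivatives[OF p _ _ pos, of t \<gamma> x] t gamma 1 3
        unfolding r(2)[symmetric] by (simp add: defs)
    qed
    then show ?thesis
      using p pos unfolding C1_solution_def C1_on_iff by (blast intro: less_imp_le)
  qed
  have "\<sigma> (0, x) = \<sigma>\<^sub>0 x" "\<beta> (0, x) = \<beta>\<^sub>0 x" for x
    using w12_inverse[of \<theta> \<sigma>\<^sub>0 x \<beta>\<^sub>0] theta nonneg[of x] unfolding \<sigma>_def \<beta>_def y_def init by auto
  then show ?thesis
    using sol by (intro exI[of _ \<sigma>] exI[of _ \<beta>]) (simp add: global_C1_solution_def has_initial_data_def)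
qed

end

theorem theorem2p2:
  fixes \<gamma> \<theta> :: real and \<sigma>\<^sub>0 \<beta>\<^sub>0 :: "real \<Rightarrow> real"
  assumes "1 < \<gamma>" and "\<gamma> < 3" and "\<theta> = (\<gamma> - 1) / 2"
    and "Linfty \<sigma>\<^sub>0" and "Linfty \<beta>\<^sub>0"
    and "\<sigma>\<^sub>0 C1_differentiable_on UNIV" and "\<beta>\<^sub>0 C1_differentiable_on UNIV"
    and "\<forall>x. \<sigma>\<^sub>0 x \<ge> 0"
    and "(INF x. w1 \<theta> \<sigma>\<^sub>0 \<beta>\<^sub>0 x) > 0" and "0 > (SUP x. w2 \<theta> \<sigma>\<^sub>0 \<beta>\<^sub>0 x)"
    and "((SUP x. w1 \<theta> \<sigma>\<^sub>0 \<beta>\<^sub>0 x) - \<theta> * (INF x. w1 \<theta> \<sigma>\<^sub>0 \<beta>\<^sub>0 x))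
           + (1 + \<theta>) * (SUP x. w2 \<theta> \<sigma>\<^sub>0 \<beta>\<^sub>0 x) < 0"
    and "(1 + \<theta>) * (INF x. w1 \<theta> \<sigma>\<^sub>0 \<beta>\<^sub>0 x)
           - (\<theta> * (SUP x. w2 \<theta> \<sigma>\<^sub>0 \<beta>\<^sub>0 x) - (INF x. w2 \<theta> \<sigma>\<^sub>0 \<beta>\<^sub>0 x)) > 0"
  shows
    "((\<exists>\<sigma> \<beta>. global_C1_solution \<gamma> \<sigma> \<beta> \<and> has_initial_data \<sigma> \<beta> \<sigma>\<^sub>0 \<beta>\<^sub>0 \<and>
         (\<forall>\<sigma>' \<beta>'. global_C1_solution \<gamma> \<sigma>' \<beta>' \<and> has_initial_data \<sigma>' \<beta>' \<sigma>\<^sub>0 \<beta>\<^sub>0 \<longrightarrow>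
            (\<forall>t\<ge>0. \<forall>x. \<sigma>' (t, x) = \<sigma> (t, x) \<and> \<beta>' (t, x) = \<beta> (t, x))))
      \<longleftrightarrow> (\<forall>x. deriv (w1 \<theta> \<sigma>\<^sub>0 \<beta>\<^sub>0) x \<le> 0 \<and> deriv (w2 \<theta> \<sigma>\<^sub>0 \<beta>\<^sub>0) x \<le> 0))
     \<and>
     (\<not> (\<forall>x. deriv (w1 \<theta> \<sigma>\<^sub>0 \<beta>\<^sub>0) x \<le> 0 \<and> deriv (w2 \<theta> \<sigma>\<^sub>0 \<beta>\<^sub>0) x \<le> 0) \<longrightarrow>
        (\<exists>C>0. \<forall>t>0. ereal t < C1_lifespan \<gamma> \<sigma>\<^sub>0 \<beta>\<^sub>0 \<longrightarrow>
           (\<forall>T \<sigma> \<beta>. t < T \<and> C1_solution \<gamma> T \<sigma> \<beta> \<and> has_initial_data \<sigma> \<beta> \<sigma>\<^sub>0 \<beta>\<^sub>0 \<longrightarrow>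
              (INF x. ereal (dx (w1 \<theta> \<sigma> \<beta>) t x)) \<ge> ereal (- C / t) \<and>
              (INF x. ereal (dx (w2 \<theta> \<sigma> \<beta>) t x)) \<ge> ereal (- C / t))))"
proof -
  have theta: "0 < \<theta>" "\<theta> < 1" using assms(1-3) by auto
  define a1 where "a1 = (INF x. w1 \<theta> \<sigma>\<^sub>0 \<beta>\<^sub>0 x)"
  define b1 where "b1 = (SUP x. w1 \<theta> \<sigma>\<^sub>0 \<beta>\<^sub>0 x)"
  define a2 where "a2 = (INF x. w2 \<theta> \<sigma>\<^sub>0 \<beta>\<^sub>0 x)"
  define b2 where "b2 = (SUP x. w2 \<theta> \<sigma>\<^sub>0 \<beta>\<^sub>0 x)"
  have "continuous_on UNIV \<sigma>\<^sub>0" "continuous_on UNIV \<beta>\<^sub>0"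
    using assms(6,7) by (auto intro: C1_differentiable_imp_continuous_on)
  then obtain K L where K: "\<And>x. \<bar>\<sigma>\<^sub>0 x\<bar> \<le> K" and L: "\<And>x. \<bar>\<beta>\<^sub>0 x\<bar> \<le> L"
    using Linfty_continuous_bounded assms(4,5) by metis
  have "\<bar>w1 \<theta> \<sigma>\<^sub>0 \<beta>\<^sub>0 x\<bar> \<le> L + K powr \<theta> / \<theta>" "\<bar>w2 \<theta> \<sigma>\<^sub>0 \<beta>\<^sub>0 x\<bar> \<le> L + K powr \<theta> / \<theta>" for x
  proof -
    have "\<sigma>\<^sub>0 x powr \<theta> / \<theta> \<le> K powr \<theta> / \<theta>"
      using K[of x] assms(8) theta by (intro divide_right_mono powr_mono2) auto
    moreover have "0 \<le> \<sigma>\<^sub>0 x powr \<theta> / \<theta>" using theta by simp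
    ultimately show "\<bar>w1 \<theta> \<sigma>\<^sub>0 \<beta>\<^sub>0 x\<bar> \<le> L + K powr \<theta> / \<theta>" "\<bar>w2 \<theta> \<sigma>\<^sub>0 \<beta>\<^sub>0 x\<bar> \<le> L + K powr \<theta> / \<theta>"
      using L[of x] unfolding w1_def w2_def by linarith+
  qed
  then have "bounded (range (w1 \<theta> \<sigma>\<^sub>0 \<beta>\<^sub>0))" "bounded (range (w2 \<theta> \<sigma>\<^sub>0 \<beta>\<^sub>0))"
    by (auto simp: bounded_iff)
  note bdd = this[THEN bounded_imp_bdd_above] this[THEN bounded_imp_bdd_below]
  have range: "a1 \<le> w1 \<theta> \<sigma>\<^sub>0 \<beta>\<^sub>0 x" "w1 \<theta> \<sigma>\<^sub>0 \<beta>\<^sub>0 x \<le> b1" "a2 \<le> w2 \<theta> \<sigma>\<^sub>0 \<beta>\<^sub>0 x" "w2 \<theta> \<sigma>\<^sub>0 \<beta>\<^sub>0 x \<le> b2" for x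
    unfolding a1_def b1_def a2_def b2_def using bdd by (auto intro: cINF_lower cSUP_upper)
  \<comment> \<open>Bounds the extreme speeds \<open>lam \<theta> a1 a2\<close> and
    \<open>- lam \<theta> b2 b1\<close> of the box from below:
    \<open>a2 - \<theta> * b2 \<le> (1 - \<theta>) * a2\<close> because \<open>a2 \<le> b2\<close>,
    and \<open>(1 - \<theta>) * b1 \<le> b1 - \<theta> * a1\<close> because
    \<open>a1 \<le> b1\<close>. The last two hypotheses of the theorem say that it is
    positive.\<close>
  define \<kappa> where "\<kappa> = min (((1 + \<theta>) * a1 - (\<theta> * b2 - a2)) / 2) (- ((b1 - \<theta> * a1) + (1 + \<theta>) * b2) / 2)"
  have "0 < \<kappa>" using assms(11,12) by (auto simp: \<kappa>_def a1_def b1_def a2_def b2_def)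
  have box: "\<kappa> \<le> lam \<theta> a b \<and> lam \<theta> b a \<le> - \<kappa>" if "a1 \<le> a" "a \<le> b1" "a2 \<le> b" "b \<le> b2" for a b
  proof -
    have "(1 + \<theta>) * a1 \<le> (1 + \<theta>) * a" "(1 - \<theta>) * a2 \<le> (1 - \<theta>) * b" "(1 + \<theta>) * b \<le> (1 + \<theta>) * b2" "(1 - \<theta>) * a \<le> (1 - \<theta>) * b1"
      "\<theta> * a2 \<le> \<theta> * b2" "\<theta> * a1 \<le> \<theta> * b1"
      using that theta by (intro mult_left_mono; simp)+
    moreover have "(1 - \<theta>) * a2 = a2 - \<theta> * a2" "(1 - \<theta>) * b1 = b1 - \<theta> * b1" by (simp_all add: algebra_simps)
    moreover have "\<kappa> \<le> ((1 + \<theta>) * a1 - (\<theta> * b2 - a2)) / 2" "\<kappa> \<le> - ((b1 - \<theta> * a1) + (1 + \<theta>) * b2) / 2"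
      unfolding \<kappa>_def by (rule min.cobounded1 min.cobounded2)+
    ultimately have "\<kappa> \<le> ((1 + \<theta>) * a + (1 - \<theta>) * b) / 2" "((1 + \<theta>) * b + (1 - \<theta>) * a) / 2 \<le> - \<kappa>"
      by argo+
    then show ?thesis by (simp add: lam_def)
  qed
  interpret admissible_data \<gamma> \<theta> \<kappa> a1 b1 a2 b2 \<sigma>\<^sub>0 \<beta>\<^sub>0
    by unfold_locales (use assms(1-3,6-8) range \<open>0 < \<kappa>\<close> box in auto)
  let ?mono = "\<forall>x. deriv (w1 \<theta> \<sigma>\<^sub>0 \<beta>\<^sub>0) x \<le> 0 \<and> deriv (w2 \<theta> \<sigma>\<^sub>0 \<beta>\<^sub>0) x \<le> 0"
  show ?thesis
  proof (intro conjI iffI impI)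
    assume "\<exists>\<sigma> \<beta>. global_C1_solution \<gamma> \<sigma> \<beta> \<and> has_initial_data \<sigma> \<beta> \<sigma>\<^sub>0 \<beta>\<^sub>0 \<and>
         (\<forall>\<sigma>' \<beta>'. global_C1_solution \<gamma> \<sigma>' \<beta>' \<and> has_initial_data \<sigma>' \<beta>' \<sigma>\<^sub>0 \<beta>\<^sub>0 \<longrightarrow>
            (\<forall>t\<ge>0. \<forall>x. \<sigma>' (t, x) = \<sigma> (t, x) \<and> \<beta>' (t, x) = \<beta> (t, x)))"
    then show ?mono using global_imp_monotone by blast
  next
    assume ?mono
    then obtain \<sigma> \<beta> where sol: "global_C1_solution \<gamma> \<sigma> \<beta>" "has_initial_data \<sigma> \<beta> \<sigma>\<^sub>0 \<beta>\<^sub>0"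
      using monotone_imp_global by blast
    have "\<sigma>' (t, x) = \<sigma> (t, x) \<and> \<beta>' (t, x) = \<beta> (t, x)"
      if "global_C1_solution \<gamma> \<sigma>' \<beta>'" "has_initial_data \<sigma>' \<beta>' \<sigma>\<^sub>0 \<beta>\<^sub>0" "0 \<le> t" for \<sigma>' \<beta>' t x
    proof (rule solution_unique)
      show "C1_solution \<gamma> (t + 1) \<sigma> \<beta>" "C1_solution \<gamma> (t + 1) \<sigma>' \<beta>'"
        using sol that by (auto simp: global_C1_solution_def)
    qed (use sol that in auto)
    with sol show "\<exists>\<sigma> \<beta>. global_C1_solution \<gamma> \<sigma> \<beta> \<and> has_initial_data \<sigma> \<beta> \<sigma>\<^sub>0 \<beta>\<^sub>0 \<and>
         (\<forall>\<sigma>' \<beta>'. global_C1_solution \<gamma> \<sigma>' \<beta>' \<and> has_initial_data \<sigma>' \<beta>' \<sigma>\<^sub>0 \<beta>\<^sub>0 \<longrightarrow>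
            (\<forall>t\<ge>0. \<forall>x. \<sigma>' (t, x) = \<sigma> (t, x) \<and> \<beta>' (t, x) = \<beta> (t, x)))"
      by blast
  next
    obtain C where C: "0 < C"
      "\<And>T \<sigma> \<beta> t x. C1_solution \<gamma> T \<sigma> \<beta> \<Longrightarrow> has_initial_data \<sigma> \<beta> \<sigma>\<^sub>0 \<beta>\<^sub>0 \<Longrightarrow> 0 < t \<Longrightarrow> t < T \<Longrightarrow>
        - C / t \<le> dx (w1 \<theta> \<sigma> \<beta>) t x \<and> - C / t \<le> dx (w2 \<theta> \<sigma> \<beta>) t x"
      by (rule one_sided_bound) (rule that)
    show "\<exists>C>0. \<forall>t>0. ereal t < C1_lifespan \<gamma> \<sigma>\<^sub>0 \<beta>\<^sub>0 \<longrightarrow>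
           (\<forall>T \<sigma> \<beta>. t < T \<and> C1_solution \<gamma> T \<sigma> \<beta> \<and> has_initial_data \<sigma> \<beta> \<sigma>\<^sub>0 \<beta>\<^sub>0 \<longrightarrow>
              (INF x. ereal (dx (w1 \<theta> \<sigma> \<beta>) t x)) \<ge> ereal (- C / t) \<and>
              (INF x. ereal (dx (w2 \<theta> \<sigma> \<beta>) t x)) \<ge> ereal (- C / t))"
      by (intro exI[of _ C] conjI C(1) allI impI INF_greatest; use C(2) in force)
  qed
qed

end
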